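(* Consider the generalized incremental knapsack problem (defined in the context). For any accuracy level $\epsilon\in(0,1)$, there is an algorithm that, on every instance, computes a feasible chain whose profit is at least $(1-\epsilon)$ times the maximum profit of a feasible chain, in time $O\big((nT)^{O(\frac{1}{\epsilon^{5}}\cdot\log(n\cdot \frac{w_{\max}}{w_{\min}}))}\cdot|\mathcal{I}|^{O(1)}\big)$, where $w_{\max}=\max_i w_i$, $w_{\min}=\min_i w_i$, and $|\mathcal{I}|=\Theta(n\log \|w\|_{\infty} + nT\log \|p\|_{\infty} + T\log \|W\|_{\infty})$ is the input size.
   Context: Generalized incremental knapsack: we are given $n$ items with strictly positive weights $w_1,\dots,w_n$, $T$ time periods with non-decreasing capacities $W_1 \le \cdots \le W_T$, and non-negative profits $p_{it}$ for $i\in[n]$, $t\in[T]$. A chain is a sequence $\mathcal{S}=(S_1,\dots,S_T)$ with $S_1\subseteq\cdots\subseteq S_T\subseteq[n]$; it is feasible if $w(S_t)=\sum_{i\in S_t}w_i\le W_t$ for every $t\in[T]$. Its profit is $\Phi(\mathcal{S})=\sum_{t\in[T]}\sum_{i\in S_t\setminus S_{t-1}}p_{it}$, with $S_0=\emptyset$. The goal is to find a feasible chain of maximum profit. *)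

theory Defs
  imports "HOL-Analysis.Analysis" "HOL-Library.Log_Nat"
begin

section \<open>Generalized incremental knapsack\<close>

text \<open>Items are \<open>1..items I\<close>, periods are \<open>1..periods I\<close>; the values of the data functions outside
  these ranges are irrelevant. All numerical data are natural numbers, since the input size is
  measured by binary encoding lengths.\<close>

record gik =
  items :: nat
  periods :: nat
  weight :: "nat \<Rightarrow> nat"
  capacity :: "nat \<Rightarrow> nat"
  profit :: "nat \<Rightarrow> nat \<Rightarrow> nat"

definition gik_instance :: "gik \<Rightarrow> bool" where
  "gik_instance I \<longleftrightarrow>
     items I \<ge> 1 \<and> periods I \<ge> 1 \<and>
     (\<forall>i\<in>{1..items I}. weight I i > 0) \<and>
     mono_on {1..periods I} (capacity I)"

definition chain :: "gik \<Rightarrow> (nat \<Rightarrow> nat set) \<Rightarrow> bool" where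
  "chain I S \<longleftrightarrow>
     S 0 = {} \<and> (\<forall>t\<in>{1..periods I}. S (t - 1) \<subseteq> S t \<and> S t \<subseteq> {1..items I})"

definition feasible_chain :: "gik \<Rightarrow> (nat \<Rightarrow> nat set) \<Rightarrow> bool" where
  "feasible_chain I S \<longleftrightarrow>
     chain I S \<and> (\<forall>t\<in>{1..periods I}. (\<Sum>i\<in>S t. weight I i) \<le> capacity I t)"

definition chain_profit :: "gik \<Rightarrow> (nat \<Rightarrow> nat set) \<Rightarrow> nat" where
  "chain_profit I S = (\<Sum>t\<in>{1..periods I}. \<Sum>i\<in>S t - S (t - 1). profit I i t)"

definition max_profit :: "gik \<Rightarrow> nat" where
  "max_profit I = Max {chain_profit I S | S. feasible_chain I S}"

lemma finite_chain_profits: "finite {chain_profit I S | S. feasible_chain I S}"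
proof (rule finite_subset)
  show "{chain_profit I S | S. feasible_chain I S}
          \<subseteq> {.. \<Sum>t\<in>{1..periods I}. \<Sum>i\<in>{1..items I}. profit I i t}"
  proof
    fix v assume "v \<in> {chain_profit I S | S. feasible_chain I S}"
    then obtain S where v: "v = chain_profit I S" and S: "feasible_chain I S" by blast
    from S have "S t - S (t - 1) \<subseteq> {1..items I}" if "t \<in> {1..periods I}" for t
      using that unfolding feasible_chain_def chain_def by blast
    then show "v \<in> {.. \<Sum>t\<in>{1..periods I}. \<Sum>i\<in>{1..items I}. profit I i t}"
      unfolding v chain_profit_def atMost_iff by (intro sum_mono sum_mono2) auto
  qed
qed simp

lemma feasible_chain_empty: "feasible_chain I (\<lambda>_. {})"
  by (simp add: feasible_chain_def chain_def)

lemma max_profit_attained: "\<exists>S. feasible_chain I S \<and> chain_profit I S = max_profit I"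
  using Max_in[OF finite_chain_profits, of I] feasible_chain_empty[of I]
  unfolding max_profit_def by fastforce

lemma chain_profit_le_max_profit: "feasible_chain I S \<Longrightarrow> chain_profit I S \<le> max_profit I"
  unfolding max_profit_def by (rule Max_ge[OF finite_chain_profits]) blast

definition w_max :: "gik \<Rightarrow> nat" where
  "w_max I = Max (weight I ` {1..items I})"

definition w_min :: "gik \<Rightarrow> nat" where
  "w_min I = Min (weight I ` {1..items I})"

definition W_max :: "gik \<Rightarrow> nat" where
  "W_max I = Max (capacity I ` {1..periods I})"

definition p_max :: "gik \<Rightarrow> nat" where
  "p_max I = Max ((\<lambda>(i, t). profit I i t) ` ({1..items I} \<times> {1..periods I}))"

text \<open>The number of binary digits; the number \<open>0\<close> also takes one digit.\<close>

definition bits :: "nat \<Rightarrow> nat" where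
  "bits k = max 1 (floorlog 2 k)"

definition input_size :: "gik \<Rightarrow> nat" where
  "input_size I =
     items I * bits (w_max I) +
     items I * periods I * bits (p_max I) +
     periods I * bits (W_max I)"


section \<open>Computation model\<close>

text \<open>Algorithms are programs of a while language over scalar variables and arrays of natural
  numbers, i.e. a structured form of the random access machine (the finitely many arrays of a program
  can be interleaved in a single memory). Time is measured by the logarithmic cost criterion: every
  evaluated expression node, including an array index, is charged the bit length of its value, and
  every executed command or test one further unit. Since operands are themselves charged nodes, this
  is polynomially related to Turing machine time even though multiplication and division are
  primitive.\<close>

type_synonym vname = string

record state =
  var :: "vname \<Rightarrow> nat"
  arr :: "vname \<Rightarrow> nat \<Rightarrow> nat"

datatype aexp =
    Const nat
  | Var vname
  | Arr vname aexp
  | Plus aexp aexp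
  | Minus aexp aexp
  | Times aexp aexp
  | Div aexp aexp
  | Mod aexp aexp

fun aval :: "aexp \<Rightarrow> state \<Rightarrow> nat" where
  "aval (Const k) s = k"
| "aval (Var x) s = var s x"
| "aval (Arr x a) s = arr s x (aval a s)"
| "aval (Plus a b) s = aval a s + aval b s"
| "aval (Minus a b) s = aval a s - aval b s"
| "aval (Times a b) s = aval a s * aval b s"
| "aval (Div a b) s = aval a s div aval b s"
| "aval (Mod a b) s = aval a s mod aval b s"

fun acost :: "aexp \<Rightarrow> state \<Rightarrow> nat" where
  "acost (Const k) s = bits k"
| "acost (Var x) s = bits (var s x)"
| "acost (Arr x a) s = acost a s + bits (aval (Arr x a) s)"
| "acost (Plus a b) s = acost a s + acost b s + bits (aval (Plus a b) s)"
| "acost (Minus a b) s = acost a s + acost b s + bits (aval (Minus a b) s)"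
| "acost (Times a b) s = acost a s + acost b s + bits (aval (Times a b) s)"
| "acost (Div a b) s = acost a s + acost b s + bits (aval (Div a b) s)"
| "acost (Mod a b) s = acost a s + acost b s + bits (aval (Mod a b) s)"

datatype bexp =
    Less aexp aexp
  | Eq aexp aexp
  | Not bexp
  | And bexp bexp

fun bval :: "bexp \<Rightarrow> state \<Rightarrow> bool" where
  "bval (Less a b) s \<longleftrightarrow> aval a s < aval b s"
| "bval (Eq a b) s \<longleftrightarrow> aval a s = aval b s"
| "bval (Not b) s \<longleftrightarrow> \<not> bval b s"
| "bval (And a b) s \<longleftrightarrow> bval a s \<and> bval b s"

fun bcost :: "bexp \<Rightarrow> state \<Rightarrow> nat" where
  "bcost (Less a b) s = acost a s + acost b s + 1"
| "bcost (Eq a b) s = acost a s + acost b s + 1"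
| "bcost (Not b) s = bcost b s + 1"
| "bcost (And a b) s = bcost a s + bcost b s + 1"

datatype com =
    Skip
  | Assign vname aexp
  | ArrAssign vname aexp aexp
  | Seq com com
  | If bexp com com
  | While bexp com

text \<open>\<open>exec c s k s'\<close>: started in \<open>s\<close>, the program \<open>c\<close> halts in \<open>s'\<close> after time \<open>k\<close>.\<close>

inductive exec :: "com \<Rightarrow> state \<Rightarrow> nat \<Rightarrow> state \<Rightarrow> bool" where
  Skip: "exec Skip s 1 s"
| Assign: "exec (Assign x a) s (acost a s + 1) (s\<lparr>var := (var s)(x := aval a s)\<rparr>)"
| ArrAssign: "exec (ArrAssign x a b) s (acost a s + acost b s + 1)
    (s\<lparr>arr := (arr s)(x := (arr s x)(aval a s := aval b s))\<rparr>)"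
| Seq: "exec c s k s' \<Longrightarrow> exec d s' l s'' \<Longrightarrow> exec (Seq c d) s (k + l) s''"
| IfTrue: "bval b s \<Longrightarrow> exec c s k s' \<Longrightarrow> exec (If b c d) s (bcost b s + k + 1) s'"
| IfFalse: "\<not> bval b s \<Longrightarrow> exec d s k s' \<Longrightarrow> exec (If b c d) s (bcost b s + k + 1) s'"
| WhileFalse: "\<not> bval b s \<Longrightarrow> exec (While b c) s (bcost b s + 1) s"
| WhileTrue: "bval b s \<Longrightarrow> exec c s k s' \<Longrightarrow> exec (While b c) s' l s'' \<Longrightarrow>
    exec (While b c) s (bcost b s + k + l + 1) s''"

inductive_cases exec_elims:
  "exec Skip s k s'" "exec (Assign x a) s k s'" "exec (ArrAssign x a b) s k s'"
  "exec (Seq c d) s k s'" "exec (If b c d) s k s'"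
inductive_cases exec_WhileE: "exec (While b c) s k s'"

lemma exec_deterministic:
  "exec c s k s' \<Longrightarrow> exec c s l s'' \<Longrightarrow> k = l \<and> s' = s''"
proof (induction arbitrary: l s'' rule: exec.induct)
  case (Seq c s k s' d l' t)
  from Seq.prems obtain i u j where "l = i + j" "exec c s i u" "exec d u j s''"
    by (rule exec_elims(4))
  with Seq.IH(1)[of i u] Seq.IH(2)[of j s''] show ?case by simp
next
  case (IfTrue b s c k s' d)
  from IfTrue.prems IfTrue.hyps obtain i where "l = bcost b s + i + 1" "exec c s i s''"
    by (auto elim: exec_elims(5))
  with IfTrue.IH[of i s''] show ?case by simp
next
  case (IfFalse b s d k s' c)
  from IfFalse.prems IfFalse.hyps obtain i where "l = bcost b s + i + 1" "exec d s i s''"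
    by (auto elim: exec_elims(5))
  with IfFalse.IH[of i s''] show ?case by simp
next
  case (WhileFalse b s c)
  from WhileFalse.prems WhileFalse.hyps show ?case
    by (auto elim: exec_WhileE)
next
  case (WhileTrue b s c k s' l' t)
  from WhileTrue.prems WhileTrue.hyps obtain i u j
    where "l = bcost b s + i + j + 1" "exec c s i u" "exec (While b c) u j s''"
    by (rule_tac exec_WhileE) auto
  with WhileTrue.IH(1)[of i u] WhileTrue.IH(2)[of j s''] show ?case by simp
qed (auto elim: exec_elims(1-3))

text \<open>Two-dimensional data are stored row by row: the entry of item \<open>i\<close> and period \<open>t\<close> has index
  \<open>(i - 1) * T + t\<close>. Everything outside the input is initialised to \<open>0\<close>.\<close>

definition entry :: "gik \<Rightarrow> nat \<Rightarrow> nat \<Rightarrow> nat" where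
  "entry I i t = (i - 1) * periods I + t"

definition init_state :: "gik \<Rightarrow> state" where
  "init_state I = \<lparr>
     var = (\<lambda>_. 0)(''n'' := items I, ''T'' := periods I),
     arr = (\<lambda>_ _. 0)(
       ''w'' := (\<lambda>k. if k \<in> {1..items I} then weight I k else 0),
       ''W'' := (\<lambda>k. if k \<in> {1..periods I} then capacity I k else 0),
       ''p'' := (\<lambda>k. if k \<in> {1..items I * periods I}
                   then profit I ((k - 1) div periods I + 1) ((k - 1) mod periods I + 1)
                   else 0))\<rparr>"

lemma init_state_profit:
  assumes "i \<in> {1..items I}" "t \<in> {1..periods I}"
  shows "arr (init_state I) ''p'' (entry I i t) = profit I i t"
proof -
  obtain j where j: "i = Suc j" "j < items I" using assms by (cases i) auto
  obtain u where u: "t = Suc u" "u < periods I" using assms by (cases t) auto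
  have "Suc j * periods I \<le> items I * periods I"
    using j by (intro mult_right_mono) auto
  then show ?thesis using j u by (simp add: init_state_def entry_def)
qed

text \<open>The chain computed by a program: item \<open>i\<close> belongs to \<open>S\<^sub>t\<close> iff its entry in the output array
  is nonzero.\<close>

definition output_chain :: "gik \<Rightarrow> state \<Rightarrow> nat \<Rightarrow> nat set" where
  "output_chain I s t =
     (if t = 0 then {} else {i \<in> {1..items I}. arr s ''S'' (entry I i t) \<noteq> 0})"

end

theory Submission
  imports Defs
begin

text \<open>List the items of an optimal chain by insertion period and cut the list into groups: a bucket of
  items of total weight below a threshold \<open>\<theta>\<close>, followed by the single item that lifts the weight of the
  group to at least \<open>\<theta>\<close>. The threshold doubles after every \<open>4 L\<close> groups, \<open>L \<approx> 1 / \<epsilon>\<close>, so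
  \<open>O(L log (n w_max / w_min))\<close> groups suffice. Number the blocks of four consecutive groups modulo \<open>L\<close>
  and give up the residue class of least profit; this costs at most a fraction \<open>1 / L\<close>, and everything
  after the first round of groups gains a slack of twice its own threshold. The slack lets every item of a
  bucket be inserted at any time from the start of the bucket on, and it absorbs the error of rounding the
  bucket loads to multiples of \<open>\<theta> / (2 K n)\<close>, where \<open>K = 8 L\<close>. It remains to guess the start period of
  each slot (a bucket or a closing item) and the closing items, and for each guess to run a dynamic program
  over the items whose states are the vectors of rounded loads. Every table entry is tested for exact
  feasibility, so rounding only matters for the profit guarantee: an entry that agrees with the truncated
  optimum in the rounded loads is feasible.\<close>


section \<open>Guesses and rounded loads\<close>

text \<open>The slack of twice the threshold is spent in two halves. A guessed solution may insert a
  whole bucket at its start, where the chain has only reached the first of its items; this costs at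
  most one \<theta>. Rounding costs at most \<open>\<theta> x' / (2 * K)\<close> in slot
  \<open>x'\<close>, and as thresholds grow geometrically these errors add up to at most the
  \<theta> of the last slot concerned; this is the other half. A block has four groups because the
  one that makes room lies one round back, where a full group is only guaranteed half the present
  threshold. The first round has no predecessor, which is why the thresholds start at the minimum
  weight: its buckets are empty, and its closing items are named by the guess and not rounded. A
  table entry remembers a single solution, chosen by profit, so the exchange argument must cover
  arbitrary solutions that share guess and loads with the intended one. Guesses and load vectors
  have \<open>X\<close> digits each in radix \<open>B\<close>; this gives \<open>B ^ (2 * X)\<close>
  up to polynomial factors and hence the exponent of the running time.\<close>

lemma digit_sum_less:
  fixes B :: nat
  assumes "\<And>j. j < m \<Longrightarrow> f j < B"
  shows "(\<Sum>j<m. f j * B ^ j) < B ^ m"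
  using assms
proof (induction m)
  case (Suc m)
  have "(\<Sum>j<Suc m. f j * B ^ j) < B ^ m + f m * B ^ m" using Suc by simp
  also have "\<dots> = (f m + 1) * B ^ m" by simp
  also have "\<dots> \<le> B * B ^ m" using Suc.prems[of m] by (intro mult_right_mono) auto
  finally show ?case by simp
qed simp

lemma digit_of_sum:
  fixes B :: nat
  assumes "\<And>j. j < m \<Longrightarrow> f j < B" and "i < m"
  shows "(\<Sum>j<m. f j * B ^ j) div B ^ i mod B = f i"
  using assms
proof (induction m arbitrary: f i)
  case (Suc m)
  have eq: "(\<Sum>j<Suc m. f j * B ^ j) = f 0 + B * (\<Sum>j<m. f (Suc j) * B ^ j)"
    unfolding sum.lessThan_Suc_shift by (simp add: sum_distrib_left mult_ac)
  have f0: "f 0 < B" using Suc.prems(1)[of 0] by simp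
  show ?case
  proof (cases i)
    case 0
    then show ?thesis using eq f0 by simp
  next
    case (Suc i')
    have "(\<Sum>j<Suc m. f j * B ^ j) div B ^ i = (\<Sum>j<m. f (Suc j) * B ^ j) div B ^ i'"
      unfolding eq Suc power_Suc div_mult2_eq using f0 by simp
    then show ?thesis using Suc.IH[of "\<lambda>j. f (Suc j)" i'] Suc.prems Suc by simp
  qed
qed simp

lemma digit_sum_extend:
  fixes B :: nat
  assumes "m \<le> n"
  shows "(\<Sum>j<m. f j * B ^ j) = (\<Sum>j<n. (if j < m then f j else 0) * B ^ j)"
  using assms by (intro sum.mono_neutral_cong_left) auto

locale gik_dp =
  fixes I :: gik and K L :: nat
  assumes inst: "gik_instance I" and K_L: "K = 8 * L" and L2: "2 \<le> L"
begin

lemma K16: "16 \<le> K" using K_L L2 by simp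

abbreviation n where "n \<equiv> items I"
abbreviation T where "T \<equiv> periods I"
abbreviation w where "w \<equiv> weight I"
abbreviation W where "W \<equiv> capacity I"
abbreviation p where "p \<equiv> profit I"

text \<open>Slots \<open>2 g\<close> and \<open>2 g + 1\<close> are the bucket and the closing item of group \<open>g\<close>; a round of \<open>4 L\<close> groups
  thus has \<open>K\<close> slots. Vectors are encoded in radix \<open>B\<close>: the digit \<open>x\<close> of a guess \<open>y\<close> is
  \<open>\<tau> (n + 1) + f\<close>, where \<open>\<tau>\<close> is the start period of slot \<open>x\<close> (\<open>T + 1\<close> if the slot is closed) and \<open>f\<close> is
  its closing item (\<open>0\<close> for a bucket).\<close>

definition wm where "wm = w_min I"
definition sw where "sw = (\<Sum>i<n. w (Suc i))"
text \<open>Number of rounds. As \<open>2 * sw < wm * 2 ^ J\<close>, the threshold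
  \<open>wm * 2 ^ (J - 1)\<close> of the last round exceeds the weight of all items, so no group of
  that round can fill up.\<close>

definition J where "J = (LEAST j. 2 * sw < wm * 2 ^ j)"
definition X where "X = K * J"
definition \<theta> where "\<theta> x = wm * 2 ^ (x div K)" for x :: nat
text \<open>One radix for three kinds of vectors, so that a single table of powers serves all: loads
  (at most \<open>n\<close> summands of at most \<open>2 * K * n\<close>), digits of a guess (below
  \<open>(T + 2) * (n + 1)\<close>) and insertion periods (at most \<open>T\<close>).\<close>

definition B where "B = 2 * K * n * n * (T + 1)"
definition M where "M = B ^ X"
definition Y where "Y = (n + 1) * M"
definition opts where "opts = X * (T + 1)"

definition dig where "dig z x = z div B ^ x mod B" for z x :: nat
definition tau where "tau y x = dig y x div (n + 1)"
definition sel where "sel y x = dig y x mod (n + 1)"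

definition allowed where
  "allowed y i x t \<longleftrightarrow> tau y x \<le> t \<and> (sel y x = i \<or> sel y x = 0 \<and> w i < \<theta> x)"

text \<open>Weight in units of \<open>\<theta> x / (2 * K * n)\<close>, rounded down. A closing item
  adds no load, since the guess already names it.\<close>

definition rnd where
  "rnd y i x = (if sel y x = 0 then w i * (2 * K * n) div \<theta> x else 0)"

definition feas where
  "feas A \<longleftrightarrow> (\<forall>t\<in>{1..T}. (\<Sum>i<n. if 0 < dig A i \<and> dig A i \<le> t then w (Suc i) else 0) \<le> W t)"

definition prof where
  "prof A = (\<Sum>i<n. if dig A i = 0 then 0 else p (Suc i) (dig A i))"

text \<open>The table entry \<open>y * Y + i * M + z\<close> belongs to the guess \<open>y\<close>, the first \<open>i\<close> items and the encoded
  loads \<open>z\<close>. It consists of \<open>v\<close>, one more than the profit (\<open>0\<close> if the entry is unreachable), and \<open>a\<close>, the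
  insertion periods in radix \<open>B\<close>. Step \<open>u\<close> treats entry \<open>u div opts\<close>: it compares the entry with the best
  feasible solution \<open>(b, c)\<close> and then puts the next item into slot \<open>x\<close> at period \<open>t\<close>, where \<open>t = 0\<close> leaves
  the item out. Pushes go to larger indices only, so an entry is final when it is treated.\<close>

definition step :: "nat \<Rightarrow> (nat \<Rightarrow> nat) \<times> (nat \<Rightarrow> nat) \<times> nat \<times> nat \<Rightarrow> (nat \<Rightarrow> nat) \<times> (nat \<Rightarrow> nat) \<times> nat \<times> nat" where
  "step u = (\<lambda>(v, a, b, c).
      let e = u div opts;
          upd = (feas (a e) \<and> b < v e);
          x = u mod opts div (T + 1); t = u mod (T + 1);
          i = e div M mod (n + 1); y = e div Y;
          e' = e + M + (if t = 0 then 0 else rnd y (Suc i) x * B ^ x);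
          v' = v e + (if t = 0 then 0 else p (Suc i) t);
          push = (0 < v e \<and> i < n \<and> (t = 0 \<or> allowed y (Suc i) x t) \<and> v e' < v')
      in (if push then v(e' := v') else v, if push then a(e' := a e + t * B ^ i) else a,
          if upd then v e else b, if upd then a e else c))"

primrec st where
  "st 0 = ((\<lambda>k. if k mod Y = 0 \<and> k div Y < M then 1 else 0), (\<lambda>_. 0), 0, 0)"
| "st (Suc u) = step u (st u)"

text \<open>A partial solution for the items \<open>1..i\<close> under the guess \<open>y\<close>: item \<open>k + 1\<close> is put into slot
  \<open>sl k\<close> and inserted in period \<open>pe k\<close>, where \<open>pe k = 0\<close> means that it is not used.\<close>

definition valid where
  "valid y sl pe i \<longleftrightarrow> (\<forall>k<i. pe k = 0 \<or> sl k < X \<and> pe k \<le> T \<and> allowed y (Suc k) (sl k) (pe k))"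

definition code where
  "code y sl pe i = (\<Sum>k<i. if pe k = 0 then 0 else rnd y (Suc k) (sl k) * B ^ sl k)"

definition load where
  "load y sl pe i x = (\<Sum>k<i. if pe k \<noteq> 0 \<and> sl k = x then rnd y (Suc k) x else 0)"

definition gain where
  "gain pe i = (\<Sum>k<i. if pe k = 0 then 0 else p (Suc k) (pe k))"

definition acode where
  "acode pe i = (\<Sum>k<i. pe k * B ^ k)" for pe :: "nat \<Rightarrow> nat" and i :: nat

definition sound where
  "sound e V A \<longleftrightarrow> V = 0 \<and> A = 0 \<or>
     (\<exists>y sl pe i. i \<le> n \<and> valid y sl pe i \<and> e = y * Y + i * M + code y sl pe i \<and>
        V = 1 + gain pe i \<and> A = acode pe i)"

section \<open>Estimates for thresholds and radix; decoding of table indices\<close>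

lemma n1: "1 \<le> n" and T1: "1 \<le> T" and w_pos: "i \<in> {1..n} \<Longrightarrow> 0 < w i"
  and W_mono: "mono_on {1..T} W"
  using inst unfolding gik_instance_def by auto

lemma wm_le: "i \<in> {1..n} \<Longrightarrow> wm \<le> w i"
  unfolding wm_def w_min_def by (intro Min_le) auto

lemma wm_pos: "0 < wm"
proof -
  have "wm \<in> w ` {1..n}"
    unfolding wm_def w_min_def using n1 by (intro Min_in) auto
  then show ?thesis using w_pos by auto
qed

lemma theta_pos: "0 < \<theta> x"
  unfolding \<theta>_def using wm_pos by simp

lemma wm_sw: "wm \<le> sw"
proof -
  have "wm \<le> w (Suc 0)" using n1 by (intro wm_le) auto
  also have "\<dots> \<le> sw" unfolding sw_def using n1 by (intro member_le_sum) auto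
  finally show ?thesis .
qed

lemma J_exists: "\<exists>j. 2 * sw < wm * 2 ^ j"
proof
  show "2 * sw < wm * 2 ^ (2 * sw)"
    using wm_pos less_exp[of "2 * sw"] mult_le_mono1[of 1 wm "2 ^ (2 * sw)"] by linarith
qed

lemma J_gt: "2 * sw < wm * 2 ^ J"
  unfolding J_def using J_exists by (rule LeastI_ex)

lemma J_least: "j < J \<Longrightarrow> wm * 2 ^ j \<le> 2 * sw"
  unfolding J_def by (meson not_less_Least not_le)

lemma J_pos: "0 < J"
  using J_gt wm_sw wm_pos by (cases J) auto

lemma X_pos: "0 < X" unfolding X_def using J_pos K16 by simp

lemma opts_pos: "0 < opts" unfolding opts_def using X_pos by simp

lemma B_bounds: "2 * K * n * n < B" "(T + 2) * (n + 1) \<le> B" "2 \<le> B" "T < B" "n < B"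
proof -
  have "K * n * n * 2 * 2 \<le> B" unfolding B_def using T1 by (auto simp: algebra_simps)
  moreover have "n * 1 \<le> n * n" using n1 by (intro mult_left_mono) auto
  moreover have "16 * (n * n) \<le> K * n * n" using K16 by (simp add: mult.assoc)
  moreover have "0 < K * n * n" using n1 K16 by simp
  ultimately show 1: "2 * K * n * n < B" "n < B" "2 \<le> B" using n1 by linarith+
  have "(T + 2) * (n + 1) \<le> (2 * (T + 1)) * (2 * n)" using n1 by (intro mult_mono) auto
  also have "\<dots> = 4 * n * 1 * (T + 1)" by simp
  also have "\<dots> \<le> (2 * K) * n * n * (T + 1)" using n1 K16 by (intro mult_mono) auto
  finally show 2: "(T + 2) * (n + 1) \<le> B" unfolding B_def .
  have "T + 2 \<le> (T + 2) * (n + 1)" by simp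
  then have "T + 2 \<le> B" using 2 by (rule le_trans)
  then show "T < B" by simp
qed

lemma M_pos: "0 < M" unfolding M_def using B_bounds(3) by simp
lemma Y_pos: "0 < Y" unfolding Y_def using M_pos by simp

lemma rnd_le: "allowed y i x t \<Longrightarrow> 0 < i \<Longrightarrow> rnd y i x \<le> 2 * K * n"
proof (cases "sel y x = 0 \<and> w i < \<theta> x")
  case True
  then have "w i * (2 * K * n) \<le> \<theta> x * (2 * K * n)" by (intro mult_right_mono) auto
  then have "w i * (2 * K * n) div \<theta> x \<le> \<theta> x * (2 * K * n) div \<theta> x" by (rule div_le_mono)
  then show ?thesis using True theta_pos[of x] by (simp add: rnd_def)
qed (auto simp: rnd_def allowed_def sel_def)

text \<open>No digit overflows, so adding codes adds load vectors digit by digit, and a code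
  determines its loads.\<close>

lemma load_less: assumes "valid y sl pe i" "i \<le> n" shows "load y sl pe i x < B"
proof -
  have "load y sl pe i x \<le> (\<Sum>k<i. 2 * K * n)"
    unfolding load_def using assms(1) rnd_le unfolding valid_def by (intro sum_mono) auto
  also have "\<dots> \<le> n * (2 * K * n)" using assms(2) by simp
  also have "\<dots> = 2 * K * n * n" by simp
  also have "\<dots> < B" by (rule B_bounds)
  finally show ?thesis .
qed

lemma code_load: assumes "valid y sl pe i" shows "code y sl pe i = (\<Sum>x<X. load y sl pe i x * B ^ x)"
proof -
  have "(\<Sum>x<X. load y sl pe i x * B ^ x)
      = (\<Sum>x<X. \<Sum>k<i. if pe k \<noteq> 0 \<and> sl k = x then rnd y (Suc k) x * B ^ x else 0)"
    unfolding load_def by (intro sum.cong refl) (auto simp: sum_distrib_right intro!: sum.cong)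
  also have "\<dots> = (\<Sum>k<i. \<Sum>x<X. if pe k \<noteq> 0 \<and> sl k = x then rnd y (Suc k) x * B ^ x else 0)"
    by (rule sum.swap)
  also have "\<dots> = code y sl pe i"
    unfolding code_def
  proof (intro sum.cong refl)
    fix k assume "k \<in> {..<i}"
    then have "pe k = 0 \<or> sl k < X" using assms unfolding valid_def by auto
    then show "(\<Sum>x<X. if pe k \<noteq> 0 \<and> sl k = x then rnd y (Suc k) x * B ^ x else 0)
      = (if pe k = 0 then 0 else rnd y (Suc k) (sl k) * B ^ sl k)"
      by (auto simp: sum.delta)
  qed
  finally show ?thesis by simp
qed

lemma code_less: assumes "valid y sl pe i" "i \<le> n" shows "code y sl pe i < M"
  unfolding code_load[OF assms(1)] M_def by (intro digit_sum_less load_less assms)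

lemma code_eq_load:
  assumes "valid y sl pe n" "valid y sl' pe' n" "code y sl pe n = code y sl' pe' n" "x < X"
  shows "load y sl pe n x = load y sl' pe' n x"
proof -
  have "load y sl pe n x = code y sl pe n div B ^ x mod B"
    unfolding code_load[OF assms(1)] by (subst digit_of_sum) (auto intro!: load_less assms)
  also have "\<dots> = load y sl' pe' n x"
    unfolding assms(3) code_load[OF assms(2)] by (subst digit_of_sum) (auto intro!: load_less assms)
  finally show ?thesis .
qed

lemma entry_decode:
  assumes "z < M" "i \<le> n" "e = y * Y + i * M + z"
  shows "e div Y = y" "e div M mod (n + 1) = i" "e mod M = z"
proof -
  have lt: "i * M + z < Y"
  proof -
    have "i * M + z < (i + 1) * M" using assms by simp
    also have "\<dots> \<le> Y" unfolding Y_def using assms by (intro mult_right_mono) auto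
    finally show ?thesis .
  qed
  show "e div Y = y" unfolding assms(3) using lt Y_pos by (simp add: add.assoc)
  have e: "e = z + M * (y * (n + 1) + i)" unfolding assms(3) Y_def by (simp add: algebra_simps)
  have "e div M = y * (n + 1) + i" unfolding e using assms(1) M_pos by simp
  then show "e div M mod (n + 1) = i" using assms(2)
    by (simp only: mod_mult_self3) simp
  show "e mod M = z" unfolding e using assms(1) by simp
qed

lemma dig_acode:
  assumes "\<And>k. k < i \<Longrightarrow> pe k \<le> T" "i \<le> n" "k < n"
  shows "dig (acode pe i) k = (if k < i then pe k else 0)"
proof -
  have eq: "acode pe i = (\<Sum>j<n. (if j < i then pe j else 0) * B ^ j)"
    unfolding acode_def by (rule digit_sum_extend) fact
  have "(\<Sum>j<n. (if j < i then pe j else 0) * B ^ j) div B ^ k mod B = (if k < i then pe k else 0)"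
    using assms le_less_trans[OF _ B_bounds(4)] B_bounds(3) by (intro digit_of_sum) auto
  then show ?thesis unfolding dig_def eq .
qed

lemma acode_less:
  assumes "\<And>k. k < i \<Longrightarrow> pe k \<le> T" "i \<le> n"
  shows "acode pe i < B ^ n"
proof -
  have "acode pe i = (\<Sum>j<n. (if j < i then pe j else 0) * B ^ j)"
    unfolding acode_def by (rule digit_sum_extend) fact
  also have "\<dots> < B ^ n" using assms le_less_trans[OF _ B_bounds(4)] B_bounds(3) by (intro digit_sum_less) auto
  finally show ?thesis .
qed

lemma prof_acode:
  assumes "valid y sl pe i" "i \<le> n"
  shows "prof (acode pe i) = gain pe i"
proof -
  have pe: "pe k \<le> T" if "k < i" for k using assms that unfolding valid_def by fastforce
  have "prof (acode pe i) = (\<Sum>k<n. if k < i then (if pe k = 0 then 0 else p (Suc k) (pe k)) else 0)"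
    unfolding prof_def using dig_acode[OF pe assms(2)] by (intro sum.cong) auto
  also have "\<dots> = gain pe i"
    unfolding gain_def using assms(2) by (intro sum.mono_neutral_cong_right) auto
  finally show ?thesis .
qed

lemma dig_0 [simp]: "dig 0 i = 0" by (simp add: dig_def)

lemma feas_0: "feas 0" by (simp add: feas_def)

section \<open>Invariant of the table computation and value of its result\<close>

definition dst where
  "dst u = (let e = u div opts; x = u mod opts div (T + 1); t = u mod (T + 1);
      i = e div M mod (n + 1); y = e div Y
    in e + M + (if t = 0 then 0 else rnd y (Suc i) x * B ^ x))"

text \<open>The optimality half of the invariant. Only an inequality is claimed, because another
  push may have improved the destination.\<close>

definition pushed where
  "pushed v u \<longleftrightarrow> (let e = u div opts; x = u mod opts div (T + 1); t = u mod (T + 1);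
      i = e div M mod (n + 1); y = e div Y
    in 0 < v e \<and> i < n \<and> (t = 0 \<or> allowed y (Suc i) x t) \<longrightarrow>
       v e + (if t = 0 then 0 else p (Suc i) t) \<le> v (dst u))"

text \<open>For the incumbent \<open>(b, c)\<close>, soundness at some index is all that is needed:
  it makes the digits of \<open>c\<close> periods, so that \<open>c\<close> decodes to a chain of
  profit \<open>prof c\<close>.\<close>

definition good :: "nat \<Rightarrow> (nat \<Rightarrow> nat) \<times> (nat \<Rightarrow> nat) \<times> nat \<times> nat \<Rightarrow> bool" where
  "good u = (\<lambda>(v, a, b, c).
     (\<forall>e. sound e (v e) (a e)) \<and> (\<forall>y<M. 0 < v (y * Y)) \<and>
     (\<forall>u'<u. pushed v u' \<and> (feas (a (u' div opts)) \<longrightarrow> v (u' div opts) \<le> b)) \<and>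
     feas c \<and> b \<le> 1 + prof c \<and> (\<exists>e. sound e b c))"

lemma dst_gt: "u div opts < dst u"
  unfolding dst_def Let_def using M_pos by simp

lemma sound_push:
  assumes "sound e V A" "0 < V" "e = u div opts"
    "x = u mod opts div (T + 1)" "t = u mod (T + 1)" "i = e div M mod (n + 1)" "y = e div Y"
    "i < n" "t = 0 \<or> allowed y (Suc i) x t"
  shows "sound (dst u) (V + (if t = 0 then 0 else p (Suc i) t)) (A + t * B ^ i)"
proof -
  obtain y' sl pe i' where *: "i' \<le> n" "valid y' sl pe i'" "e = y' * Y + i' * M + code y' sl pe i'"
        "V = 1 + gain pe i'" "A = acode pe i'" using assms(1,2) unfolding sound_def by auto
  have yi: "y' = y" "i' = i"
    using entry_decode[OF code_less[OF *(2,1)] *(1,3)] assms by auto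
  let ?sl = "sl(i := x)" and ?pe = "pe(i := t)"
  have xX: "x < X" unfolding assms(4)
  proof (rule less_mult_imp_div_less)
    have "u mod opts < opts" using opts_pos by simp
    then show "u mod opts < X * (T + 1)" by (simp only: opts_def)
  qed
  have tT: "t \<le> T" unfolding assms(5) using mod_less_divisor[of "T + 1" u] by linarith
  have v: "valid y ?sl ?pe (Suc i)"
    using * yi assms(9) xX tT unfolding valid_def by (auto simp: less_Suc_eq)
  have c: "code y ?sl ?pe (Suc i) = code y sl pe i + (if t = 0 then 0 else rnd y (Suc i) x * B ^ x)"
    unfolding code_def by (simp cong: if_cong)
  have g: "gain ?pe (Suc i) = gain pe i + (if t = 0 then 0 else p (Suc i) t)"
    unfolding gain_def by (simp cong: if_cong)
  have a: "acode ?pe (Suc i) = acode pe i + t * B ^ i" unfolding acode_def by simp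
  have d: "dst u = y * Y + Suc i * M + code y ?sl ?pe (Suc i)"
    unfolding dst_def Let_def c assms(4-7)[symmetric] assms(3)[symmetric]
    using *(3) yi by simp
  show ?thesis unfolding sound_def
    using assms(8) v c g a * yi d by (intro disjI2 exI[of _ y] exI[of _ ?sl] exI[of _ ?pe] exI[of _ "Suc i"]) auto
qed

lemma sound_prof: "sound e V A \<Longrightarrow> V \<le> 1 + prof A"
  unfolding sound_def using prof_acode by auto

lemma good_step:
  assumes "good u (v, a, b, c)"
  shows "good (Suc u) (step u (v, a, b, c))"
proof -
  define e x t i y where defs: "e = u div opts" "x = u mod opts div (T + 1)" "t = u mod (T + 1)"
    "i = e div M mod (n + 1)" "y = e div Y"
  define g where "g = (if t = 0 then 0 else p (Suc i) t)"
  define upd where "upd = (feas (a e) \<and> b < v e)"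
  define ok where "ok = (0 < v e \<and> i < n \<and> (t = 0 \<or> allowed y (Suc i) x t))"
  define push where "push = (ok \<and> v (dst u) < v e + g)"
  have dst: "dst u = e + M + (if t = 0 then 0 else rnd y (Suc i) x * B ^ x)"
    unfolding dst_def Let_def defs by simp
  define v' a' b' c' where new: "v' = (if push then v(dst u := v e + g) else v)"
    "a' = (if push then a(dst u := a e + t * B ^ i) else a)"
    "b' = (if upd then v e else b)" "c' = (if upd then a e else c)"
  have st: "step u (v, a, b, c) = (v', a', b', c')"
    unfolding step_def Let_def new push_def ok_def upd_def dst g_def defs by simp
  have s: "sound e (v e) (a e)" for e using assms unfolding good_def by auto
  have old: "v' (u' div opts) = v (u' div opts)" "a' (u' div opts) = a (u' div opts)" if "u' \<le> u" for u'
  proof -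
    have "u' div opts \<le> u div opts" using that by (rule div_le_mono)
    then have "u' div opts \<noteq> dst u" using dst_gt[of u] by linarith
    then show "v' (u' div opts) = v (u' div opts)" "a' (u' div opts) = a (u' div opts)" unfolding new by auto
  qed
  have inc: "v k \<le> v' k" for k unfolding new push_def by auto
  have 1: "sound k (v' k) (a' k)" for k
    using s[of k] sound_push[OF s, of e u x t i y] unfolding new push_def ok_def g_def
    by (auto simp: defs)
  have 2: "0 < v' (k * Y)" if "k < M" for k
    using assms that inc[of "k * Y"] unfolding good_def by (auto intro: less_le_trans)
  have 3: "pushed v' u'" if "u' < u" for u'
  proof -
    have "pushed v u'" using assms that unfolding good_def by auto
    then show ?thesis using old(1)[of u'] that inc[of "dst u'"] unfolding pushed_def Let_def by auto
  qed
  have 4: "pushed v' u"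
  proof -
    have "ok \<longrightarrow> v e + g \<le> v' (dst u)" unfolding new push_def by auto
    then show ?thesis using old(1)[of u] 
      unfolding pushed_def Let_def defs[symmetric] ok_def g_def by (simp add: defs)
  qed
  have 5: "feas (a' (u' div opts)) \<longrightarrow> v' (u' div opts) \<le> b'" if "u' < Suc u" for u'
  proof (cases "u' = u")
    case True
    then show ?thesis using old[of u] unfolding new upd_def by (auto simp: defs)
  next
    case False
    then have "feas (a (u' div opts)) \<longrightarrow> v (u' div opts) \<le> b" using assms that unfolding good_def by auto
    then show ?thesis using old[of u'] that False unfolding new upd_def by auto
  qed
  have 6: "feas c'" "b' \<le> 1 + prof c'" "\<exists>e. sound e b' c'"
    using assms s sound_prof[OF s] unfolding good_def new upd_def by auto
  show ?thesis unfolding st good_def using 1 2 3 4 5 6 by (auto simp: less_Suc_eq)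
qed

lemma good_st: "good u (st u)"
proof (induction u)
  case 0
  have "sound e (if e mod Y = 0 \<and> e div Y < M then 1 else 0) 0" for e
  proof (cases "e mod Y = 0 \<and> e div Y < M")
    case True
    then have "e = (e div Y) * Y" by auto
    then show ?thesis unfolding sound_def
      by (intro disjI2 exI[of _ "e div Y"] exI[of _ "\<lambda>_. 0"] exI[of _ "0::nat"])
        (use True in \<open>auto simp: valid_def code_def gain_def acode_def\<close>)
  qed (auto simp: sound_def)
  moreover have "\<exists>e. sound e 0 0" by (auto simp: sound_def)
  ultimately show ?case using Y_pos feas_0 unfolding good_def by auto
next
  case (Suc u)
  obtain v a b c where "st u = (v, a, b, c)" by (metis prod_cases4)
  then show ?case using good_step Suc by simp
qed

text \<open>After the last step \<open>pushed\<close> speaks of the final table throughout, so the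
  path of the given solution can be followed item by item. Its gain stays a lower bound even where
  the table has replaced a prefix by a better one with the same loads.\<close>

lemma path_value:
  assumes "good (M * Y * opts) (v, a, b, c)" "valid y sl pe n" "y < M" "i \<le> n"
  shows "1 + gain pe i \<le> v (y * Y + i * M + code y sl pe i)"
  using assms(4)
proof (induction i)
  case 0
  have "0 < v (y * Y)" using assms unfolding good_def by auto
  then show ?case by (simp add: gain_def code_def)
next
  case (Suc i)
  define e where "e = y * Y + i * M + code y sl pe i"
  define x where "x = (if pe i = 0 then 0 else sl i)"
  define t where "t = pe i"
  define u where "u = e * opts + (x * (T + 1) + t)"
  have val: "valid y sl pe i" using assms(2) Suc.prems unfolding valid_def by auto
  have opt: "t = 0 \<or> x < X \<and> t \<le> T \<and> allowed y (Suc i) x t"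
    using assms(2) Suc.prems unfolding valid_def x_def t_def Suc_le_eq by auto
  have xX: "x < X" using opt X_pos x_def t_def by auto
  have tT: "t \<le> T" using opt by auto
  have lt: "x * (T + 1) + t < opts"
  proof -
    have "x * (T + 1) + t < (x + 1) * (T + 1)" using tT by simp
    also have "\<dots> \<le> opts" unfolding opts_def using xX by (intro mult_right_mono) auto
    finally show ?thesis .
  qed
  have cl: "code y sl pe i < M" using val Suc.prems by (intro code_less) auto
  have "i * M + code y sl pe i < Y"
  proof -
    have "i * M + code y sl pe i < (i + 1) * M" using cl by simp
    also have "\<dots> \<le> Y" unfolding Y_def using Suc.prems by (intro mult_right_mono) auto
    finally show ?thesis .
  qed
  then have eMY: "e < M * Y"
  proof -
    assume "i * M + code y sl pe i < Y"
    then have "e < (y + 1) * Y" unfolding e_def by simp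
    also have "\<dots> \<le> M * Y" using assms(3) by (intro mult_right_mono) auto
    finally show ?thesis .
  qed
  have uN: "u < M * Y * opts"
  proof -
    have "u < (e + 1) * opts" unfolding u_def using lt by simp
    also have "\<dots> \<le> M * Y * opts" using eMY by (intro mult_right_mono) auto
    finally show ?thesis .
  qed
  have ue: "u div opts = e" "u mod opts = x * (T + 1) + t" unfolding u_def using lt by auto
  have ux: "u mod opts div (T + 1) = x" unfolding ue(2)
    using tT by (intro div_nat_eqI) auto
  have ut: "u mod (T + 1) = t"
  proof -
    have "u = (e * X + x) * (T + 1) + t" unfolding u_def opts_def by (simp add: algebra_simps)
    then show ?thesis using tT by (metis less_Suc_eq_le Suc_eq_plus1 mod_less mod_mult_self3)
  qed
  have dec: "e div Y = y" "e div M mod (n + 1) = i"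
    using entry_decode[OF cl _ e_def] Suc.prems by auto
  have IH: "1 + gain pe i \<le> v e" using Suc unfolding e_def by auto
  have pu: "pushed v u" using assms(1) uN unfolding good_def by auto
  have "dst u = y * Y + Suc i * M + code y sl pe (Suc i)"
    unfolding dst_def Let_def ue(1) ux ut dec code_def sum.lessThan_Suc
    by (auto simp: e_def code_def x_def t_def)
  then show ?case using pu IH opt Suc.prems
    unfolding pushed_def Let_def ue(1) ux ut dec by (auto simp: gain_def t_def)
qed

text \<open>The entry at the end of the path may hold a different solution, known only to have the
  same rounded loads. The assumption \<open>exch\<close> is the interface to the slack argument: it
  makes that solution pass the exact test, so that its value reaches the incumbent.\<close>

lemma solution_value:
  assumes "good (M * Y * opts) (v, a, b, c)" "valid y sl pe n" "y < M"
    and exch: "\<And>sl' pe'. valid y sl' pe' n \<Longrightarrow> (\<And>x. x < X \<Longrightarrow> load y sl' pe' n x = load y sl pe n x) \<Longrightarrow>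
      feas (acode pe' n)"
  shows "gain pe n \<le> prof c"
proof -
  define e where "e = y * Y + n * M + code y sl pe n"
  have cl: "code y sl pe n < M" using assms by (intro code_less) auto
  have ve: "1 + gain pe n \<le> v e" using path_value[OF assms(1-3), of n] e_def by simp
  have "sound e (v e) (a e)" using assms(1) unfolding good_def by auto
  then obtain y' sl' pe' i where *: "i \<le> n" "valid y' sl' pe' i" "e = y' * Y + i * M + code y' sl' pe' i"
        "a e = acode pe' i" unfolding sound_def using ve by auto
  have yi: "y' = y" "i = n" "code y' sl' pe' i = code y sl pe n"
    using entry_decode[OF code_less[OF *(2,1)] *(1,3)] entry_decode[OF cl _ e_def] by auto
  have fe: "feas (a e)" unfolding *(4) yi(2)
    using * yi by (intro exch code_eq_load) (auto intro: assms)
  have "n * M + code y sl pe n < Y" unfolding Y_def using cl by (simp add: algebra_simps)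
  then have "e < (y + 1) * Y" unfolding e_def by simp
  also have "\<dots> \<le> M * Y" using assms(3) by (intro mult_right_mono) auto
  \<comment> \<open>\<open>e * opts\<close> is the first step that treats entry
    \<open>e\<close>.\<close>
  finally have "e * opts < M * Y * opts" using opts_pos by simp
  then have "feas (a (e * opts div opts)) \<longrightarrow> v (e * opts div opts) \<le> b" 
    using assms(1) unfolding good_def by blast
  then have "v e \<le> b" using fe opts_pos by simp
  then show ?thesis using ve assms(1) unfolding good_def by auto
qed

end

section \<open>Groups and slack\<close>

context gik_dp
begin

lemma theta_level0: "x < K \<Longrightarrow> \<theta> x = wm" by (simp add: \<theta>_def)

lemma sum_theta_blocks: "(\<Sum>x<K * j. \<theta> x) + K * wm = K * (wm * 2 ^ j)"
proof (induction j)
  case (Suc j)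
  have "(\<Sum>x<K * Suc j. \<theta> x) = (\<Sum>x<K * j. \<theta> x) + (\<Sum>x\<in>{K * j..<K * j + K}. \<theta> x)"
    using sum.union_disjoint[of "{..<K * j}" "{K * j..<K * j + K}" \<theta>]
    by (simp add: ivl_disj_un add.commute ivl_disj_int)
  also have "(\<Sum>x\<in>{K * j..<K * j + K}. \<theta> x) = (\<Sum>x\<in>{K * j..<K * j + K}. wm * 2 ^ j)"
  proof (intro sum.cong refl)
    fix x assume "x \<in> {K * j..<K * j + K}"
    then have "x div K = j" by (intro div_nat_eqI) auto
    then show "\<theta> x = wm * 2 ^ j" by (simp add: \<theta>_def)
  qed
  finally show ?case using Suc by (simp add: algebra_simps)
qed simp

text \<open>Geometric series: all rounds up to that of \<open>x\<close> together have at most twice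
  the sum of thresholds of its own round, which consists of \<open>K\<close> slots. This is the
  origin of the factor \<open>2 * K\<close> in the rounding unit.\<close>

lemma sum_theta_le: "(\<Sum>x'\<le>x. \<theta> x') \<le> 2 * K * \<theta> x"
proof -
  have "x < K * (x div K + 1)" using K16 by (simp add: dividend_less_times_div)
  then have "{..x} \<subseteq> {..<K * (x div K + 1)}" by auto
  then have "(\<Sum>x'\<le>x. \<theta> x') \<le> (\<Sum>x'<K * (x div K + 1). \<theta> x')" by (intro sum_mono2) auto
  also have "\<dots> \<le> K * (wm * 2 ^ (x div K + 1))" using sum_theta_blocks[of "x div K + 1"] by linarith
  also have "\<dots> = 2 * K * \<theta> x" by (simp add: \<theta>_def)
  finally show ?thesis .
qed

end

text \<open>The items of a fixed chain, listed in the order of their insertion; positions in the list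
  start at 0. The parameter \<open>c\<close> selects the groups that are given up.\<close>

locale gik_seq = gik_dp +
  fixes xs :: "nat list" and per :: "nat \<Rightarrow> nat" and c :: nat
  assumes xs_dist: "distinct xs" and xs_items: "set xs \<subseteq> {1..n}"
    and per_range: "\<And>i. i \<in> set xs \<Longrightarrow> per i \<in> {1..T}"
    and per_sorted: "\<And>k l. k \<le> l \<Longrightarrow> l < length xs \<Longrightarrow> per (xs ! k) \<le> per (xs ! l)"
    and prefix: "\<And>k. k < length xs \<Longrightarrow> (\<Sum>l\<le>k. w (xs ! l)) \<le> W (per (xs ! k))"
    and c_less: "c < L"
begin

abbreviation m where "m \<equiv> length xs"
abbreviation \<omega> where "\<omega> k \<equiv> w (xs ! k)"

lemma xs_nth: "k < m \<Longrightarrow> xs ! k \<in> {1..n}"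
  using xs_items nth_mem by blast

lemma sum_omega_le: "(\<Sum>k<m. \<omega> k) \<le> sw"
proof -
  have "(\<Sum>k<m. \<omega> k) = (\<Sum>i\<in>set xs. w i)"
    using sum.reindex_bij_betw[OF bij_betw_nth[OF xs_dist refl refl], of w] by simp
  also have "\<dots> \<le> (\<Sum>i\<in>{1..n}. w i)" using xs_items by (intro sum_mono2) auto
  also have "\<dots> = sw" unfolding sw_def by (rule sum.reindex_bij_witness[of _ Suc "\<lambda>i. i - 1"]) auto
  finally show ?thesis .
qed

text \<open>If the items run out before the group \<open>g\<close> starting at position \<open>a\<close> is full, then
  \<open>closing g a = max a m\<close> is not a position.\<close>

definition closing where
  "closing g a = (LEAST k. a \<le> k \<and> (m \<le> k \<or> \<theta> (2 * g) \<le> (\<Sum>l\<in>{a..k}. \<omega> l)))"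

primrec start where
  "start 0 = 0"
| "start (Suc g) = Suc (closing g (start g))"

abbreviation fin where "fin g \<equiv> closing g (start g)"

lemma closing: "a \<le> closing g a" "m \<le> closing g a \<or> \<theta> (2 * g) \<le> (\<Sum>l\<in>{a..closing g a}. \<omega> l)"
proof -
  have "\<exists>k. a \<le> k \<and> (m \<le> k \<or> \<theta> (2 * g) \<le> (\<Sum>l\<in>{a..k}. \<omega> l))"
    by (rule exI[of _ "max a m"]) auto
  from LeastI_ex[OF this] show "a \<le> closing g a" "m \<le> closing g a \<or> \<theta> (2 * g) \<le> (\<Sum>l\<in>{a..closing g a}. \<omega> l)"
    unfolding closing_def by auto
qed

lemma before_closing: "a \<le> k \<Longrightarrow> k < closing g a \<Longrightarrow> k < m \<and> (\<Sum>l\<in>{a..k}. \<omega> l) < \<theta> (2 * g)"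
  using not_less_Least[of k "\<lambda>k. a \<le> k \<and> (m \<le> k \<or> \<theta> (2 * g) \<le> (\<Sum>l\<in>{a..k}. \<omega> l))"]
  unfolding closing_def by auto

lemma start_less: "start g < start (Suc g)" using closing(1)[of "start g" g] by simp

lemma start_strict: "g < h \<Longrightarrow> start g < start h" by (rule lift_Suc_mono_less[of start, OF start_less])

lemma start_mono: "g \<le> h \<Longrightarrow> start g \<le> start h" using start_strict[of g h] by (cases "g = h") auto

lemma start_ge: "g \<le> start g"
proof (induction g)
  case (Suc g)
  then show ?case using start_less[of g] by linarith
qed simp

lemma bucket_weight: "(\<Sum>l\<in>{start g..<fin g}. \<omega> l) < \<theta> (2 * g)"
proof (cases "start g < fin g")
  case True
  then have "{start g..<fin g} = {start g..fin g - 1}" by auto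
  then show ?thesis using before_closing[of "start g" "fin g - 1" g] True by auto
qed (use theta_pos in auto)

definition grp where "grp k = (LEAST g. k < start (Suc g))"

lemma grp: "start (grp k) \<le> k" "k < start (Suc (grp k))"
proof -
  have "\<exists>g. k < start (Suc g)" using start_ge[of "Suc k"] by (intro exI[of _ k]) auto
  from LeastI_ex[OF this] show 1: "k < start (Suc (grp k))" unfolding grp_def .
  show "start (grp k) \<le> k"
  proof (cases "grp k")
    case (Suc g)
    then have "\<not> k < start (Suc g)" using not_less_Least[of g "\<lambda>g. k < start (Suc g)"] unfolding grp_def by simp
    then show ?thesis using Suc by simp
  qed simp
qed

lemma grp_eq: "start g \<le> k \<Longrightarrow> k < start (Suc g) \<Longrightarrow> grp k = g"
  using grp[of k] start_mono[of "Suc g" "grp k"] start_mono[of "Suc (grp k)" g]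
  by (meson not_less_eq_eq le_trans leD nat_le_linear le_antisym not_le)

section \<open>Slots, the fitting guess and the truncated chain as a solution\<close>

definition removed where "removed g \<longleftrightarrow> g div 4 mod L = c"

definition slot where "slot k = (if k = fin (grp k) then 2 * grp k + 1 else 2 * grp k)"

text \<open>The position whose insertion period becomes the start period of slot \<open>x\<close>.
  If the bucket of a group is empty, both of its slots have the same key.\<close>

definition key where "key x = (if even x then start (x div 2) else fin (x div 2))"

definition live where "live x \<longleftrightarrow> key x < m \<and> \<not> removed (x div 2)"

definition tdig where
  "tdig x = (if live x then per (xs ! key x) * (n + 1) + (if even x then 0 else xs ! key x)
             else (T + 1) * (n + 1))"

definition guess where "guess = (\<Sum>x<X. tdig x * B ^ x)"

lemma grp_le_fin: "k \<le> fin (grp k)" using grp(2)[of k] by simp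

lemma slot_div: "slot k div 2 = grp k" by (simp add: slot_def)

text \<open>A position past the last slot would force the last group of round \<open>J - 1\<close>
  to be full. Its threshold is \<open>wm * 2 ^ (J - 1)\<close>, which by the choice of
  \<open>J\<close> exceeds the weight of all items.\<close>

lemma grp_bound: assumes "k < m" shows "2 * grp k + 1 < X"
proof (rule ccontr)
  define h where "h = 4 * L * J"
  have Kj: "K * j = 2 * (4 * L * j)" for j using K_L by simp
  have Xh: "X = 2 * h" unfolding X_def h_def by (rule Kj)
  have h0: "0 < h" using Xh X_pos by simp
  assume "\<not> 2 * grp k + 1 < X"
  then have gh: "h \<le> grp k" using Xh by linarith
  then have "start h \<le> k" using start_mono[OF gh] grp(1)[of k] by linarith
  then have fin: "fin (h - 1) < m" using assms h0 by (cases h) auto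
  then have "\<theta> (2 * (h - 1)) \<le> (\<Sum>l\<in>{start (h - 1)..fin (h - 1)}. \<omega> l)"
    using closing(2)[where g = "h - 1" and a = "start (h - 1)"] by linarith
  also have "\<dots> \<le> (\<Sum>k<m. \<omega> k)" using fin by (intro sum_mono2) auto
  also have "\<dots> \<le> sw" by (rule sum_omega_le)
  finally have 1: "\<theta> (2 * (h - 1)) \<le> sw" .
  have "2 * (h - 1) div K = J - 1"
  proof (rule div_nat_eqI)
    obtain j where j: "J = Suc j" using J_pos by (cases J) auto
    show "K * (J - 1) \<le> 2 * (h - 1)" unfolding h_def j K_L using L2 by (simp add: algebra_simps)
    show "2 * (h - 1) < K * Suc (J - 1)" unfolding h_def j K_L using L2 by (simp add: algebra_simps)
  qed
  then have "2 * \<theta> (2 * (h - 1)) = wm * (2 * 2 ^ (J - 1))" by (simp add: \<theta>_def)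
  also have "\<dots> = wm * 2 ^ J" using J_pos by (cases J) auto
  finally show False using 1 J_gt by linarith
qed

lemma slot_bound: "k < m \<Longrightarrow> slot k < X" using grp_bound[of k] by (simp add: slot_def)

lemma key_slot_le: "key (slot k) \<le> k"
  unfolding key_def slot_def using grp(1)[of k] by auto

lemma live_slot: "k < m \<Longrightarrow> \<not> removed (grp k) \<Longrightarrow> live (slot k)"
  unfolding live_def slot_div using key_slot_le[of k] by linarith

lemma tdig_less: "tdig x < B"
proof -
  have "tdig x \<le> (T + 1) * (n + 1)"
  proof (cases "live x")
    case True
    then have k: "key x < m" by (simp add: live_def)
    have "per (xs ! key x) * (n + 1) + (if even x then 0 else xs ! key x) \<le> T * (n + 1) + (n + 1)"
      using per_range[OF nth_mem[OF k]] xs_nth[OF k] by (intro add_mono mult_right_mono) auto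
    then show ?thesis using True by (simp add: tdig_def)
  qed (simp add: tdig_def)
  also have "\<dots> < (T + 2) * (n + 1)" by simp
  also have "\<dots> \<le> B" by (rule B_bounds)
  finally show ?thesis .
qed

lemma guess_less: "guess < M" unfolding guess_def M_def by (intro digit_sum_less tdig_less)

lemma dig_guess: "x < X \<Longrightarrow> dig guess x = tdig x"
  unfolding dig_def guess_def by (rule digit_of_sum) (auto intro: tdig_less)

lemma tau_guess: "x < X \<Longrightarrow> tau guess x = (if live x then per (xs ! key x) else T + 1)"
proof -
  assume x: "x < X"
  show ?thesis
  proof (cases "live x")
    case True
    then have "(if even x then 0 else xs ! key x) < n + 1"
      using xs_nth[of "key x"] by (auto simp: live_def)
    then have "(per (xs ! key x) * (n + 1) + (if even x then 0 else xs ! key x)) div (n + 1) = per (xs ! key x)"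
      by (intro div_nat_eqI) auto
    then show ?thesis unfolding tau_def dig_guess[OF x] tdig_def using True by simp
  next
    case False
    have "(T + 1) * (n + 1) div (n + 1) = T + 1" by (rule nonzero_mult_div_cancel_right) simp
    then show ?thesis unfolding tau_def dig_guess[OF x] tdig_def using False by simp
  qed
qed

lemma sel_guess: "x < X \<Longrightarrow> sel guess x = (if live x \<and> odd x then xs ! key x else 0)"
proof -
  assume x: "x < X"
  show ?thesis
  proof (cases "live x")
    case True
    then have "(if even x then 0 else xs ! key x) < n + 1"
      using xs_nth[of "key x"] by (auto simp: live_def)
    then have "(per (xs ! key x) * (n + 1) + (if even x then 0 else xs ! key x)) mod (n + 1) = (if even x then 0 else xs ! key x)"
      by (simp only: mod_mult_self3) simp
    then show ?thesis unfolding sel_def dig_guess[OF x] tdig_def using True by simp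
  next
    case False
    have "(T + 1) * (n + 1) mod (n + 1) = 0" by (rule mod_mult_self2_is_0)
    then show ?thesis unfolding sel_def dig_guess[OF x] tdig_def using False by simp
  qed
qed

definition kept where "kept = {k. k < m \<and> \<not> removed (grp k)}"

definition pos where "pos i = (THE k. k < m \<and> xs ! k = Suc i)"

text \<open>With \<open>tsl\<close>, the target solution: every surviving item keeps its own period
  and takes the slot of its position. Index \<open>i\<close> stands for item \<open>i + 1\<close>,
  as in \<open>valid\<close>.\<close>

definition tpe where "tpe i = (if Suc i \<in> (!) xs ` kept then per (Suc i) else 0)"
definition tsl where "tsl i = slot (pos i)"

lemma pos_nth: "k < m \<Longrightarrow> xs ! k = Suc i \<Longrightarrow> pos i = k"
  unfolding pos_def using nth_eq_iff_index_eq[OF xs_dist] by (intro the_equality) metis+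

lemma tpe_cases:
  assumes "tpe i \<noteq> 0"
  obtains k where "k \<in> kept" "xs ! k = Suc i" "tsl i = slot k" "tpe i = per (xs ! k)"
  using assms pos_nth unfolding tpe_def tsl_def kept_def by (auto split: if_splits)

lemma tpe_kept: assumes "k \<in> kept" shows "tpe (xs ! k - 1) = per (xs ! k)" "tsl (xs ! k - 1) = slot k" "xs ! k - 1 < n"
    "Suc (xs ! k - 1) = xs ! k"
proof -
  have k: "k < m" using assms by (simp add: kept_def)
  then have i: "Suc (xs ! k - 1) = xs ! k" "xs ! k - 1 < n" using xs_nth[OF k] by auto
  show "tpe (xs ! k - 1) = per (xs ! k)" unfolding tpe_def i using assms by auto
  show "tsl (xs ! k - 1) = slot k" unfolding tsl_def using pos_nth[OF k] i by simp
  show "xs ! k - 1 < n" "Suc (xs ! k - 1) = xs ! k" by fact+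
qed

text \<open>Passes from sums over items, as the table forms them, to sums over positions, where
  groups and prefix weights live; \<open>pos\<close> inverts the list.\<close>

lemma sum_target:
  "(\<Sum>i<n. if tpe i \<noteq> 0 \<and> P (tsl i) then f (Suc i) (tpe i) else (0::nat)) =
   (\<Sum>k | k \<in> kept \<and> P (slot k). f (xs ! k) (per (xs ! k)))"
proof -
  have "(\<Sum>i<n. if tpe i \<noteq> 0 \<and> P (tsl i) then f (Suc i) (tpe i) else 0)
      = (\<Sum>i | i < n \<and> tpe i \<noteq> 0 \<and> P (tsl i). f (Suc i) (tpe i))"
    by (simp add: sum.inter_filter[symmetric])
  also have "\<dots> = (\<Sum>k | k \<in> kept \<and> P (slot k). f (xs ! k) (per (xs ! k)))"
  proof (rule sum.reindex_bij_witness[of _ "\<lambda>k. xs ! k - 1" pos])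
    fix i assume "i \<in> {i. i < n \<and> tpe i \<noteq> 0 \<and> P (tsl i)}"
    then have "tpe i \<noteq> 0" and P: "P (tsl i)" by auto
    from this(1) obtain k where k: "k \<in> kept" "xs ! k = Suc i" "tsl i = slot k" "tpe i = per (xs ! k)"
      by (rule tpe_cases)
    then have "pos i = k" using pos_nth by (auto simp: kept_def)
    then show "xs ! pos i - 1 = i" "pos i \<in> {k. k \<in> kept \<and> P (slot k)}"
      "f (xs ! pos i) (per (xs ! pos i)) = f (Suc i) (tpe i)"
      using k P by auto
  next
    fix k assume k: "k \<in> {k. k \<in> kept \<and> P (slot k)}"
    then have "per (xs ! k) \<noteq> 0" using per_range[OF nth_mem[of k]] by (auto simp: kept_def)
    then show "pos (xs ! k - 1) = k" "xs ! k - 1 \<in> {i. i < n \<and> tpe i \<noteq> 0 \<and> P (tsl i)}"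
      using k tpe_kept[of k] pos_nth[of k "xs ! k - 1"] by (auto simp: kept_def)
  qed
  finally show ?thesis .
qed

lemma in_bucket: assumes "k \<noteq> fin (grp k)" shows "\<omega> k < \<theta> (2 * grp k)"
proof -
  have "k < fin (grp k)" using grp_le_fin[of k] assms by linarith
  then have "k \<in> {start (grp k)..<fin (grp k)}" using grp(1) by auto
  then have "\<omega> k \<le> (\<Sum>l\<in>{start (grp k)..<fin (grp k)}. \<omega> l)" by (intro member_le_sum) auto
  then show ?thesis using bucket_weight[of "grp k"] by linarith
qed

text \<open>Start periods are read off at \<open>key\<close>, which never comes after the position
  itself, so an item's own period is late enough. A bucket item is lighter than the threshold
  because its whole bucket is.\<close>

lemma valid_target: "valid guess tsl tpe n"
  unfolding valid_def
proof (intro allI impI)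
  fix i assume i: "i < n"
  show "tpe i = 0 \<or> tsl i < X \<and> tpe i \<le> T \<and> allowed guess (Suc i) (tsl i) (tpe i)"
  proof (cases "tpe i = 0")
    case False
    then obtain k where k: "k \<in> kept" "xs ! k = Suc i" "tsl i = slot k" "tpe i = per (xs ! k)"
      by (rule tpe_cases)
    have km: "k < m" using k by (simp add: kept_def)
    have lv: "live (slot k)" using live_slot k by (simp add: kept_def)
    have sX: "slot k < X" using slot_bound[OF km] .
    have t: "tau guess (slot k) \<le> per (xs ! k)"
      unfolding tau_guess[OF sX] using lv per_sorted[OF key_slot_le km] by simp
    have a: "sel guess (slot k) = Suc i \<or> sel guess (slot k) = 0 \<and> w (Suc i) < \<theta> (slot k)"
    proof (cases "k = fin (grp k)")
      case True
      then have "key (slot k) = k" "odd (slot k)" by (auto simp: key_def slot_def)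
      then show ?thesis unfolding sel_guess[OF sX] using lv k by simp
    next
      case False
      then have "slot k = 2 * grp k" by (simp add: slot_def)
      then show ?thesis unfolding sel_guess[OF sX] using in_bucket[OF False] k by simp
    qed
    show ?thesis using t a sX k per_range[OF nth_mem[OF km]] unfolding allowed_def by auto
  qed simp
qed

lemma gain_target: "gain tpe n = (\<Sum>k\<in>kept. p (xs ! k) (per (xs ! k)))"
proof -
  have "gain tpe n = (\<Sum>i<n. if tpe i \<noteq> 0 \<and> True then p (Suc i) (tpe i) else 0)"
    unfolding gain_def by (intro sum.cong) auto
  also have "\<dots> = (\<Sum>k | k \<in> kept \<and> True. p (xs ! k) (per (xs ! k)))"
    by (rule sum_target[of "\<lambda>_. True" p])
  finally show ?thesis by simp
qed

section \<open>Weight freed by the groups that are given up\<close>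

text \<open>The positions given up in the round before that of slot \<open>x\<close>, which provide the slack.\<close>

definition rem where "rem x = {start (4 * (L * (x div K - 1) + c))..<start (4 * (L * (x div K - 1) + c) + 4)}"

lemma rem_removed: assumes "k \<in> rem x" shows "removed (grp k)"
proof -
  define q where "q = L * (x div K - 1) + c"
  have k: "start (4 * q) \<le> k" "k < start (4 * q + 4)" using assms by (auto simp: rem_def q_def)
  have "4 * q \<le> grp k"
  proof (rule ccontr)
    assume "\<not> 4 * q \<le> grp k"
    then have "start (Suc (grp k)) \<le> start (4 * q)" by (intro start_mono) auto
    then show False using k(1) grp(2)[of k] by linarith
  qed
  moreover have "grp k < 4 * q + 4"
  proof (rule ccontr)
    assume "\<not> grp k < 4 * q + 4"
    then have "start (4 * q + 4) \<le> start (grp k)" by (intro start_mono) auto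
    then show False using k(2) grp(1)[of k] by linarith
  qed
  ultimately have "grp k div 4 = q" by (intro div_nat_eqI) auto
  then show ?thesis unfolding removed_def q_def using c_less by simp
qed

lemma group_weight:
  assumes "start (Suc g) \<le> m"
  shows "\<theta> (2 * g) \<le> (\<Sum>l\<in>{start g..<start (Suc g)}. \<omega> l)"
proof -
  have "fin g < m" using assms by simp
  then have "\<theta> (2 * g) \<le> (\<Sum>l\<in>{start g..fin g}. \<omega> l)" using closing(2)[where g = g and a = "start g"] by linarith
  moreover have "{start g..fin g} = {start g..<start (Suc g)}" by auto
  ultimately show ?thesis by simp
qed

text \<open>The block given up one round earlier ends before the group of \<open>x\<close>; as
  \<open>x\<close> is live, the list reaches that far and the four groups of the block are full.
  Each weighs at least half of \<open>\<theta> x\<close>.\<close>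

lemma rem_weight:
  assumes "K \<le> x" "live x"
  shows "rem x \<subseteq> {..<start (x div 2)}" "2 * \<theta> x \<le> (\<Sum>l\<in>rem x. \<omega> l)"
proof -
  define j where "j = x div K - 1"
  define q where "q = L * j + c"
  have xj: "x div K = Suc j" using assms(1) K16 unfolding j_def by (simp add: div_greater_zero_iff)
  have "(x div K) * K \<le> x" by simp
  then have "Suc j * (8 * L) \<le> x" unfolding xj by (simp only: K_L[symmetric])
  then have "4 * (L * j + L) \<le> x div 2" by (simp add: algebra_simps less_eq_div_iff_mult_less_eq)
  moreover have "4 * (L * j + c + 1) \<le> 4 * (L * j + L)" using c_less by (intro mult_left_mono) auto
  ultimately have "4 * (L * j + c + 1) \<le> x div 2" by (rule le_trans[rotated])
  then have qx: "4 * q + 4 \<le> x div 2" unfolding q_def by simp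
  have "start (x div 2) \<le> key x" unfolding key_def using closing(1) by auto
  then have sm: "start (4 * q + 4) \<le> start (x div 2)" "start (x div 2) < m"
    using start_mono[OF qx] assms(2) by (auto simp: live_def)
  show "rem x \<subseteq> {..<start (x div 2)}" unfolding rem_def using sm(1) by (auto simp: q_def j_def)
  have th: "\<theta> (2 * g) = wm * 2 ^ j" if "4 * q \<le> g" "g < 4 * q + 4" for g
  proof -
    have "2 * g div K = j"
    proof (rule div_nat_eqI)
      show "K * j \<le> 2 * g" using that unfolding q_def K_L by (simp add: algebra_simps)
      have "g < 4 * (L * j + c + 1)" using that unfolding q_def by simp
      also have "\<dots> \<le> 4 * (L * j + L)" using c_less by (intro mult_left_mono) auto
      finally have "g < 4 * (L * j + L)" .
      then show "2 * g < K * Suc j" unfolding K_L by (simp add: algebra_simps)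
    qed
    then show ?thesis by (simp add: \<theta>_def)
  qed
  have gw: "wm * 2 ^ j \<le> (\<Sum>l\<in>{start g..<start (Suc g)}. \<omega> l)" if "4 * q \<le> g" "g < 4 * q + 4" for g
    unfolding th[OF that, symmetric] using that sm start_mono[of "Suc g" "4 * q + 4"]
    by (intro group_weight) linarith
  have acc: "s * (wm * 2 ^ j) \<le> (\<Sum>l\<in>{start (4 * q)..<start (4 * q + s)}. \<omega> l)" if "s \<le> 4" for s
    using that
  proof (induction s)
    case (Suc s)
    have "(\<Sum>l\<in>{start (4 * q)..<start (4 * q + Suc s)}. \<omega> l)
        = (\<Sum>l\<in>{start (4 * q)..<start (4 * q + s)}. \<omega> l) + (\<Sum>l\<in>{start (4 * q + s)..<start (Suc (4 * q + s))}. \<omega> l)"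
      using sum.atLeastLessThan_concat[of "start (4 * q)" "start (4 * q + s)" "start (4 * q + Suc s)" \<omega>]
        start_mono[of "4 * q" "4 * q + s"] start_mono[of "4 * q + s" "4 * q + Suc s"] by simp
    then show ?case using Suc gw[of "4 * q + s"] by simp
  qed simp
  have "2 * \<theta> x = 4 * (wm * 2 ^ j)" by (simp add: \<theta>_def xj)
  also have "\<dots> \<le> (\<Sum>l\<in>rem x. \<omega> l)" using acc[of 4] unfolding rem_def q_def j_def by simp
  finally show "2 * \<theta> x \<le> (\<Sum>l\<in>rem x. \<omega> l)" .
qed

definition tw where "tw x = (\<Sum>k | k \<in> kept \<and> slot k = x. \<omega> k)"

lemma kept_finite [simp]: "finite kept" unfolding kept_def by simp

lemma sum_tw: "(\<Sum>x'\<le>x. tw x') = (\<Sum>k | k \<in> kept \<and> slot k \<le> x. \<omega> k)"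
proof -
  have "(\<Sum>x'\<le>x. tw x') = (\<Sum>x'\<le>x. \<Sum>k | k \<in> {k \<in> kept. slot k \<le> x} \<and> slot k = x'. \<omega> k)"
    unfolding tw_def by (intro sum.cong) auto
  also have "\<dots> = (\<Sum>k\<in>{k \<in> kept. slot k \<le> x}. \<omega> k)"
    by (rule sum.group) auto
  finally show ?thesis by simp
qed

text \<open>Slots up to \<open>x\<close> reach beyond the position \<open>key x\<close> only if
  \<open>x\<close> is a bucket, and then only by the rest of that bucket.\<close>

lemma slot_less_key: assumes "slot k \<le> x" shows "k \<le> key x \<or> even x \<and> k \<in> {start (x div 2)..<fin (x div 2)}"
proof -
  have "grp k \<le> x div 2" using div_le_mono[OF assms, of 2] slot_div by simp
  moreover have "k \<le> key x" if "grp k < x div 2"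
  proof -
    have "k < start (x div 2)" using grp(2)[of k] start_mono[of "Suc (grp k)" "x div 2"] that by linarith
    also have "\<dots> \<le> key x" unfolding key_def using closing(1) by auto
    finally show ?thesis by simp
  qed
  moreover have ?thesis if "grp k = x div 2"
  proof (cases "even x")
    case True
    then have "k \<noteq> fin (grp k)" using assms that by (auto simp: slot_def)
    then show ?thesis using that grp(1)[of k] grp_le_fin[of k] True by auto
  next
    case False
    then show ?thesis using that grp_le_fin[of k] by (simp add: key_def)
  qed
  ultimately show ?thesis by linarith
qed

text \<open>From the prefix up to \<open>key x\<close> at least \<open>2 * \<theta> x\<close> has
  been removed, and the bucket of \<open>x\<close> adds back less than \<open>\<theta> x\<close>.
  The remaining \<open>\<theta> x\<close> is reserved for rounding.\<close>

lemma kept_weight: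
  assumes "live x" "K \<le> x"
  shows "(\<Sum>x'\<le>x. tw x') + \<theta> x \<le> (\<Sum>l\<le>key x. \<omega> l)"
proof -
  let ?A = "{k \<in> kept. slot k \<le> x}"
  let ?Bk = "if even x then {start (x div 2)..<fin (x div 2)} else {}"
  have rk: "rem x \<subseteq> {..key x}"
    using rem_weight(1)[OF assms(2,1)] closing(1)[of "start (x div 2)" "x div 2"] unfolding key_def by (auto split: if_splits)
  have fr: "finite (rem x)" unfolding rem_def by simp
  have "?A \<subseteq> ({..key x} - rem x) \<union> ?Bk"
    using slot_less_key rem_removed unfolding kept_def by fastforce
  then have "(\<Sum>k\<in>?A. \<omega> k) \<le> (\<Sum>k\<in>({..key x} - rem x) \<union> ?Bk. \<omega> k)" by (intro sum_mono2) auto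
  also have "\<dots> \<le> (\<Sum>k\<in>{..key x} - rem x. \<omega> k) + (\<Sum>k\<in>?Bk. \<omega> k)"
    using sum_Un_nat[of "{..key x} - rem x" ?Bk \<omega>] by simp
  also have "(\<Sum>k\<in>?Bk. \<omega> k) \<le> \<theta> x"
  proof (cases "even x")
    case True
    then show ?thesis using bucket_weight[of "x div 2"] by simp
  qed simp
  finally have "(\<Sum>k\<in>?A. \<omega> k) \<le> (\<Sum>k\<in>{..key x} - rem x. \<omega> k) + \<theta> x" by simp
  moreover have "(\<Sum>k\<in>{..key x} - rem x. \<omega> k) + (\<Sum>k\<in>rem x. \<omega> k) = (\<Sum>l\<le>key x. \<omega> l)"
    using sum.subset_diff[OF rk, of \<omega>] by simp
  ultimately show ?thesis using rem_weight(2)[OF assms(2,1)] unfolding sum_tw by simp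
qed

text \<open>A closing slot ends at its key, so no slack is required. The first round, which has
  none, relies on this.\<close>

lemma kept_weight_odd:
  assumes "odd x"
  shows "(\<Sum>x'\<le>x. tw x') \<le> (\<Sum>l\<le>key x. \<omega> l)"
  unfolding sum_tw using slot_less_key assms by (intro sum_mono2) fastforce+

lemma tw_odd: assumes "odd x" "live x" shows "\<omega> (key x) \<le> tw x"
proof -
  have k: "key x = fin (x div 2)" using assms by (simp add: key_def)
  have g: "grp (key x) = x div 2" unfolding k using closing(1) by (intro grp_eq) auto
  then have "slot (key x) = x" unfolding slot_def using k assms by simp
  then have "key x \<in> {k \<in> kept. slot k = x}" using assms g unfolding kept_def live_def by auto
  then show ?thesis unfolding tw_def by (intro member_le_sum) auto
qed

end

section \<open>Exchange: every solution with the same guess and the same rounded loads is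
  feasible\<close>

locale gik_exchange = gik_seq +
  fixes sl pe :: "nat \<Rightarrow> nat"
  assumes val: "valid guess sl pe n"
    and loads: "\<And>x. x < X \<Longrightarrow> load guess sl pe n x = load guess tsl tpe n x"
begin

definition ww where "ww x = (\<Sum>i<n. if pe i \<noteq> 0 \<and> sl i = x then w (Suc i) else 0)"

lemma used: assumes "i < n" "pe i \<noteq> 0"
  shows "sl i < X" "live (sl i)" "tau guess (sl i) \<le> pe i" "pe i \<le> T"
   "if odd (sl i) then Suc i = xs ! key (sl i) else w (Suc i) < \<theta> (sl i)"
proof -
  have *: "sl i < X" "pe i \<le> T" "allowed guess (Suc i) (sl i) (pe i)" using val assms unfolding valid_def by auto
  then show l: "live (sl i)" using tau_guess[OF *(1)] unfolding allowed_def by (auto split: if_splits)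
  show "sl i < X" "tau guess (sl i) \<le> pe i" "pe i \<le> T" using * by (auto simp: allowed_def)
  show "if odd (sl i) then Suc i = xs ! key (sl i) else w (Suc i) < \<theta> (sl i)"
    using *(3) sel_guess[OF *(1)] l xs_nth[of "key (sl i)"] unfolding allowed_def by (auto simp: live_def)
qed

lemma ww_zero: "\<not> live x \<Longrightarrow> ww x = 0"
  unfolding ww_def using used(2) by (intro sum.neutral) auto

lemma ww_level0: assumes "x < K" "even x" shows "ww x = 0"
  unfolding ww_def
proof (intro sum.neutral ballI)
  fix i assume i: "i \<in> {..<n}"
  have "\<not> (pe i \<noteq> 0 \<and> sl i = x)"
    using used(5)[of i] i assms wm_le[of "Suc i"] theta_level0[OF assms(1)] by auto
  then show "(if pe i \<noteq> 0 \<and> sl i = x then w (Suc i) else 0) = 0" by (rule if_not_P)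
qed

text \<open>The guess admits at most its one closing item here, and the target solution does contain
  that item.\<close>

lemma ww_odd: assumes "odd x" shows "ww x \<le> tw x"
proof (cases "live x")
  case True
  have "ww x \<le> (\<Sum>i<n. if i = xs ! key x - 1 then \<omega> (key x) else 0)"
    unfolding ww_def
  proof (intro sum_mono)
    fix i assume "i \<in> {..<n}"
    then have "Suc i = xs ! key x" if "pe i \<noteq> 0" "sl i = x" using used(5)[of i] that assms by auto
    then show "(if pe i \<noteq> 0 \<and> sl i = x then w (Suc i) else 0) \<le> (if i = xs ! key x - 1 then \<omega> (key x) else 0)"
      by auto
  qed
  also have "\<dots> \<le> \<omega> (key x)" by (simp add: sum.delta)
  also have "\<dots> \<le> tw x" using tw_odd assms True by auto
  finally show ?thesis .
qed (simp add: ww_zero)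

text \<open>Rounding down loses less than \<open>\<theta> x / (2 * K * n)\<close> per item, hence at
  most \<open>\<theta> x / (2 * K)\<close> over all \<open>n\<close> items. The inequality is
  multiplied by \<open>2 * K\<close> to stay within the natural numbers.\<close>

lemma ww_even: assumes "even x" "x < X" shows "2 * K * ww x \<le> 2 * K * tw x + \<theta> x"
proof -
  have s: "sel guess x = 0" using sel_guess assms by simp
  let ?N = "2 * K * n"
  have r: "rnd guess i x = w i * ?N div \<theta> x" for i by (simp add: rnd_def s)
  have "?N * ww x = (\<Sum>i<n. if pe i \<noteq> 0 \<and> sl i = x then w (Suc i) * ?N else 0)"
    unfolding ww_def sum_distrib_left by (intro sum.cong) auto
  also have "\<dots> \<le> (\<Sum>i<n. (if pe i \<noteq> 0 \<and> sl i = x then rnd guess (Suc i) x else 0) * \<theta> x + \<theta> x)"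
  proof (intro sum_mono)
    fix i
    have "w (Suc i) * ?N < \<theta> x + w (Suc i) * ?N div \<theta> x * \<theta> x"
      using dividend_less_div_times[OF theta_pos] .
    then show "(if pe i \<noteq> 0 \<and> sl i = x then w (Suc i) * ?N else 0)
      \<le> (if pe i \<noteq> 0 \<and> sl i = x then rnd guess (Suc i) x else 0) * \<theta> x + \<theta> x"
      unfolding r by simp
  qed
  also have "\<dots> = load guess sl pe n x * \<theta> x + n * \<theta> x"
    unfolding load_def by (simp add: sum.distrib sum_distrib_right)
  also have "\<dots> = (\<Sum>i<n. (if tpe i \<noteq> 0 \<and> tsl i = x then rnd guess (Suc i) x else 0) * \<theta> x) + n * \<theta> x"
    unfolding loads[OF assms(2)] unfolding load_def sum_distrib_right ..
  also have "(\<Sum>i<n. (if tpe i \<noteq> 0 \<and> tsl i = x then rnd guess (Suc i) x else 0) * \<theta> x)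
      \<le> (\<Sum>i<n. if tpe i \<noteq> 0 \<and> tsl i = x then w (Suc i) * ?N else 0)"
    unfolding r by (intro sum_mono) auto
  also have "\<dots> = (\<Sum>i<n. if tpe i \<noteq> 0 \<and> tsl i = x then w (Suc i) else 0) * ?N"
    unfolding sum_distrib_right by (intro sum.cong) auto
  also have "(\<Sum>i<n. if tpe i \<noteq> 0 \<and> tsl i = x then w (Suc i) else 0) = tw x"
    unfolding tw_def using sum_target[of "\<lambda>y. y = x" "\<lambda>i _. w i"] by simp
  finally have "n * (2 * K * ww x) \<le> n * (2 * K * tw x + \<theta> x)" by (simp add: algebra_simps)
  then show ?thesis using n1 by simp
qed

text \<open>In the first round a nonempty slot must be a closing slot, and nothing has been rounded
  up to it. Later the errors of all slots up to \<open>x\<close> sum to at most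
  \<open>\<theta> x\<close>, just what \<open>kept_weight\<close> leaves free.\<close>

lemma ww_prefix:
  assumes "live x" "x < X" "0 < ww x"
  shows "(\<Sum>x'\<le>x. ww x') \<le> (\<Sum>l\<le>key x. \<omega> l)"
proof (cases "x < K")
  case True
  then have "odd x" using ww_level0[of x] assms by auto
  have "(\<Sum>x'\<le>x. ww x') \<le> (\<Sum>x'\<le>x. tw x')"
  proof (intro sum_mono)
    fix x' assume "x' \<in> {..x}"
    then show "ww x' \<le> tw x'" using ww_odd[of x'] ww_level0[of x'] True by (cases "odd x'") auto
  qed
  then show ?thesis using kept_weight_odd[OF \<open>odd x\<close>] by linarith
next
  case False
  have "2 * K * (\<Sum>x'\<le>x. ww x') \<le> (\<Sum>x'\<le>x. 2 * K * tw x' + \<theta> x')"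
    unfolding sum_distrib_left
  proof (intro sum_mono)
    fix x' assume "x' \<in> {..x}"
    then show "2 * K * ww x' \<le> 2 * K * tw x' + \<theta> x'"
      using ww_even[of x'] trans_le_add1[OF mult_left_mono[OF ww_odd[of x'], of "2 * K"], of "\<theta> x'"] assms(2)
      by (cases "odd x'") auto
  qed
  also have "\<dots> \<le> 2 * K * (\<Sum>x'\<le>x. tw x') + 2 * K * \<theta> x"
    unfolding sum.distrib sum_distrib_left[symmetric] using sum_theta_le[of x] by simp
  also have "\<dots> = 2 * K * ((\<Sum>x'\<le>x. tw x') + \<theta> x)" by (simp add: algebra_simps)
  also have "\<dots> \<le> 2 * K * (\<Sum>l\<le>key x. \<omega> l)"
    using kept_weight assms False by (intro mult_left_mono) auto
  finally show ?thesis using K16 by simp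
qed

text \<open>Let \<open>x\<close> be the largest slot used up to time \<open>t\<close>. Everything
  inserted so far lies in slots up to \<open>x\<close>, so it weighs no more than the chain's prefix
  up to \<open>key x\<close>; that prefix fits the capacity at the start period of \<open>x\<close>,
  which is at most \<open>t\<close>.\<close>

lemma feas_exchange: "feas (acode pe n)"
  unfolding feas_def
proof
  fix t assume t: "t \<in> {1..T}"
  define F where "F = {i. i < n \<and> 0 < pe i \<and> pe i \<le> t}"
  have "pe i \<le> T" if "i < n" for i using used(4)[of i] that by (cases "pe i = 0") auto
  then have "(\<Sum>i<n. if 0 < dig (acode pe n) i \<and> dig (acode pe n) i \<le> t then w (Suc i) else 0)
      = (\<Sum>i<n. if 0 < pe i \<and> pe i \<le> t then w (Suc i) else 0)"
    using dig_acode[of n pe] by (intro sum.cong) auto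
  also have "\<dots> = (\<Sum>i\<in>F. w (Suc i))" unfolding F_def by (simp add: sum.inter_filter[symmetric])
  also have "\<dots> \<le> W t"
  proof (cases "F = {}")
    case False
    have fF: "finite F" unfolding F_def by simp
    define x where "x = Max (sl ` F)"
    have "x \<in> sl ` F" unfolding x_def using False fF by (intro Max_in) auto
    then obtain i where i: "i \<in> F" "x = sl i" by auto
    then have i': "i < n" "pe i \<noteq> 0" "pe i \<le> t" by (auto simp: F_def)
    have le: "sl i \<le> x" if "i \<in> F" for i unfolding x_def using that fF by (intro Max_ge) auto
    have x: "x < X" "live x" "tau guess x \<le> t" using used(1-3)[OF i'(1,2)] i i' by auto
    have "0 < w (Suc i)" using i' w_pos by auto
    also have "\<dots> = (if pe i \<noteq> 0 \<and> sl i = x then w (Suc i) else 0)" using i' i by simp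
    also have "\<dots> \<le> ww x" unfolding ww_def using i' by (intro member_le_sum) auto
    finally have wx: "0 < ww x" .
    have "(\<Sum>i\<in>F. w (Suc i)) = (\<Sum>x'\<le>x. \<Sum>i | i \<in> F \<and> sl i = x'. w (Suc i))"
      using fF le by (intro sum.group[symmetric]) auto
    also have "\<dots> \<le> (\<Sum>x'\<le>x. ww x')"
    proof (intro sum_mono)
      fix x'
      have "ww x' = (\<Sum>i | i < n \<and> pe i \<noteq> 0 \<and> sl i = x'. w (Suc i))"
        unfolding ww_def by (simp add: sum.inter_filter[symmetric])
      then show "(\<Sum>i | i \<in> F \<and> sl i = x'. w (Suc i)) \<le> ww x'"
        unfolding F_def by (auto intro!: sum_mono2)
    qed
    also have "\<dots> \<le> (\<Sum>l\<le>key x. \<omega> l)" using ww_prefix x wx by auto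
    also have "\<dots> \<le> W (per (xs ! key x))" using prefix x by (auto simp: live_def)
    also have "\<dots> \<le> W t"
      using tau_guess[OF x(1)] x t per_range[OF nth_mem[of "key x"]]
      by (intro mono_onD[OF W_mono]) (auto simp: live_def)
    finally show ?thesis .
  qed simp
  finally show "(\<Sum>i<n. if 0 < dig (acode pe n) i \<and> dig (acode pe n) i \<le> t then w (Suc i) else 0) \<le> W t" .
qed

end

context gik_seq
begin

lemma target_value:
  assumes "good (M * Y * opts) (v, a, b, co)"
  shows "(\<Sum>k\<in>kept. p (xs ! k) (per (xs ! k))) \<le> prof co"
proof -
  have "gain tpe n \<le> prof co"
  proof (rule solution_value[OF assms valid_target guess_less])
    fix sl' pe'
    assume *: "valid guess sl' pe' n" "\<And>x. x < X \<Longrightarrow> load guess sl' pe' n x = load guess tsl tpe n x"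
    interpret gik_exchange I K L xs per c sl' pe' by unfold_locales (use * in auto)
    show "feas (acode pe' n)" by (rule feas_exchange)
  qed
  then show ?thesis by (simp add: gain_target)
qed

end

section \<open>Decoding chains, and averaging over the residue classes\<close>

context gik_dp
begin

definition chain_of where
  "chain_of A t = (if t = 0 then {} else {i \<in> {1..n}. 0 < dig A (i - 1) \<and> dig A (i - 1) \<le> t})"

lemma chain_of_eq: "chain_of A t = {i \<in> {1..n}. 0 < dig A (i - 1) \<and> dig A (i - 1) \<le> t}"
  by (auto simp: chain_of_def)

lemma feasible_chain_of: assumes "feas A" shows "feasible_chain I (chain_of A)"
  unfolding feasible_chain_def chain_def
proof (intro conjI ballI)
  fix t assume t: "t \<in> {1..T}"
  have "(\<Sum>i\<in>chain_of A t. w i) = (\<Sum>i | i < n \<and> 0 < dig A i \<and> dig A i \<le> t. w (Suc i))"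
    by (rule sum.reindex_bij_witness[of _ Suc "\<lambda>i. i - 1"]) (use t in \<open>auto simp: chain_of_def\<close>)
  also have "\<dots> = (\<Sum>i<n. if 0 < dig A i \<and> dig A i \<le> t then w (Suc i) else 0)"
    by (simp add: sum.inter_filter[symmetric])
  also have "\<dots> \<le> W t" using assms t unfolding feas_def by auto
  finally show "(\<Sum>i\<in>chain_of A t. w i) \<le> W t" .
qed (auto simp: chain_of_def)

lemma profit_chain_of: assumes "\<And>i. i < n \<Longrightarrow> dig A i \<le> T" shows "chain_profit I (chain_of A) = prof A"
proof -
  define F where "F = {i. i < n \<and> dig A i \<noteq> 0}"
  have "chain_profit I (chain_of A) = (\<Sum>t\<in>{1..T}. \<Sum>i | i \<in> F \<and> dig A i = t. p (Suc i) (dig A i))"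
    unfolding chain_profit_def
  proof (rule sum.cong[OF refl])
    fix t assume t: "t \<in> {1..T}"
    show "(\<Sum>i\<in>chain_of A t - chain_of A (t - 1). p i t) = (\<Sum>i | i \<in> F \<and> dig A i = t. p (Suc i) (dig A i))"
      by (rule sum.reindex_bij_witness[of _ Suc "\<lambda>i. i - 1"]) (use t in \<open>auto simp: chain_of_eq F_def intro!: arg_cong2[of _ _ _ _ p]\<close>)
  qed
  also have "\<dots> = (\<Sum>i\<in>F. p (Suc i) (dig A i))"
    using assms by (intro sum.group) (auto simp: F_def Suc_le_eq)
  also have "\<dots> = prof A" unfolding prof_def F_def
    by (intro sum.mono_neutral_cong_left) auto
  finally show ?thesis .
qed

lemma sound_dig: "sound e V A \<Longrightarrow> i < n \<Longrightarrow> dig A i \<le> T"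
proof -
  assume s: "sound e V A" and i: "i < n"
  show ?thesis
  proof (cases "A = 0")
    case False
    then obtain y sl pe j where *: "j \<le> n" "valid y sl pe j" "A = acode pe j" using s unfolding sound_def by auto
    have "pe k \<le> T" if "k < j" for k using * that unfolding valid_def by fastforce
    then show ?thesis unfolding *(3) using dig_acode[of j pe i] * i by auto
  qed simp
qed

definition ins where "ins S i = (if \<exists>t\<in>{1..T}. i \<in> S t then LEAST t. 1 \<le> t \<and> i \<in> S t else 0)" for S :: "nat \<Rightarrow> nat set"

lemma ins_props:
  assumes "ins S i \<noteq> 0"
  shows "ins S i \<in> {1..T}" "i \<in> S (ins S i)" "\<And>t. 1 \<le> t \<Longrightarrow> t < ins S i \<Longrightarrow> i \<notin> S t"
proof -
  obtain t where t: "t \<in> {1..T}" "i \<in> S t" using assms unfolding ins_def by (auto split: if_splits)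
  have eq: "ins S i = (LEAST t. 1 \<le> t \<and> i \<in> S t)" using assms unfolding ins_def by (auto split: if_splits)
  have "1 \<le> ins S i \<and> i \<in> S (ins S i)" unfolding eq using LeastI[of "\<lambda>t. 1 \<le> t \<and> i \<in> S t" t] t by auto
  moreover have "ins S i \<le> t" unfolding eq using t by (intro Least_le) auto
  ultimately show "ins S i \<in> {1..T}" "i \<in> S (ins S i)" using t by auto
  fix t' assume "1 \<le> t'" "t' < ins S i"
  then show "i \<notin> S t'" unfolding eq using not_less_Least by blast
qed

lemma ins_in: "i \<in> S t \<Longrightarrow> t \<in> {1..T} \<Longrightarrow> 0 < ins S i \<and> ins S i \<le> t"
proof -
  assume a: "i \<in> S t" "t \<in> {1..T}"
  then have eq: "ins S i = (LEAST t. 1 \<le> t \<and> i \<in> S t)" unfolding ins_def by auto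
  show ?thesis unfolding eq using LeastI[of "\<lambda>t. 1 \<le> t \<and> i \<in> S t" t] a Least_le[of "\<lambda>t. 1 \<le> t \<and> i \<in> S t" t] by auto
qed

lemma chain_mono: assumes "chain I S" "s \<le> t" "t \<le> T" shows "S s \<subseteq> S t"
  using assms(2,3)
proof (induction t)
  case (Suc t)
  have "S t \<subseteq> S (Suc t)" using assms(1) Suc.prems unfolding chain_def by force
  then show ?case using Suc by (cases "s = Suc t") auto
qed simp

lemma approximation:
  assumes S: "feasible_chain I S" and G: "good (M * Y * opts) (v, a, b, co)"
  shows "(L - 1) * chain_profit I S \<le> L * prof co"
    "n = 1 \<Longrightarrow> chain_profit I S \<le> prof co"
proof -
  have ch: "chain I S" and wt: "\<And>t. t \<in> {1..T} \<Longrightarrow> (\<Sum>i\<in>S t. w i) \<le> W t"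
    using S unfolding feasible_chain_def by auto
  have Sn: "S t \<subseteq> {1..n}" if "t \<in> {1..T}" for t using ch that unfolding chain_def by blast
  define U where "U = {i \<in> {1..n}. ins S i \<noteq> 0}"
  define xs where "xs = sort_key (ins S) (sorted_list_of_set U)"
  have fU: "finite U" unfolding U_def by simp
  have set_xs: "set xs = U" unfolding xs_def using fU by simp
  have dist: "distinct xs" unfolding xs_def by simp
  have sorted: "ins S (xs ! k) \<le> ins S (xs ! l)" if "k \<le> l" "l < length xs" for k l
    using sorted_nth_mono[of "map (ins S) xs" k l] that unfolding xs_def by simp
  have insU: "ins S i \<in> {1..T}" "i \<in> S (ins S i)" if "i \<in> U" for i
    using ins_props[of S i] that unfolding U_def by auto
  have pre: "(\<Sum>l\<le>k. w (xs ! l)) \<le> W (ins S (xs ! k))" if k: "k < length xs" for k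
  proof -
    have kU: "xs ! k \<in> U" using set_xs nth_mem[OF k] by simp
    have "(\<Sum>l\<le>k. w (xs ! l)) = (\<Sum>i\<in>(!) xs ` {..k}. w i)"
      using dist k by (subst sum.reindex) (auto simp: inj_on_def nth_eq_iff_index_eq)
    also have "\<dots> \<le> (\<Sum>i\<in>S (ins S (xs ! k)). w i)"
    proof (intro sum_mono2)
      show "finite (S (ins S (xs ! k)))" using Sn[OF insU(1)[OF kU]] by (rule finite_subset) simp
      show "(!) xs ` {..k} \<subseteq> S (ins S (xs ! k))"
      proof
        fix i assume "i \<in> (!) xs ` {..k}"
        then obtain l where l: "i = xs ! l" "l \<le> k" by auto
        then have "i \<in> U" using k set_xs nth_mem[of l xs] by auto
        then have "i \<in> S (ins S i)" using insU by auto
        also have "\<dots> \<subseteq> S (ins S (xs ! k))"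
          using chain_mono[OF ch sorted[OF l(2) k]] insU(1)[OF kU] l by auto
        finally show "i \<in> S (ins S (xs ! k))" .
      qed
    qed auto
    also have "\<dots> \<le> W (ins S (xs ! k))" using wt insU(1)[OF kU] by auto
    finally show ?thesis .
  qed
  have profS: "chain_profit I S = (\<Sum>k<length xs. p (xs ! k) (ins S (xs ! k)))"
  proof -
    have "chain_profit I S = (\<Sum>t\<in>{1..T}. \<Sum>i | i \<in> U \<and> ins S i = t. p i (ins S i))"
      unfolding chain_profit_def
    proof (rule sum.cong[OF refl])
      fix t assume t: "t \<in> {1..T}"
      have "i \<in> S t - S (t - 1) \<longleftrightarrow> i \<in> U \<and> ins S i = t" for i
      proof
        assume i: "i \<in> S t - S (t - 1)"
        then have *: "0 < ins S i" "ins S i \<le> t" using ins_in t by auto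
        have "ins S i = t"
        proof (rule ccontr)
          assume "ins S i \<noteq> t"
          then have "S (ins S i) \<subseteq> S (t - 1)" using * t by (intro chain_mono[OF ch]) auto
          then show False using i ins_props(2)[of S i] * by auto
        qed
        then show "i \<in> U \<and> ins S i = t" using i Sn[OF t] t unfolding U_def by auto
      next
        assume i: "i \<in> U \<and> ins S i = t"
        then have "i \<in> S t" using insU by auto
        moreover have "i \<notin> S (t - 1)"
        proof (cases "t = 1")
          case True
          then show ?thesis using ch unfolding chain_def by simp
        next
          case False
          then have "1 \<le> t - 1" "t - 1 < ins S i" "ins S i \<noteq> 0" using i t by auto
          then show ?thesis using ins_props(3)[of S i "t - 1"] by auto
        qed
        ultimately show "i \<in> S t - S (t - 1)" by auto
      qed
      then have "S t - S (t - 1) = {i. i \<in> U \<and> ins S i = t}" by blast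
      then show "(\<Sum>i\<in>S t - S (t - 1). p i t) = (\<Sum>i | i \<in> U \<and> ins S i = t. p i (ins S i))"
        by (intro sum.cong) auto
    qed
    also have "\<dots> = (\<Sum>i\<in>U. p i (ins S i))" using insU fU by (intro sum.group) auto
    also have "\<dots> = (\<Sum>k<length xs. p (xs ! k) (ins S (xs ! k)))"
      using sum.reindex_bij_betw[OF bij_betw_nth[OF dist refl refl], of "\<lambda>i. p i (ins S i)"] set_xs by simp
    finally show ?thesis .
  qed
  have loc: "gik_seq I K L xs (ins S) c" if "c < L" for c
    using dist sorted pre insU set_xs that by unfold_locales (auto simp: U_def)
  have grp0: "gik_seq.grp I K xs k = gik_seq.grp I K xs k" for k ..
  \<comment> \<open>The grouping does not depend on \<open>c\<close>, so the \<open>L\<close>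
    residue classes partition the positions and their losses add up to the whole profit.\<close>
  define g where "g = gik_seq.grp I K xs"
  define q where "q k = p (xs ! k) (ins S (xs ! k))" for k
  define loss where "loss c = (\<Sum>k | k \<in> {..<length xs} \<and> g k div 4 mod L = c. q k)" for c
  have tot: "(\<Sum>c<L. loss c) = (\<Sum>k<length xs. q k)"
    unfolding loss_def using L2 by (intro sum.group) auto
  have key: "chain_profit I S \<le> prof co + loss c" if "c < L" for c
  proof -
    interpret gik_seq I K L xs "ins S" c using loc that .
    have kp: "kept = {..<length xs} - {k \<in> {..<length xs}. g k div 4 mod L = c}"
      unfolding kept_def removed_def g_def by auto
    have "(\<Sum>k\<in>kept. q k) + loss c = (\<Sum>k<length xs. q k)"
      unfolding kp loss_def by (subst sum.subset_diff[of "{k \<in> {..<length xs}. g k div 4 mod L = c}"]) auto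
    then show ?thesis using target_value[OF G] unfolding profS q_def by linarith
  qed
  obtain c where c: "c < L" "L * loss c \<le> (\<Sum>k<length xs. q k)"
  proof -
    have "\<exists>c\<in>{..<L}. L * loss c \<le> (\<Sum>k<length xs. q k)"
    proof (rule ccontr)
      assume "\<not> ?thesis"
      then have "(\<Sum>c<L. \<Sum>k<length xs. q k) < (\<Sum>c<L. L * loss c)" using L2 by (intro sum_strict_mono) (auto simp: not_le lessThan_empty_iff)
      also have "\<dots> = L * (\<Sum>k<length xs. q k)" unfolding sum_distrib_left[symmetric] tot ..
      finally show False by simp
    qed
    then show ?thesis using that by auto
  qed
  have tq: "(\<Sum>k<length xs. q k) = chain_profit I S" unfolding profS q_def ..
  have "L * chain_profit I S \<le> L * prof co + L * loss c" using key[OF c(1)] by (metis add_mult_distrib2 mult_le_mono2)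
  then have "L * chain_profit I S - chain_profit I S \<le> L * prof co" using c(2) tq by linarith
  then show "(L - 1) * chain_profit I S \<le> L * prof co" by (simp add: diff_mult_distrib)
  assume "n = 1"
  then have "card U \<le> 1" using card_mono[of "{1..n}" U] by (auto simp: U_def)
  then have "length xs \<le> 1" using distinct_card[OF dist] set_xs by simp
  then have l: "loss c = 0 \<or> loss c = (\<Sum>k<length xs. q k)"
  proof -
    assume "length xs \<le> 1"
    then have "length xs = 0 \<or> length xs = 1" by linarith
    then have "{k \<in> {..<length xs}. g k div 4 mod L = c} = {} \<or> {k \<in> {..<length xs}. g k div 4 mod L = c} = {..<length xs}"
      by (elim disjE) auto
    then show ?thesis unfolding loss_def by (metis (lifting) sum.empty)
  qed
  \<comment> \<open>With at most one position the loss is nothing or the whole profit. Twice the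
    loss being at most the whole profit, it is zero in either case.\<close>
  have "2 * loss c \<le> L * loss c" using L2 by (rule mult_right_mono) simp
  then have "loss c = 0" using l c(2) by linarith
  then show "chain_profit I S \<le> prof co" using key[OF c(1)] by simp
qed

end

section \<open>Programs over bounded values\<close>

fun asz :: "aexp \<Rightarrow> nat" where
  "asz (Const k) = 1"
| "asz (Var x) = 1"
| "asz (Arr x a) = asz a + 1"
| "asz (Plus a b) = asz a + asz b + 1"
| "asz (Minus a b) = asz a + asz b + 1"
| "asz (Times a b) = asz a + asz b + 1"
| "asz (Div a b) = asz a + asz b + 1"
| "asz (Mod a b) = asz a + asz b + 1"

fun aok :: "nat \<Rightarrow> aexp \<Rightarrow> bool" where
  "aok V (Const k) \<longleftrightarrow> k \<le> V"
| "aok V (Var x) \<longleftrightarrow> True"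
| "aok V (Arr x a) \<longleftrightarrow> aok V a"
| "aok V (Plus a b) \<longleftrightarrow> aok V a \<and> aok V b"
| "aok V (Minus a b) \<longleftrightarrow> aok V a \<and> aok V b"
| "aok V (Times a b) \<longleftrightarrow> aok V a \<and> aok V b"
| "aok V (Div a b) \<longleftrightarrow> aok V a \<and> aok V b"
| "aok V (Mod a b) \<longleftrightarrow> aok V a \<and> aok V b"

text \<open>The demand \<open>2 \<le> V\<close> lets a sum of two powers of \<open>V\<close> be
  absorbed by one further factor \<open>V\<close>.\<close>

definition bnd :: "nat \<Rightarrow> state \<Rightarrow> bool" where
  "bnd V s \<longleftrightarrow> 2 \<le> V \<and> (\<forall>x. var s x \<le> V) \<and> (\<forall>x k. arr s x k \<le> V)"

lemma asz_pos: "1 \<le> asz a" by (induction a) auto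

lemma pow_add_le: assumes "(2::nat) \<le> V" shows "V ^ i + V ^ j \<le> V ^ (i + j + 1)"
proof -
  have "V ^ i \<le> V ^ (i + j)" "V ^ j \<le> V ^ (i + j)" using assms by (auto intro!: power_increasing)
  then have "V ^ i + V ^ j \<le> 2 * V ^ (i + j)" by simp
  also have "\<dots> \<le> V * V ^ (i + j)" using assms by (intro mult_right_mono) auto
  finally show ?thesis by simp
qed

lemma aval_le: "bnd V s \<Longrightarrow> aok V a \<Longrightarrow> aval a s \<le> V ^ asz a"
proof (induction a)
  case (Arr x a)
  have "arr s x (aval a s) \<le> V ^ 1" using Arr.prems by (simp add: bnd_def)
  also have "\<dots> \<le> V ^ asz (Arr x a)" using Arr.prems by (intro power_increasing) (auto simp: bnd_def)
  finally show ?case by simp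
next
  case (Plus a b)
  then show ?case using pow_add_le[of V "asz a" "asz b"] by (simp add: bnd_def)
next
  case (Minus a b)
  have "aval a s \<le> V ^ asz a" using Minus by simp
  also have "\<dots> \<le> V ^ asz (Minus a b)" using Minus.prems by (intro power_increasing) (auto simp: bnd_def)
  finally show ?case by simp
next
  case (Times a b)
  have "aval a s * aval b s \<le> V ^ asz a * V ^ asz b" using Times by (intro mult_mono) auto
  also have "\<dots> = V ^ (asz a + asz b)" by (simp add: power_add)
  also have "\<dots> \<le> V ^ asz (Times a b)" using Times.prems by (intro power_increasing) (auto simp: bnd_def)
  finally show ?case by simp
next
  case (Div a b)
  have "aval a s div aval b s \<le> aval a s" by simp
  also have "\<dots> \<le> V ^ asz a" using Div by simp
  also have "\<dots> \<le> V ^ asz (Div a b)" using Div.prems by (intro power_increasing) (auto simp: bnd_def)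
  finally show ?case by simp
next
  case (Mod a b)
  have "aval a s mod aval b s \<le> aval a s" by simp
  also have "\<dots> \<le> V ^ asz a" using Mod by simp
  also have "\<dots> \<le> V ^ asz (Mod a b)" using Mod.prems by (intro power_increasing) (auto simp: bnd_def)
  finally show ?case by simp
qed (auto simp: bnd_def)

lemma bits_pos: "1 \<le> bits k" by (simp add: bits_def)

lemma less_pow_bits: "k < 2 ^ bits k"
  using floorlog_leD[of 2 k "bits k"] by (simp add: bits_def)

lemma bits_leI: "k < 2 ^ m \<Longrightarrow> 1 \<le> m \<Longrightarrow> bits k \<le> m"
  using floorlog_leI[of k 2 m] by (simp add: bits_def)

lemma bits_le_pow: assumes "k \<le> V ^ j" "1 \<le> j" shows "bits k \<le> j * bits V"
proof (rule bits_leI)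
  have "V ^ j < (2 ^ bits V) ^ j" using less_pow_bits[of V] assms(2) by (intro power_strict_mono) auto
  then show "k < 2 ^ (j * bits V)" using assms(1) by (simp add: power_mult[symmetric] mult.commute)
  show "1 \<le> j * bits V" using assms(2) bits_pos[of V] by (metis mult_le_mono mult_1)
qed

text \<open>A node of a tree of size \<open>m\<close> has a value of at most
  \<open>m * bits V\<close> digits, and the squared sizes of the subtrees leave room for this:
  \<open>i\<^sup>2 + j\<^sup>2 + (i + j + 1) \<le> (i + j + 1)\<^sup>2\<close>.\<close>

lemma acost_le: assumes "bnd V s" shows "aok V a \<Longrightarrow> acost a s \<le> (asz a)\<^sup>2 * bits V"
proof -
  have b: "bits (aval a s) \<le> asz a * bits V" if "aok V a" for a
    using bits_le_pow[OF aval_le[OF assms that] asz_pos] .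
  have un: "(i\<^sup>2 + (i + 1)) * bits V \<le> (i + 1)\<^sup>2 * bits V" for i :: nat
    by (intro mult_right_mono) (auto simp: power2_eq_square)
  have bi: "(i\<^sup>2 + j\<^sup>2 + (i + j + 1)) * bits V \<le> (i + j + 1)\<^sup>2 * bits V" for i j :: nat
    by (intro mult_right_mono) (auto simp: power2_eq_square algebra_simps)
  show "aok V a \<Longrightarrow> acost a s \<le> (asz a)\<^sup>2 * bits V"
  proof (induction a)
    case (Const k) then show ?case using b[of "Const k"] by simp
  next
    case (Var x) then show ?case using b[of "Var x"] by simp
  next
    case (Arr x a)
    then show ?case using b[of "Arr x a"] un[of "asz a"] by (simp add: add_mult_distrib)
  next
    case (Plus a1 a2)
    then show ?case using b[of "Plus a1 a2"] bi[of "asz a1" "asz a2"] by (simp add: add_mult_distrib)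
  next
    case (Minus a1 a2)
    then show ?case using b[of "Minus a1 a2"] bi[of "asz a1" "asz a2"] by (simp add: add_mult_distrib)
  next
    case (Times a1 a2)
    then show ?case using b[of "Times a1 a2"] bi[of "asz a1" "asz a2"] by (simp add: add_mult_distrib)
  next
    case (Div a1 a2)
    then show ?case using b[of "Div a1 a2"] bi[of "asz a1" "asz a2"] by (simp add: add_mult_distrib)
  next
    case (Mod a1 a2)
    then show ?case using b[of "Mod a1 a2"] bi[of "asz a1" "asz a2"] by (simp add: add_mult_distrib)
  qed
qed

fun bsz :: "bexp \<Rightarrow> nat" where
  "bsz (Less a b) = (asz a)\<^sup>2 + (asz b)\<^sup>2 + 1"
| "bsz (Eq a b) = (asz a)\<^sup>2 + (asz b)\<^sup>2 + 1"
| "bsz (Not b) = bsz b + 1"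
| "bsz (And a b) = bsz a + bsz b + 1"

fun bok :: "nat \<Rightarrow> bexp \<Rightarrow> bool" where
  "bok V (Less a b) \<longleftrightarrow> aok V a \<and> aok V b"
| "bok V (Eq a b) \<longleftrightarrow> aok V a \<and> aok V b"
| "bok V (Not b) \<longleftrightarrow> bok V b"
| "bok V (And a b) \<longleftrightarrow> bok V a \<and> bok V b"

lemma bcost_le: "bnd V s \<Longrightarrow> bok V b \<Longrightarrow> bcost b s \<le> bsz b * bits V"
proof (induction b)
  case (Less a b)
  then show ?case using acost_le[of V s a] acost_le[of V s b] bits_pos[of V] by (simp add: add_mult_distrib)
next
  case (Eq a b)
  then show ?case using acost_le[of V s a] acost_le[of V s b] bits_pos[of V] by (simp add: add_mult_distrib)
next
  case (Not b)
  then show ?case using bits_pos[of V] by simp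
next
  case (And a b)
  then show ?case using bits_pos[of V] by (simp add: add_mult_distrib)
qed

text \<open>\<open>run\<close> and \<open>safe\<close> are only meaningful for commands that execute no loop.\<close>

fun run :: "com \<Rightarrow> state \<Rightarrow> state" where
  "run Skip s = s"
| "run (Assign x a) s = s\<lparr>var := (var s)(x := aval a s)\<rparr>"
| "run (ArrAssign x a b) s = s\<lparr>arr := (arr s)(x := (arr s x)(aval a s := aval b s))\<rparr>"
| "run (Seq c d) s = run d (run c s)"
| "run (If b c d) s = (if bval b s then run c s else run d s)"
| "run (While b c) s = s"

fun safe :: "nat \<Rightarrow> com \<Rightarrow> state \<Rightarrow> bool" where
  "safe V Skip s \<longleftrightarrow> True"
| "safe V (Assign x a) s \<longleftrightarrow> aok V a \<and> aval a s \<le> V"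
| "safe V (ArrAssign x a b) s \<longleftrightarrow> aok V a \<and> aok V b \<and> aval b s \<le> V"
| "safe V (Seq c d) s \<longleftrightarrow> safe V c s \<and> safe V d (run c s)"
| "safe V (If b c d) s \<longleftrightarrow> bok V b \<and> (if bval b s then safe V c s else safe V d s)"
| "safe V (While b c) s \<longleftrightarrow> False"

fun csz :: "com \<Rightarrow> nat" where
  "csz Skip = 1"
| "csz (Assign x a) = (asz a)\<^sup>2 + 1"
| "csz (ArrAssign x a b) = (asz a)\<^sup>2 + (asz b)\<^sup>2 + 1"
| "csz (Seq c d) = csz c + csz d"
| "csz (If b c d) = bsz b + csz c + csz d + 1"
| "csz (While b c) = 0"

lemma exec_run:
  "bnd V s \<Longrightarrow> safe V c s \<Longrightarrow> \<exists>k. exec c s k (run c s) \<and> k \<le> csz c * bits V \<and> bnd V (run c s)"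
proof (induction c arbitrary: s)
  case Skip
  then show ?case using exec.Skip[of s] bits_pos[of V] by auto
next
  case (Assign x a)
  then show ?case using exec.Assign[of x a s] acost_le[of V s a] bits_pos[of V]
    by (intro exI[of _ "acost a s + 1"]) (auto simp: bnd_def)
next
  case (ArrAssign x a b)
  then show ?case using exec.ArrAssign[of x a b s] acost_le[of V s a] acost_le[of V s b] bits_pos[of V]
    by (intro exI[of _ "acost a s + acost b s + 1"]) (auto simp: bnd_def add_mult_distrib)
next
  case (Seq c d)
  obtain k where k: "exec c s k (run c s)" "k \<le> csz c * bits V" "bnd V (run c s)"
    using Seq.IH(1)[of s] Seq.prems by auto
  obtain l where l: "exec d (run c s) l (run d (run c s))" "l \<le> csz d * bits V" "bnd V (run d (run c s))"
    using Seq.IH(2)[of "run c s"] Seq.prems k by auto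
  show ?case using exec.Seq[OF k(1) l(1)] k l
    by (intro exI[of _ "k + l"]) (auto simp: add_mult_distrib)
next
  case (If b c d)
  have bc: "bcost b s + 1 \<le> bsz b * bits V + bits V" using bcost_le[of V s b] If.prems bits_pos[of V] by auto
  show ?case
  proof (cases "bval b s")
    case True
    then obtain k where k: "exec c s k (run c s)" "k \<le> csz c * bits V" "bnd V (run c s)"
      using If.IH(1)[of s] If.prems by auto
    show ?thesis using exec.IfTrue[OF True k(1)] k bc True
      by (intro exI[of _ "bcost b s + k + 1"]) (auto simp: add_mult_distrib)
  next
    case False
    then obtain k where k: "exec d s k (run d s)" "k \<le> csz d * bits V" "bnd V (run d s)"
      using If.IH(2)[of s] If.prems by auto
    show ?thesis using exec.IfFalse[OF False k(1)] k bc False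
      by (intro exI[of _ "bcost b s + k + 1"]) (auto simp: add_mult_distrib)
  qed
qed auto

text \<open>If all stored values are at most \<open>V\<close>, an expression of size \<open>m\<close> has nodes of value at most \<open>V ^ m\<close>
  and hence cost at most \<open>m\<^sup>2 * bits V\<close>. So time is measured in units of \<open>bits V\<close>.\<close>

definition triple :: "nat \<Rightarrow> (state \<Rightarrow> bool) \<Rightarrow> com \<Rightarrow> nat \<Rightarrow> (state \<Rightarrow> bool) \<Rightarrow> bool" where
  "triple V P c t Q \<longleftrightarrow>
     (\<forall>s. P s \<and> bnd V s \<longrightarrow> (\<exists>k s'. exec c s k s' \<and> k \<le> t * bits V \<and> bnd V s' \<and> Q s'))"

lemma triple_run:
  assumes "\<And>s. P s \<Longrightarrow> bnd V s \<Longrightarrow> safe V c s \<and> Q (run c s)"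
  shows "triple V P c (csz c) Q"
  using exec_run assms unfolding triple_def by blast

lemma triple_seq:
  assumes "triple V P c i Q" "triple V Q d j R"
  shows "triple V P (Seq c d) (i + j) R"
  unfolding triple_def
proof (intro allI impI)
  fix s assume "P s \<and> bnd V s"
  then obtain k s' where k: "exec c s k s'" "k \<le> i * bits V" "bnd V s'" "Q s'"
    using assms(1) unfolding triple_def by blast
  then obtain l s'' where l: "exec d s' l s''" "l \<le> j * bits V" "bnd V s''" "R s''"
    using assms(2) unfolding triple_def by blast
  show "\<exists>k s'. exec (Seq c d) s k s' \<and> k \<le> (i + j) * bits V \<and> bnd V s' \<and> R s'"
    using exec.Seq[OF k(1) l(1)] k l by (intro exI[of _ "k + l"] exI[of _ s'']) (auto simp: add_mult_distrib)
qed

definition loop_cost where "loop_cost N i b = N * (i + bsz b + 1) + (bsz b + 1)"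

text \<open>The number \<open>N\<close> of iterations need only be known to the proof, since
  \<open>test\<close> links the condition to the index of the invariant. This also covers the
  threshold loop, whose condition mentions no counter.\<close>

lemma triple_for:
  assumes body: "\<And>k. k < N \<Longrightarrow> triple V (P k) c i (P (Suc k))"
    and test: "\<And>k s. k \<le> N \<Longrightarrow> P k s \<Longrightarrow> bval b s \<longleftrightarrow> k < N" and bok: "bok V b"
  shows "triple V (P 0) (While b c) (loop_cost N i b) (P N)"
proof -
  have "\<exists>l s'. exec (While b c) s l s' \<and> l \<le> ((N - k) * (i + bsz b + 1) + (bsz b + 1)) * bits V \<and> bnd V s' \<and> P N s'"
    if "k \<le> N" "P k s" "bnd V s" for k s
    using that
  proof (induction k arbitrary: s rule: inc_induct)
    case base
    then have "\<not> bval b s" using test by auto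
    from exec.WhileFalse[OF this] show ?case
      using bcost_le[OF base(2) bok] bits_pos[of V] base by (intro exI[of _ "bcost b s + 1"] exI[of _ s]) auto
  next
    case (step k)
    then have t: "bval b s" using test[of k s] by auto
    obtain j s' where j: "exec c s j s'" "j \<le> i * bits V" "bnd V s'" "P (Suc k) s'"
      using body[OF step(2)] step.prems unfolding triple_def by blast
    obtain l s'' where l: "exec (While b c) s' l s''"
      "l \<le> ((N - Suc k) * (i + bsz b + 1) + (bsz b + 1)) * bits V" "bnd V s''" "P N s''"
      using step.IH[OF j(4,3)] by blast
    have Nk: "N - k = Suc (N - Suc k)" using step(2) by simp
    show ?case
      using exec.WhileTrue[OF t j(1) l(1)] l(2-4) j(2) bcost_le[OF step.prems(2) bok] bits_pos[of V] unfolding Nk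
      by (intro exI[of _ "bcost b s + j + l + 1"] exI[of _ s'']) (auto simp: add_mult_distrib)
  qed
  then show ?thesis unfolding triple_def loop_cost_def by (metis (no_types, lifting) diff_zero le0)
qed

section \<open>The algorithm as a program\<close>

text \<open>Scalars: \<open>sw\<close>, \<open>m\<close> total and minimum weight; \<open>h\<close> current threshold; \<open>O\<close> number of options per entry;
  \<open>b\<close>, \<open>c\<close> the best solution as in \<open>step\<close>; \<open>e\<close> the current entry; \<open>d\<close> a digit; \<open>z\<close>, \<open>g\<close> increments of code
  and profit. Arrays: \<open>H\<close> thresholds, \<open>P\<close> powers of \<open>B\<close>, \<open>v\<close> and \<open>a\<close> the table.\<close>

notation Seq (infixr ";;" 60)

definition scan_init where "scan_init =
  Assign ''sw'' (Const 0) ;; Assign ''m'' (Arr ''w'' (Const 1)) ;; Assign ''k'' (Const 0)"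

definition scan_body where "scan_body =
  Assign ''sw'' (Plus (Var ''sw'') (Arr ''w'' (Plus (Var ''k'') (Const 1)))) ;;
  If (Less (Arr ''w'' (Plus (Var ''k'') (Const 1))) (Var ''m''))
    (Assign ''m'' (Arr ''w'' (Plus (Var ''k'') (Const 1)))) Skip ;;
  Assign ''k'' (Plus (Var ''k'') (Const 1))"

definition thr_init where "thr_init =
  Assign ''B'' (Times (Times (Times (Times (Const 2) (Var ''K'')) (Var ''n'')) (Var ''n'')) (Plus (Var ''T'') (Const 1))) ;;
  Assign ''h'' (Var ''m'') ;; Assign ''X'' (Const 0)"

text \<open>The program computes no logarithm: it tabulates thresholds until one exceeds
  \<open>2 * sw\<close>, and \<open>X = K * J\<close> is the number of entries made.\<close>

definition thr_body where "thr_body =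
  ArrAssign ''H'' (Var ''X'') (Var ''h'') ;;
  Assign ''X'' (Plus (Var ''X'') (Const 1)) ;;
  If (Eq (Mod (Var ''X'') (Var ''K'')) (Const 0)) (Assign ''h'' (Times (Const 2) (Var ''h''))) Skip"

definition pow_init where "pow_init = ArrAssign ''P'' (Const 0) (Const 1) ;; Assign ''k'' (Const 0)"

definition pow_body where "pow_body =
  ArrAssign ''P'' (Plus (Var ''k'') (Const 1)) (Times (Arr ''P'' (Var ''k'')) (Var ''B'')) ;;
  Assign ''k'' (Plus (Var ''k'') (Const 1))"

definition root_init where "root_init =
  Assign ''M'' (Arr ''P'' (Var ''X'')) ;;
  Assign ''Y'' (Times (Plus (Var ''n'') (Const 1)) (Var ''M'')) ;;
  Assign ''O'' (Times (Var ''X'') (Plus (Var ''T'') (Const 1))) ;;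
  Assign ''N'' (Times (Times (Var ''M'') (Var ''Y'')) (Var ''O'')) ;;
  Assign ''y'' (Const 0)"

definition root_body where "root_body =
  ArrAssign ''v'' (Times (Var ''y'') (Var ''Y'')) (Const 1) ;;
  Assign ''y'' (Plus (Var ''y'') (Const 1))"

definition main_init where "main_init =
  Assign ''b'' (Const 0) ;; Assign ''c'' (Const 0) ;; Assign ''u'' (Const 0)"

definition test_init where "test_init =
  Assign ''e'' (Div (Var ''u'') (Var ''O'')) ;; Assign ''ok'' (Const 1) ;; Assign ''t'' (Const 1)"

definition sum_init where "sum_init = Assign ''s'' (Const 0) ;; Assign ''i'' (Const 0)"

definition sum_body where "sum_body =
  Assign ''d'' (Mod (Div (Arr ''a'' (Var ''e'')) (Arr ''P'' (Var ''i''))) (Var ''B'')) ;;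
  If (And (Less (Const 0) (Var ''d'')) (Not (Less (Var ''t'') (Var ''d''))))
    (Assign ''s'' (Plus (Var ''s'') (Arr ''w'' (Plus (Var ''i'') (Const 1))))) Skip ;;
  Assign ''i'' (Plus (Var ''i'') (Const 1))"

definition test_end where "test_end =
  If (Less (Arr ''W'' (Var ''t'')) (Var ''s'')) (Assign ''ok'' (Const 0)) Skip ;;
  Assign ''t'' (Plus (Var ''t'') (Const 1))"

definition test_body where "test_body =
  sum_init ;; While (Less (Var ''i'') (Var ''n'')) sum_body ;; test_end"

definition best_update where "best_update =
  If (And (Eq (Var ''ok'') (Const 1)) (Less (Var ''b'') (Arr ''v'' (Var ''e''))))
    (Assign ''b'' (Arr ''v'' (Var ''e'')) ;; Assign ''c'' (Arr ''a'' (Var ''e''))) Skip ;;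
  Assign ''t'' (Mod (Var ''u'') (Plus (Var ''T'') (Const 1))) ;;
  Assign ''x'' (Div (Mod (Var ''u'') (Var ''O'')) (Plus (Var ''T'') (Const 1))) ;;
  Assign ''i'' (Mod (Div (Var ''e'') (Var ''M'')) (Plus (Var ''n'') (Const 1))) ;;
  Assign ''d'' (Mod (Div (Div (Var ''e'') (Var ''Y'')) (Arr ''P'' (Var ''x''))) (Var ''B'')) ;;
  Assign ''z'' (Const 0) ;; Assign ''g'' (Const 0)"

definition selection where "selection = Mod (Var ''d'') (Plus (Var ''n'') (Const 1))"

text \<open>The disjunction in \<open>allowed\<close> is spelled with \<open>Not\<close> and
  \<open>And\<close>.\<close>

definition admissible where "admissible =
  And (Not (Less (Var ''t'') (Div (Var ''d'') (Plus (Var ''n'') (Const 1)))))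
   (Not (And (Not (Eq selection (Plus (Var ''i'') (Const 1))))
     (Not (And (Eq selection (Const 0)) (Less (Arr ''w'' (Plus (Var ''i'') (Const 1))) (Arr ''H'' (Var ''x'')))))))"

definition move where "move =
  If (Less (Const 0) (Var ''t''))
    (Assign ''g'' (Arr ''p'' (Plus (Times (Var ''i'') (Var ''T'')) (Var ''t''))) ;;
     If (Eq selection (Const 0))
       (Assign ''z'' (Times (Div (Times (Arr ''w'' (Plus (Var ''i'') (Const 1)))
          (Times (Times (Const 2) (Var ''K'')) (Var ''n''))) (Arr ''H'' (Var ''x''))) (Arr ''P'' (Var ''x'')))) Skip) Skip"

definition target where "target = Plus (Plus (Var ''e'') (Var ''M'')) (Var ''z'')"

definition push where "push =
  If (And (And (Less (Const 0) (Arr ''v'' (Var ''e''))) (Less (Var ''i'') (Var ''n'')))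
       (Not (And (Not (Eq (Var ''t'') (Const 0))) (Not admissible))))
    (move ;;
     If (Less (Arr ''v'' target) (Plus (Arr ''v'' (Var ''e'')) (Var ''g'')))
       (ArrAssign ''a'' target (Plus (Arr ''a'' (Var ''e'')) (Times (Var ''t'') (Arr ''P'' (Var ''i'')))) ;;
        ArrAssign ''v'' target (Plus (Arr ''v'' (Var ''e'')) (Var ''g''))) Skip) Skip ;;
  Assign ''u'' (Plus (Var ''u'') (Const 1))"

definition main_body where "main_body =
  test_init ;; While (Less (Var ''t'') (Plus (Var ''T'') (Const 1))) test_body ;; best_update ;; push"

definition out_init where "out_init = Assign ''k'' (Const 0)"

text \<open>The counter \<open>k\<close> is one less than the output index, so it stands for item
  \<open>k div T + 1\<close> and period \<open>k mod T + 1\<close>. That \<open>d\<close> is at most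
  this period reads \<open>d < k mod T + 2\<close>.\<close>

definition out_body where "out_body =
  Assign ''d'' (Mod (Div (Var ''c'') (Arr ''P'' (Div (Var ''k'') (Var ''T'')))) (Var ''B'')) ;;
  If (And (Less (Const 0) (Var ''d'')) (Less (Var ''d'') (Plus (Mod (Var ''k'') (Var ''T'')) (Const 2))))
    (ArrAssign ''S'' (Plus (Var ''k'') (Const 1)) (Const 1)) Skip ;;
  Assign ''k'' (Plus (Var ''k'') (Const 1))"

definition solve where "solve =
  scan_init ;; While (Less (Var ''k'') (Var ''n'')) scan_body ;;
  thr_init ;; While (Not (Less (Times (Const 2) (Var ''sw'')) (Var ''h''))) thr_body ;;
  pow_init ;; While (Less (Var ''k'') (Plus (Var ''X'') (Var ''n''))) pow_body ;;
  root_init ;; While (Less (Var ''y'') (Var ''M'')) root_body ;;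
  main_init ;; While (Less (Var ''u'') (Var ''N'')) main_body ;;
  out_init ;; While (Less (Var ''k'') (Times (Var ''n'') (Var ''T''))) out_body"

lemma bndD: "bnd V s \<Longrightarrow> var s x \<le> V" "bnd V s \<Longrightarrow> arr s x k \<le> V"
  by (auto simp: bnd_def)

section \<open>The program computes the table: invariants of its loops\<close>

context gik_dp
begin

text \<open>Bounds every value that the program stores.\<close>

definition Vb where
  "Vb = 4 * sw + B ^ (X + n) + M * Y * opts + 2 * K * n * M + n * p_max I + W_max I + B + X + n * T +
     n + T + K + M + Y + opts + p_max I + 16"

lemma Vb: "4 * sw \<le> Vb" "B ^ (X + n) \<le> Vb" "M * Y * opts \<le> Vb" "2 * K * n * M \<le> Vb"
  "1 + n * p_max I \<le> Vb" "W_max I \<le> Vb" "B \<le> Vb" "X + n \<le> Vb" "n * T \<le> Vb" "n + 1 \<le> Vb" "T + 1 \<le> Vb"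
  "K \<le> Vb" "M \<le> Vb" "Y \<le> Vb" "opts \<le> Vb" "p_max I \<le> Vb" "16 \<le> Vb"
  by (auto simp: Vb_def)

lemma w_Vb: "i < n \<Longrightarrow> w (Suc i) \<le> Vb"
proof -
  assume "i < n"
  then have "w (Suc i) \<le> sw" unfolding sw_def by (intro member_le_sum) auto
  then show ?thesis using Vb(1) by linarith
qed

definition base where
  "base s \<longleftrightarrow> var s ''n'' = n \<and> var s ''T'' = T \<and> var s ''K'' = K \<and>
     (\<forall>i<n. arr s ''w'' (Suc i) = w (Suc i)) \<and> (\<forall>t. 1 \<le> t \<and> t \<le> T \<longrightarrow> arr s ''W'' t = W t) \<and>
     (\<forall>i t. i < n \<and> 1 \<le> t \<and> t \<le> T \<longrightarrow> arr s ''p'' (i * T + t) = p (Suc i) t) \<and>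
     arr s ''S'' = (\<lambda>_. 0)"

definition fresh where
  "fresh s \<longleftrightarrow> base s \<and> arr s ''v'' = (\<lambda>_. 0) \<and> arr s ''a'' = (\<lambda>_. 0)"

text \<open>The range is \<open>{1..max 1 k}\<close> because \<open>m\<close> holds the first weight
  before any item has been scanned.\<close>

definition scan_inv where
  "scan_inv k s \<longleftrightarrow> fresh s \<and> var s ''k'' = k \<and> var s ''sw'' = (\<Sum>i<k. w (Suc i)) \<and>
     var s ''m'' = Min (w ` {1..max 1 k})"

lemma triple_scan_init: "triple Vb fresh scan_init (csz scan_init) (scan_inv 0)"
proof (rule triple_run)
  fix s assume "fresh s" "bnd Vb s"
  moreover have "0 < n" using n1 by simp
  ultimately show "safe Vb scan_init s \<and> scan_inv 0 (run scan_init s)"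
    using w_Vb[of 0] Vb(17) by (auto simp: scan_init_def scan_inv_def fresh_def base_def)
qed

lemma triple_scan_body:
  assumes "k < n"
  shows "triple Vb (scan_inv k) scan_body (csz scan_body) (scan_inv (Suc k))"
proof (rule triple_run)
  fix s assume s: "scan_inv k s" and b: "bnd Vb s"
  have "(\<Sum>i<Suc k. w (Suc i)) \<le> (\<Sum>i<n. w (Suc i))" using assms by (intro sum_mono2) auto
  also have "\<dots> \<le> Vb" unfolding sw_def[symmetric] using Vb(1) by linarith
  finally have 1: "(\<Sum>i<k. w (Suc i)) + w (Suc k) \<le> Vb" by simp
  have 2: "Suc k \<le> Vb" using assms Vb(10) by linarith
  have 3: "Min (w ` {1..max 1 (Suc k)}) = (if w (Suc k) < Min (w ` {1..max 1 k}) then w (Suc k) else Min (w ` {1..max 1 k}))"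
  proof (cases "k = 0")
    case False
    then have "{1..max 1 (Suc k)} = insert (Suc k) {1..max 1 k}" by auto
    then have "w ` {1..max 1 (Suc k)} = insert (w (Suc k)) (w ` {1..max 1 k})" by simp
    then have "Min (w ` {1..max 1 (Suc k)}) = min (w (Suc k)) (Min (w ` {1..max 1 k}))"
      by (simp only:) (rule Min_insert, auto)
    moreover have "min a b = (if a < b then a else b)" for a b :: nat by (simp add: min_def)
    ultimately show ?thesis by (simp only:)
  qed auto
  show "safe Vb scan_body s \<and> scan_inv (Suc k) (run scan_body s)"
    using s b assms 1 2 Vb(17) w_Vb[of k] unfolding scan_inv_def 3
    by (auto simp: scan_body_def fresh_def base_def)
qed

definition thr_inv where
  "thr_inv k s \<longleftrightarrow> fresh s \<and> var s ''sw'' = sw \<and> var s ''B'' = B \<and> var s ''X'' = k \<and>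
     var s ''h'' = wm * 2 ^ (k div K) \<and> (\<forall>x<k. arr s ''H'' x = \<theta> x)"

lemma triple_thr_init: "triple Vb (scan_inv n) thr_init (csz thr_init) (thr_inv 0)"
proof (rule triple_run)
  fix s assume s: "scan_inv n s" and b: "bnd Vb s"
  have "max 1 n = n" using n1 by simp
  then have "Min (w ` {1..max 1 n}) = wm" unfolding wm_def w_min_def by simp
  then show "safe Vb thr_init s \<and> thr_inv 0 (run thr_init s)"
    using s b Vb(7,17) le_trans[OF wm_sw, of Vb] Vb(1) unfolding scan_inv_def thr_inv_def sw_def[symmetric] B_def
    by (auto simp: thr_init_def fresh_def base_def bndD)
qed

text \<open>By minimality of \<open>J\<close>, the threshold on which the loop stops is at most
  twice a number not exceeding \<open>2 * sw\<close>.\<close>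

lemma div_J: "k \<le> K * J \<Longrightarrow> wm * 2 ^ (k div K) \<le> 4 * sw"
proof -
  assume "k \<le> K * J"
  then have "k div K \<le> K * J div K" by (rule div_le_mono)
  then have kJ: "k div K \<le> J" using K16 by simp
  obtain j where j: "J = Suc j" using J_pos by (cases J) auto
  have "wm * 2 ^ (k div K) \<le> wm * 2 ^ J" using kJ by (intro mult_left_mono power_increasing) auto
  also have "\<dots> = 2 * (wm * 2 ^ j)" by (simp add: j)
  also have "\<dots> \<le> 4 * sw" using J_least[of j] j by simp
  finally show ?thesis .
qed

lemma triple_thr_body:
  assumes "k < K * J"
  shows "triple Vb (thr_inv k) thr_body (csz thr_body) (thr_inv (Suc k))"
proof (rule triple_run)
  fix s assume s: "thr_inv k s" and b: "bnd Vb s"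
  have X: "K * J + n \<le> Vb" using Vb(8) unfolding X_def .
  have 1: "wm * 2 ^ (Suc k div K) \<le> Vb" using div_J[of "Suc k"] assms Vb(1) by linarith
  have h: "wm * 2 ^ (k div K) \<le> Vb" using div_J[of k] assms Vb(1) by linarith
  have 2: "Suc k \<le> Vb" using X assms by linarith
  show "safe Vb thr_body s \<and> thr_inv (Suc k) (run thr_body s)"
  proof (cases "Suc k mod K = 0")
    case True
    then have d: "Suc k div K = Suc (k div K)" by (simp add: div_Suc)
    then have "2 * (wm * 2 ^ (k div K)) \<le> Vb" using 1 by (simp add: mult.left_commute)
    then show ?thesis using s 2 h Vb(17) True d unfolding thr_inv_def
      by (simp add: thr_body_def fresh_def base_def \<theta>_def less_Suc_eq)
  next
    case False
    then have d: "Suc k div K = k div K" by (simp add: div_Suc)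
    then show ?thesis using s 2 h Vb(17) False unfolding thr_inv_def
      by (simp add: thr_body_def fresh_def base_def \<theta>_def less_Suc_eq)
  qed
qed

lemma thr_test: "k \<le> K * J \<Longrightarrow> thr_inv k s \<Longrightarrow>
  bval (Not (Less (Times (Const 2) (Var ''sw'')) (Var ''h''))) s \<longleftrightarrow> k < K * J"
proof -
  assume k: "k \<le> K * J" and s: "thr_inv k s"
  have "wm * 2 ^ (k div K) \<le> 2 * sw \<longleftrightarrow> k < K * J"
  proof (cases "k < K * J")
    case True
    then have "k div K < J" by (simp add: less_mult_imp_div_less mult.commute)
    then show ?thesis using J_least True by auto
  next
    case False
    then have "k div K = J" using k K16 by auto
    then show ?thesis using J_gt False by auto
  qed
  then show ?thesis using s by (auto simp: thr_inv_def)
qed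

definition pow_inv where
  "pow_inv k s \<longleftrightarrow> fresh s \<and> var s ''B'' = B \<and> var s ''X'' = X \<and> (\<forall>x<X. arr s ''H'' x = \<theta> x) \<and>
     var s ''k'' = k \<and> (\<forall>j\<le>k. arr s ''P'' j = B ^ j)"

lemma triple_pow_init: "triple Vb (thr_inv (K * J)) pow_init (csz pow_init) (pow_inv 0)"
  by (rule triple_run) (use Vb(17) in \<open>auto simp: pow_init_def thr_inv_def pow_inv_def X_def fresh_def base_def\<close>)

lemma triple_pow_body:
  assumes "k < X + n"
  shows "triple Vb (pow_inv k) pow_body (csz pow_body) (pow_inv (Suc k))"
proof (rule triple_run)
  fix s assume s: "pow_inv k s" and b: "bnd Vb s"
  have "B ^ Suc k \<le> B ^ (X + n)" using assms B_bounds(3) by (intro power_increasing) auto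
  then have 1: "B ^ k * B \<le> Vb" using Vb(2) by (simp add: mult.commute)
  have 2: "Suc k \<le> Vb" using assms Vb(8) by linarith
  show "safe Vb pow_body s \<and> pow_inv (Suc k) (run pow_body s)"
    using s b 1 2 Vb(17) unfolding pow_inv_def
    by (auto simp: pow_body_def fresh_def base_def le_Suc_eq)
qed

definition stat where
  "stat s \<longleftrightarrow> base s \<and> var s ''B'' = B \<and> var s ''X'' = X \<and> var s ''M'' = M \<and> var s ''Y'' = Y \<and>
     var s ''O'' = opts \<and> var s ''N'' = M * Y * opts \<and>
     (\<forall>x<X. arr s ''H'' x = \<theta> x) \<and> (\<forall>j\<le>X + n. arr s ''P'' j = B ^ j)"

definition root_inv where
  "root_inv y s \<longleftrightarrow> stat s \<and> arr s ''a'' = (\<lambda>_. 0) \<and> var s ''y'' = y \<and>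
     arr s ''v'' = (\<lambda>k. if k mod Y = 0 \<and> k div Y < y then 1 else 0)"

lemma triple_root_init: "triple Vb (pow_inv (X + n)) root_init (csz root_init) (root_inv 0)"
proof (rule triple_run)
  fix s assume s: "pow_inv (X + n) s" and b: "bnd Vb s"
  have eq: "M + n * M = Y" "X + X * T = opts" by (simp_all add: Y_def opts_def algebra_simps)
  show "safe Vb root_init s \<and> root_inv 0 (run root_init s)"
    using s b Vb(3,13,14,15,17) eq unfolding pow_inv_def root_inv_def stat_def
    by (auto simp: root_init_def fresh_def base_def M_def[symmetric])
qed

lemma triple_root_body:
  assumes "y < M"
  shows "triple Vb (root_inv y) root_body (csz root_body) (root_inv (Suc y))"
proof (rule triple_run)
  fix s assume s: "root_inv y s" and b: "bnd Vb s"
  have 1: "Suc y \<le> Vb" using assms Vb(13) by linarith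
  have 2: "(\<lambda>k. if k mod Y = 0 \<and> k div Y < y then 1 else 0)(y * Y := 1) =
    (\<lambda>k. if k mod Y = 0 \<and> k div Y < Suc y then 1 else (0::nat))"
    using Y_pos by (auto simp: fun_eq_iff less_Suc_eq)
  show "safe Vb root_body s \<and> root_inv (Suc y) (run root_body s)"
    using s b Vb(17) 1 2 unfolding root_inv_def stat_def
    by (auto simp: root_body_def base_def)
qed

text \<open>Arrays and incumbent are literally those of \<open>st u\<close>, so everything about
  profit and feasibility is inherited from \<open>good\<close>.\<close>

definition main_inv where
  "main_inv u s \<longleftrightarrow> stat s \<and> var s ''u'' = u \<and> st u = (arr s ''v'', arr s ''a'', var s ''b'', var s ''c'')"

lemma triple_main_init: "triple Vb (root_inv M) main_init (csz main_init) (main_inv 0)"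
  by (rule triple_run) (use Vb(17) in \<open>auto simp: main_init_def root_inv_def main_inv_def stat_def base_def\<close>)

lemma stat_cong:
  assumes "stat s" "\<forall>x\<in>{''n'', ''T'', ''K'', ''B'', ''X'', ''M'', ''Y'', ''O'', ''N''}. var s' x = var s x"
    "\<forall>x\<in>{''w'', ''W'', ''p'', ''S'', ''H'', ''P''}. arr s' x = arr s x"
  shows "stat s'"
  using assms by (simp add: stat_def base_def)

lemma main_inv_cong:
  assumes "main_inv u s"
    "\<forall>x\<in>{''n'', ''T'', ''K'', ''B'', ''X'', ''M'', ''Y'', ''O'', ''N'', ''u'', ''b'', ''c''}. var s' x = var s x"
    "arr s' = arr s"
  shows "main_inv u s'"
  using assms by (simp add: main_inv_def stat_def base_def)

definition used_weight where
  "used_weight A t i = (\<Sum>j<i. if 0 < dig A j \<and> dig A j \<le> t then w (Suc j) else 0)"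

lemma feas_used_weight: "feas A \<longleftrightarrow> (\<forall>t. 1 \<le> t \<and> t \<le> T \<longrightarrow> used_weight A t n \<le> W t)"
  unfolding feas_def used_weight_def by auto

definition test_inv where
  "test_inv u k s \<longleftrightarrow> main_inv u s \<and> var s ''e'' = u div opts \<and> var s ''t'' = Suc k \<and>
     var s ''ok'' = (if \<forall>t. 1 \<le> t \<and> t \<le> k \<longrightarrow> used_weight (arr s ''a'' (u div opts)) t n \<le> W t then 1 else 0)"

definition sum_inv where
  "sum_inv u k i s \<longleftrightarrow> test_inv u k s \<and> var s ''i'' = i \<and>
     var s ''s'' = used_weight (arr s ''a'' (u div opts)) (Suc k) i"

lemma test_inv_cong:
  assumes "test_inv u k s"
    "\<forall>x\<in>{''n'', ''T'', ''K'', ''B'', ''X'', ''M'', ''Y'', ''O'', ''N'', ''u'', ''b'', ''c'', ''e'', ''t'', ''ok''}. var s' x = var s x"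
    "arr s' = arr s"
  shows "test_inv u k s'"
  using assms main_inv_cong[of u s s'] by (simp add: test_inv_def)

lemma triple_test_init:
  assumes "u < M * Y * opts"
  shows "triple Vb (main_inv u) test_init (csz test_init) (test_inv u 0)"
proof (rule triple_run)
  fix s assume s: "main_inv u s" and b: "bnd Vb s"
  have 1: "u div opts \<le> Vb" using assms Vb(3) div_le_dividend[of u opts] by linarith
  show "safe Vb test_init s \<and> test_inv u 0 (run test_init s)"
    using s b Vb(17) 1 unfolding main_inv_def test_inv_def stat_def
    by (auto simp: test_init_def base_def)
qed

lemma triple_sum_init: "triple Vb (test_inv u k) sum_init (csz sum_init) (sum_inv u k 0)"
  by (rule triple_run) (use Vb(17) in
    \<open>auto simp: sum_init_def test_inv_def sum_inv_def main_inv_def stat_def base_def used_weight_def\<close>)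

lemma used_weight_le: "i \<le> n \<Longrightarrow> used_weight A t i \<le> sw"
proof -
  assume i: "i \<le> n"
  have "used_weight A t i \<le> (\<Sum>j<i. w (Suc j))" unfolding used_weight_def by (intro sum_mono) auto
  also have "\<dots> \<le> sw" unfolding sw_def using i by (intro sum_mono2) auto
  finally show ?thesis .
qed

lemma triple_sum_body:
  assumes "i < n"
  shows "triple Vb (sum_inv u k i) sum_body (csz sum_body) (sum_inv u k (Suc i))"
proof (rule triple_run)
  fix s assume s: "sum_inv u k i s" and b: "bnd Vb s"
  define A where "A = arr s ''a'' (u div opts)"
  have 1: "used_weight A (Suc k) (Suc i) \<le> Vb" using used_weight_le[of "Suc i" A "Suc k"] assms Vb(1) by linarith
  have 2: "Suc i \<le> Vb" using assms Vb(10) by linarith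
  have "dig A i < B" unfolding dig_def using B_bounds(3) by simp
  then have 3: "dig A i \<le> Vb" using Vb(7) by linarith
  have 4: "arr s ''P'' i = B ^ i" using s assms unfolding sum_inv_def test_inv_def main_inv_def stat_def by auto
  have 5: "arr s ''w'' (Suc i) = w (Suc i)" using s assms
    unfolding sum_inv_def test_inv_def main_inv_def stat_def base_def by auto
  have vars: "var s ''e'' = u div opts" "var s ''t'' = Suc k" "var s ''i'' = i" "var s ''B'' = B"
      "var s ''s'' = used_weight A (Suc k) i"
    using s by (simp_all add: sum_inv_def test_inv_def main_inv_def stat_def A_def)
  have d: "A div B ^ i mod B = dig A i" by (simp add: dig_def)
  show "safe Vb sum_body s \<and> sum_inv u k (Suc i) (run sum_body s)"
  proof (cases "0 < dig A i \<and> dig A i \<le> Suc k")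
    case True
    have run: "run sum_body s = s\<lparr>var := (var s)(''d'' := dig A i, ''s'' := used_weight A (Suc k) (Suc i), ''i'' := Suc i)\<rparr>"
      using True by (simp add: sum_body_def vars 4 5 d used_weight_def flip: A_def)
    have "test_inv u k (run sum_body s)"
      unfolding run by (rule test_inv_cong[of u k s]) (use s in \<open>simp_all add: sum_inv_def\<close>)
    moreover have "safe Vb sum_body s"
      using True 1 2 3 Vb(17) by (simp add: sum_body_def vars 4 5 d used_weight_def flip: A_def)
    ultimately show ?thesis by (simp add: sum_inv_def run flip: A_def)
  next
    case False
    have run: "run sum_body s = s\<lparr>var := (var s)(''d'' := dig A i, ''i'' := Suc i)\<rparr>"
      using False by (auto simp: sum_body_def vars 4 5 d simp flip: A_def)
    have "test_inv u k (run sum_body s)"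
      unfolding run by (rule test_inv_cong[of u k s]) (use s in \<open>simp_all add: sum_inv_def\<close>)
    moreover have "safe Vb sum_body s"
      using False 1 2 3 Vb(17) by (auto simp: sum_body_def vars 4 5 d simp flip: A_def)
    moreover have "used_weight A (Suc k) (Suc i) = used_weight A (Suc k) i"
      using False by (auto simp: used_weight_def)
    ultimately show ?thesis using vars by (simp add: sum_inv_def run flip: A_def)
  qed
qed

lemma triple_test_end:
  assumes "k < T"
  shows "triple Vb (sum_inv u k n) test_end (csz test_end) (test_inv u (Suc k))"
proof (rule triple_run)
  fix s assume s: "sum_inv u k n s" and b: "bnd Vb s"
  have 1: "Suc (Suc k) \<le> Vb" using assms Vb(11) by linarith
  have 2: "arr s ''W'' (Suc k) = W (Suc k)" using s assms
    unfolding sum_inv_def test_inv_def main_inv_def stat_def base_def by auto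
  have 3: "(\<forall>t. 1 \<le> t \<and> t \<le> Suc k \<longrightarrow> Q t) \<longleftrightarrow> (\<forall>t. 1 \<le> t \<and> t \<le> k \<longrightarrow> Q t) \<and> Q (Suc k)" for Q
    by (auto simp: le_Suc_eq)
  show "safe Vb test_end s \<and> test_inv u (Suc k) (run test_end s)"
    using s b Vb(17) 1 2 unfolding sum_inv_def test_inv_def main_inv_def stat_def 3
    by (auto simp: test_end_def base_def)
qed

definition sum_cost where
  "sum_cost = csz sum_init + (loop_cost n (csz sum_body) (Less (Var ''i'') (Var ''n'')) + csz test_end)"

lemma triple_test_body:
  assumes "k < T"
  shows "triple Vb (test_inv u k) test_body sum_cost (test_inv u (Suc k))"
  unfolding test_body_def sum_cost_def
proof (rule triple_seq[OF triple_sum_init triple_seq[OF _ triple_test_end[OF assms]]])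
  show "triple Vb (sum_inv u k 0) (While (Less (Var ''i'') (Var ''n'')) sum_body)
     (loop_cost n (csz sum_body) (Less (Var ''i'') (Var ''n'')))
     (sum_inv u k n)"
    by (rule triple_for[where P = "sum_inv u k", OF triple_sum_body])
      (auto simp: sum_inv_def test_inv_def main_inv_def stat_def base_def)
qed

text \<open>Halfway through a step: the incumbent is already that of \<open>st (Suc u)\<close>, the
  table still that of \<open>st u\<close>.\<close>

definition ready where
  "ready u s \<longleftrightarrow> stat s \<and> var s ''u'' = u \<and> var s ''e'' = u div opts \<and> var s ''t'' = u mod (T + 1) \<and>
     var s ''x'' = u mod opts div (T + 1) \<and> var s ''i'' = u div opts div M mod (n + 1) \<and>
     var s ''d'' = dig (u div opts div Y) (u mod opts div (T + 1)) \<and> var s ''z'' = 0 \<and> var s ''g'' = 0 \<and>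
     (\<exists>b c. st u = (arr s ''v'', arr s ''a'', b, c) \<and>
        (var s ''b'', var s ''c'') = (if feas (arr s ''a'' (u div opts)) \<and> b < arr s ''v'' (u div opts)
           then (arr s ''v'' (u div opts), arr s ''a'' (u div opts)) else (b, c)))"

lemma slot_index: "u mod opts div (T + 1) < X"
proof (rule less_mult_imp_div_less)
  have "u mod opts < opts" using opts_pos by simp
  then show "u mod opts < X * (T + 1)" by (simp only: opts_def)
qed

lemma triple_best_update:
  assumes "u < M * Y * opts"
  shows "triple Vb (test_inv u T) best_update (csz best_update) (ready u)"
proof (rule triple_run)
  fix s assume s: "test_inv u T s" and b: "bnd Vb s"
  define e x where "e = u div opts" and "x = u mod opts div (T + 1)"
  have t: "u mod (T + 1) \<le> Vb" using Vb(11) mod_less_divisor[of "T + 1" u] by linarith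
  have x: "x < X" unfolding x_def by (rule slot_index)
  then have x': "x \<le> Vb" using Vb(8) by linarith
  have i: "e div M mod (n + 1) \<le> Vb" using Vb(10) mod_less_divisor[of "n + 1" "e div M"] by linarith
  have "dig (e div Y) x < B" unfolding dig_def using B_bounds(3) by simp
  then have d: "dig (e div Y) x \<le> Vb" using Vb(7) by linarith
  have P: "arr s ''P'' x = B ^ x" using s x unfolding test_inv_def main_inv_def stat_def by auto
  have f: "(\<forall>t. 1 \<le> t \<and> t \<le> T \<longrightarrow> used_weight A t n \<le> W t) \<longleftrightarrow> feas A" for A
    by (simp add: feas_used_weight)
  define v a where "v = arr s ''v''" and "a = arr s ''a''"
  have vars: "var s ''e'' = e" "var s ''u'' = u" "var s ''O'' = opts" "var s ''M'' = M" "var s ''Y'' = Y"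
     "var s ''B'' = B" "var s ''n'' = n" "var s ''T'' = T" "st u = (v, a, var s ''b'', var s ''c'')" and st: "stat s"
    and ok: "var s ''ok'' = (if feas (a e) then 1 else 0)"
    using s unfolding test_inv_def main_inv_def stat_def base_def f v_def a_def e_def by auto
  have dd: "e div Y div B ^ x mod B = dig (e div Y) x" by (simp add: dig_def)
  have xS: "u mod opts div Suc T = x" by (simp add: x_def)
  define b' c' where "b' = (if feas (a e) \<and> var s ''b'' < v e then v e else var s ''b'')"
    and "c' = (if feas (a e) \<and> var s ''b'' < v e then a e else var s ''c'')"
  have run: "run best_update s = s\<lparr>var := (var s)(''b'' := b', ''c'' := c', ''t'' := u mod (T + 1), ''x'' := x,
      ''i'' := e div M mod (n + 1), ''d'' := dig (e div Y) x, ''z'' := 0, ''g'' := 0)\<rparr>"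
    using P ok unfolding best_update_def b'_def c'_def
    by (cases "feas (a e) \<and> var s ''b'' < v e")
      (simp_all add: vars dd xS flip: v_def a_def)
  have safe: "safe Vb best_update s"
    using P Vb(17) t x' i d bndD(2)[OF b, of "''v''" e] bndD(2)[OF b, of "''a''" e] unfolding best_update_def
    by (auto simp: vars dd xS)
  have "stat (run best_update s)" unfolding run using st by (rule stat_cong) simp_all
  moreover have "arr (run best_update s) = arr s" unfolding run by simp
  ultimately have "ready u (run best_update s)"
    unfolding ready_def unfolding run using vars
    by (auto simp: b'_def c'_def e_def x_def simp flip: v_def a_def)
  then show "safe Vb best_update s \<and> ready u (run best_update s)"
    using safe by simp
qed

lemma prof_bound: "valid y sl pe i \<Longrightarrow> i \<le> n \<Longrightarrow> gain pe i \<le> n * p_max I"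
proof -
  assume v: "valid y sl pe i" and i: "i \<le> n"
  have "gain pe i \<le> (\<Sum>k<i. p_max I)"
    unfolding gain_def
  proof (intro sum_mono)
    fix k assume k: "k \<in> {..<i}"
    have "p (Suc k) (pe k) \<le> p_max I" if "pe k \<noteq> 0"
    proof -
      have "(Suc k, pe k) \<in> {1..n} \<times> {1..T}" using v k i that unfolding valid_def by auto
      then show ?thesis unfolding p_max_def by (intro Max_ge) force+
    qed
    then show "(if pe k = 0 then 0 else p (Suc k) (pe k)) \<le> p_max I" by auto
  qed
  also have "\<dots> \<le> n * p_max I" using i by simp
  finally show ?thesis .
qed

text \<open>Soundness also controls the size of the stored numbers: an entry encodes at most
  \<open>n\<close> periods in radix \<open>B\<close> and the gain of at most \<open>n\<close>
  items.\<close>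

lemma sound_bounds: assumes "sound e v A" shows "v \<le> Vb" "A \<le> Vb"
proof -
  have "v \<le> 1 + n * p_max I \<and> A \<le> B ^ n"
  proof (cases "v = 0 \<and> A = 0")
    case False
    then obtain y sl pe i where *: "i \<le> n" "valid y sl pe i" "v = 1 + gain pe i" "A = acode pe i"
      using assms unfolding sound_def by auto
    have "pe k \<le> T" if "k < i" for k using * that unfolding valid_def by fastforce
    then show ?thesis using * prof_bound[OF *(2,1)] acode_less[of i pe] by auto
  qed auto
  moreover have "B ^ n \<le> B ^ (X + n)" using B_bounds(3) by (intro power_increasing) auto
  ultimately show "v \<le> Vb" "A \<le> Vb" using Vb(2,5) by linarith+
qed

lemma triple_push:
  assumes "u < M * Y * opts"
  shows "triple Vb (ready u) push (csz push) (main_inv (Suc u))"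
proof (rule triple_run)
  fix s assume s: "ready u s" and b: "bnd Vb s"
  define e x t where "e = u div opts" and "x = u mod opts div (T + 1)" and "t = u mod (T + 1)"
  define i y where "i = e div M mod (n + 1)" and "y = e div Y"
  define v a where "v = arr s ''v''" and "a = arr s ''a''"
  define ok where "ok = (t = 0 \<or> allowed y (Suc i) x t)"
  define z g where "z = (if t = 0 then 0 else rnd y (Suc i) x * B ^ x)" and "g = (if t = 0 then 0 else p (Suc i) t)"
  obtain b0 c0 where st0: "st u = (v, a, b0, c0)"
    and bc: "(var s ''b'', var s ''c'') = (if feas (a e) \<and> b0 < v e then (v e, a e) else (b0, c0))"
    using s unfolding ready_def v_def a_def e_def by auto
  have x: "x < X" unfolding x_def by (rule slot_index)
  have t: "t \<le> T" unfolding t_def using mod_less_divisor[of "T + 1" u] by linarith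
  have u: "Suc u \<le> Vb" using assms Vb(3) by linarith
  have vars: "var s ''e'' = e" "var s ''t'' = t" "var s ''x'' = x" "var s ''i'' = i" "var s ''d'' = dig y x"
    "var s ''z'' = 0" "var s ''g'' = 0" "var s ''u'' = u" "var s ''M'' = M" "var s ''n'' = n" "var s ''T'' = T"
    "var s ''K'' = K"
    using s unfolding ready_def stat_def base_def e_def t_def x_def i_def y_def by auto
  have arrs: "arr s ''P'' x = B ^ x" "i < n \<Longrightarrow> arr s ''P'' i = B ^ i" "arr s ''H'' x = \<theta> x"
     "i < n \<Longrightarrow> arr s ''w'' (Suc i) = w (Suc i)" "i < n \<Longrightarrow> 0 < t \<Longrightarrow> arr s ''p'' (i * T + t) = p (Suc i) t"
    using s x t unfolding ready_def stat_def base_def by auto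
  have adm: "i < n \<Longrightarrow> bval admissible s \<longleftrightarrow> allowed y (Suc i) x t"
    unfolding admissible_def selection_def allowed_def tau_def sel_def using vars arrs by auto
  have admok: "bok Vb admissible" unfolding admissible_def selection_def using Vb(17) by simp
  define s' where "s' = run move s"
  have s': "safe Vb move s" "s' = s\<lparr>var := (var s)(''g'' := g, ''z'' := z)\<rparr>" if "i < n" "ok"
  proof -
    have zz: "rnd y (Suc i) x * B ^ x \<le> Vb" if "t \<noteq> 0"
    proof -
      have "rnd y (Suc i) x \<le> 2 * K * n" using rnd_le[of y "Suc i" x t] \<open>ok\<close> that unfolding ok_def by auto
      moreover have "B ^ x \<le> M" unfolding M_def using x B_bounds(3) by (intro power_increasing) auto
      ultimately have "rnd y (Suc i) x * B ^ x \<le> 2 * K * n * M" by (intro mult_mono) auto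
      then show ?thesis using Vb(4) by linarith
    qed
    have gg: "p (Suc i) t \<le> Vb" if "t \<noteq> 0" using arrs(5)[symmetric] that \<open>i < n\<close> bndD(2)[OF b] by simp
    show "safe Vb move s"
      using zz gg vars arrs \<open>i < n\<close> Vb(17) unfolding move_def selection_def rnd_def sel_def by (auto simp: mult_ac)
    show "s' = s\<lparr>var := (var s)(''g'' := g, ''z'' := z)\<rparr>"
      using vars arrs \<open>i < n\<close> unfolding s'_def move_def selection_def z_def g_def rnd_def sel_def
      by (auto simp: mult_ac fun_eq_iff intro!: state.equality)
  qed
  have snd: "sound k (v k) (a k)" for k using good_st[of u] unfolding st0 good_def by auto
  have new: "v e + g \<le> Vb" "a e + t * B ^ i \<le> Vb" if "i < n" "ok" "0 < v e"
    using sound_bounds[OF sound_push[OF snd that(3) e_def x_def t_def i_def y_def that(1)]] that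
    unfolding ok_def g_def by auto
  define go where "go = (0 < v e \<and> i < n \<and> ok)"
  define pu where "pu = (go \<and> v (e + M + z) < v e + g)"
  have bgo: "bval (And (And (Less (Const 0) (Arr ''v'' (Var ''e''))) (Less (Var ''i'') (Var ''n'')))
       (Not (And (Not (Eq (Var ''t'') (Const 0))) (Not admissible)))) s \<longleftrightarrow> go"
    using adm vars unfolding go_def ok_def v_def by auto
  have step: "st (Suc u) = (if pu then v(e + M + z := v e + g) else v,
     if pu then a(e + M + z := a e + t * B ^ i) else a, var s ''b'', var s ''c'')"
    unfolding st.simps st0 step_def Let_def prod.case using bc
    unfolding pu_def go_def ok_def z_def g_def e_def x_def t_def i_def y_def by auto
  show "safe Vb push s \<and> main_inv (Suc u) (run push s)"
  proof (cases go)
    case False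
    then have "\<not> pu" by (simp add: pu_def)
    then show ?thesis unfolding push_def run.simps safe.simps bgo
      using False step s u vars admok Vb(17)
      by (auto simp: main_inv_def ready_def stat_def base_def v_def a_def)
  next
    case True
    then have i: "i < n" and ok: ok and ve: "0 < v e" by (auto simp: go_def)
    note sv = s'[OF i ok, unfolded s'_def] and nw = new[OF i ok ve] and Pi = arrs(2)[OF i]
    have st: "stat s" using s by (simp add: ready_def)
    define f where "f = (var s)(''g'' := g, ''z'' := z, ''u'' := Suc u)"
    show ?thesis
    proof (cases pu)
      case True
      then have lt: "v (e + M + z) < v e + g" by (simp add: pu_def)
      have run: "run push s = s\<lparr>var := f, arr := (arr s)(''a'' := a(e + M + z := a e + t * B ^ i),
          ''v'' := v(e + M + z := v e + g))\<rparr>"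
        unfolding push_def run.simps bgo using \<open>go\<close> lt
        by (simp add: sv target_def vars Pi f_def flip: v_def a_def)
      have "safe Vb push s"
        unfolding push_def safe.simps bgo using \<open>go\<close> lt nw u admok Vb(17)
        by (simp add: sv target_def vars Pi flip: v_def a_def)
      moreover have "stat (run push s)" unfolding run using st by (rule stat_cong) (simp_all add: f_def)
      ultimately show ?thesis unfolding main_inv_def step using True by (simp add: run f_def)
    next
      case False
      then have lt: "\<not> v (e + M + z) < v e + g" using \<open>go\<close> by (simp add: pu_def)
      have run: "run push s = s\<lparr>var := f\<rparr>"
        unfolding push_def run.simps bgo using \<open>go\<close> lt
        by (simp add: sv target_def vars Pi f_def flip: v_def a_def)
      have "safe Vb push s"
        unfolding push_def safe.simps bgo using \<open>go\<close> lt nw u admok Vb(17)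
        by (simp add: sv target_def vars Pi flip: v_def a_def)
      moreover have "stat (run push s)" unfolding run using st by (rule stat_cong) (simp_all add: f_def)
      ultimately show ?thesis unfolding main_inv_def step using False by (simp add: run f_def flip: v_def a_def)
    qed
  qed
qed

definition test_cost where
  "test_cost = csz test_init + (loop_cost T sum_cost (Less (Var ''t'') (Plus (Var ''T'') (Const 1))) + (csz best_update + csz push))"

lemma triple_main_body:
  assumes "u < M * Y * opts"
  shows "triple Vb (main_inv u) main_body test_cost (main_inv (Suc u))"
  unfolding main_body_def test_cost_def
proof (rule triple_seq[OF triple_test_init[OF assms] triple_seq[OF _ triple_seq[OF triple_best_update[OF assms] triple_push[OF assms]]]])
  show "triple Vb (test_inv u 0) (While (Less (Var ''t'') (Plus (Var ''T'') (Const 1))) test_body)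
     (loop_cost T sum_cost (Less (Var ''t'') (Plus (Var ''T'') (Const 1))))
     (test_inv u T)"
    by (rule triple_for[where P = "test_inv u", OF triple_test_body])
      (use Vb(17) in \<open>auto simp: test_inv_def main_inv_def stat_def base_def\<close>)
qed

definition shown where "shown A j \<longleftrightarrow> 0 < dig A (j div T) \<and> dig A (j div T) < j mod T + 2"

definition out_inv where
  "out_inv A k s \<longleftrightarrow> var s ''n'' = n \<and> var s ''T'' = T \<and> var s ''B'' = B \<and> (\<forall>j\<le>X + n. arr s ''P'' j = B ^ j) \<and>
     var s ''c'' = A \<and> var s ''k'' = k \<and>
     (\<forall>j. arr s ''S'' j \<noteq> 0 \<longleftrightarrow> 1 \<le> j \<and> j \<le> k \<and> shown A (j - 1))"

lemma triple_out_init: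
  "triple Vb (main_inv (M * Y * opts)) out_init (csz out_init) (out_inv (snd (snd (snd (st (M * Y * opts))))) 0)"
  by (rule triple_run) (use Vb(17) in \<open>auto simp: out_init_def out_inv_def main_inv_def stat_def base_def\<close>)

lemma triple_out_body:
  assumes "k < n * T"
  shows "triple Vb (out_inv A k) out_body (csz out_body) (out_inv A (Suc k))"
proof (rule triple_run)
  fix s assume s: "out_inv A k s" and b: "bnd Vb s"
  have k: "k div T < n" using assms by (simp add: less_mult_imp_div_less)
  have 1: "Suc k \<le> Vb" using assms Vb(9) by linarith
  have "dig A (k div T) < B" unfolding dig_def using B_bounds(3) by simp
  then have 2: "dig A (k div T) \<le> Vb" using Vb(7) by linarith
  have 3: "arr s ''P'' (k div T) = B ^ (k div T)" using s k unfolding out_inv_def by auto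
  have 4: "A div B ^ (k div T) mod B = dig A (k div T)" by (simp add: dig_def)
  have vars: "var s ''n'' = n" "var s ''T'' = T" "var s ''B'' = B" "var s ''c'' = A" "var s ''k'' = k"
    using s by (simp_all add: out_inv_def)
  have S: "arr s ''S'' j \<noteq> 0 \<longleftrightarrow> 1 \<le> j \<and> j \<le> k \<and> shown A (j - 1)" for j using s by (simp add: out_inv_def)
  show "safe Vb out_body s \<and> out_inv A (Suc k) (run out_body s)"
  proof (cases "shown A k")
    case True
    then have c: "0 < dig A (k div T)" "dig A (k div T) < k mod T + 2" by (auto simp: shown_def)
    then show ?thesis using s Vb(17) 1 2 S True
      by (auto simp: out_body_def out_inv_def vars 3 4 le_Suc_eq)
  next
    case False
    then have c: "\<not> (0 < dig A (k div T) \<and> dig A (k div T) < k mod T + 2)" by (auto simp: shown_def)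
    then show ?thesis using s Vb(17) 1 2 S False
      by (auto simp: out_body_def out_inv_def vars 3 4 le_Suc_eq)
  qed
qed

definition total_cost where
  "total_cost = csz scan_init + (loop_cost n (csz scan_body) (Less (Var ''k'') (Var ''n'')) +
    (csz thr_init + (loop_cost (K * J) (csz thr_body) (Not (Less (Times (Const 2) (Var ''sw'')) (Var ''h''))) +
    (csz pow_init + (loop_cost (X + n) (csz pow_body) (Less (Var ''k'') (Plus (Var ''X'') (Var ''n''))) +
    (csz root_init + (loop_cost M (csz root_body) (Less (Var ''y'') (Var ''M'')) +
    (csz main_init + (loop_cost (M * Y * opts) test_cost (Less (Var ''u'') (Var ''N'')) +
    (csz out_init + loop_cost (n * T) (csz out_body) (Less (Var ''k'') (Times (Var ''n'') (Var ''T'')))))))))))))"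

lemma triple_solve:
  "triple Vb fresh solve total_cost (out_inv (snd (snd (snd (st (M * Y * opts))))) (n * T))"
  unfolding solve_def total_cost_def
  apply (rule triple_seq[OF triple_scan_init] triple_seq)+
   apply (rule triple_for[where P = scan_inv, OF triple_scan_body]; auto simp: scan_inv_def fresh_def base_def)
  apply (rule triple_seq[OF triple_thr_init] triple_seq)+
   apply (rule triple_for[where P = thr_inv, OF triple_thr_body _ ]; (rule thr_test | use Vb(17) in simp); assumption?)
  apply (rule triple_seq[OF triple_pow_init] triple_seq)+
   apply (rule triple_for[where P = pow_inv, OF triple_pow_body]; auto simp: pow_inv_def fresh_def base_def)
  apply (rule triple_seq[OF triple_root_init] triple_seq)+
   apply (rule triple_for[where P = root_inv, OF triple_root_body]; auto simp: root_inv_def stat_def)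
  apply (rule triple_seq[OF triple_main_init] triple_seq)+
   apply (rule triple_for[where P = main_inv, OF triple_main_body]; auto simp: main_inv_def stat_def)
  apply (rule triple_seq[OF triple_out_init])
  apply (rule triple_for[where P = "out_inv (snd (snd (snd (st (M * Y * opts)))))", OF triple_out_body]; auto simp: out_inv_def)
  done

end

text \<open>For a single item the exponent in the time bound vanishes, so that the accuracy must not depend on
  \<open>\<epsilon>\<close>; giving up less than all of the profit then means giving up nothing, and \<open>L = 2\<close> is exact.\<close>

definition select where "select k =
  If (Eq (Var ''n'') (Const 1)) (Assign ''K'' (Const 16)) (Assign ''K'' (Const k))"

section \<open>Running time\<close>

definition cost_const :: nat where
  "cost_const = 3 * (csz (select 0) +
     csz scan_init + csz scan_body + bsz (Less (Var ''k'') (Var ''n'')) + 1 +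
     csz thr_init + csz thr_body + bsz (Not (Less (Times (Const 2) (Var ''sw'')) (Var ''h''))) + 1 +
     csz pow_init + csz pow_body + bsz (Less (Var ''k'') (Plus (Var ''X'') (Var ''n''))) + 1 +
     csz root_init + csz root_body + bsz (Less (Var ''y'') (Var ''M'')) + 1 +
     csz main_init + bsz (Less (Var ''u'') (Var ''N'')) + 1 +
     csz test_init + csz sum_init + csz sum_body + bsz (Less (Var ''i'') (Var ''n'')) + 1 + csz test_end +
     bsz (Less (Var ''t'') (Plus (Var ''T'') (Const 1))) + 1 + csz best_update + csz push +
     csz out_init + csz out_body + bsz (Less (Var ''k'') (Times (Var ''n'') (Var ''T''))) + 1)"

text \<open>A constant counts as one node whatever its value, so \<open>cost_const\<close> does not
  depend on \<epsilon>.\<close>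

lemma csz_select: "csz (select k) = csz (select 0)" by (simp add: select_def)

lemma loop_cost_le: "loop_cost N i b \<le> (i + bsz b + 1) * (N + 1)"
  unfolding loop_cost_def by (simp add: algebra_simps)

lemma le_mult_pos: "a \<le> b \<Longrightarrow> 0 < c \<Longrightarrow> a \<le> b * (c::nat)"
  by (metis le_trans mult.right_neutral mult_le_mono2 Suc_leI One_nat_def)

lemma bits_add: "bits (a + b) \<le> bits a + bits b"
proof (rule bits_leI)
  have "a + b < 2 ^ bits a + 2 ^ bits b" using less_pow_bits[of a] less_pow_bits[of b] by linarith
  also have "(2::nat) ^ bits a \<le> 2 ^ (bits a + bits b - 1)" using bits_pos[of b] by (intro power_increasing) auto
  also have "(2::nat) ^ bits b \<le> 2 ^ (bits a + bits b - 1)" using bits_pos[of a] by (intro power_increasing) auto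
  also have "2 ^ (bits a + bits b - 1) + 2 ^ (bits a + bits b - 1) = (2::nat) ^ Suc (bits a + bits b - 1)" by simp
  also have "Suc (bits a + bits b - 1) = bits a + bits b" using bits_pos[of a] by simp
  finally show "a + b < 2 ^ (bits a + bits b)" by simp
qed (use bits_pos[of a] in simp)

lemma bits_mult: "bits (a * b) \<le> bits a + bits b"
proof (rule bits_leI)
  have "a * b < 2 ^ bits a * 2 ^ bits b"
    using less_pow_bits[of a] less_pow_bits[of b] by (intro mult_strict_mono) auto
  then show "a * b < 2 ^ (bits a + bits b)" by (simp add: power_add)
qed (use bits_pos[of a] in simp)

lemma bits_le_self: "1 \<le> k \<Longrightarrow> bits k \<le> k" by (rule bits_leI) auto

lemma bits_mono: "a \<le> b \<Longrightarrow> bits a \<le> bits b"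
  using less_pow_bits[of b] bits_pos[of b] by (intro bits_leI) auto

section \<open>Number of steps and bit lengths\<close>

context gik_dp
begin

lemma exec_solve:
  assumes "fresh s" "bnd Vb s"
  shows "\<exists>k s'. exec solve s k s' \<and> k \<le> total_cost * bits Vb \<and>
    out_inv (snd (snd (snd (st (M * Y * opts))))) (n * T) s'"
  using triple_solve assms unfolding triple_def by blast

lemma total_cost_le:
  "csz (select k) + total_cost \<le> cost_const * (M * Y * opts * ((n + 1) * (T + 1)))"
proof -
  define R where "R = M * Y * opts"
  define D where "D = 3 * (R * ((n + 1) * (T + 1)))"
  have pos: "0 < R" unfolding R_def using M_pos Y_pos opts_pos by simp
  have nY: "n + 1 \<le> Y" unfolding Y_def using M_pos by (intro le_mult_pos) auto
  have R1: "Y * opts \<le> R" "M \<le> R" "opts \<le> Y * opts" "Y \<le> Y * opts" unfolding R_def using M_pos Y_pos opts_pos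
    by (simp_all add: mult.assoc)
  have XO: "X \<le> opts" unfolding opts_def by simp
  have TO: "T \<le> opts" unfolding opts_def using X_pos by (metis One_nat_def Suc_leI add_leD1 le_trans mult_1 mult_le_mono1)
  have "n * T \<le> Y * opts" using nY TO by (intro mult_mono) auto
  \<comment> \<open>Source of the factor 3 in \<open>cost_const\<close>: it covers the iteration
    counts of all loops outside the main body, final tests included.\<close>
  then have N: "n + 1 \<le> 3 * R" "K * J + 1 \<le> 3 * R" "X + n + 1 \<le> 3 * R" "M + 1 \<le> 3 * R" "n * T + 1 \<le> 3 * R" "R + 1 \<le> 3 * R"
    using R1 nY XO pos unfolding X_def by linarith+
  have D: "x \<le> 3 * R \<Longrightarrow> c * x \<le> c * D" for c x
  proof -
    assume "x \<le> 3 * R"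
    also have "3 * R \<le> 3 * R * ((n + 1) * (T + 1))" by (rule le_mult_pos) auto
    also have "\<dots> = D" by (simp only: D_def mult.assoc)
    finally show ?thesis by (rule mult_left_mono) simp
  qed
  have D1: "c \<le> c * D" for c using D[of 1 c] pos by simp
  have lc: "loop_cost N i b \<le> (i + bsz b + 1) * D" if "N + 1 \<le> 3 * R" for N i b
    using loop_cost_le[of N i b] D[OF that, of "i + bsz b + 1"] by linarith
  define s1 where "s1 = csz sum_init + csz sum_body + bsz (Less (Var ''i'') (Var ''n'')) + 1 + csz test_end"
  have "sum_cost \<le> s1 * (n + 1)"
    using loop_cost_le[of n "csz sum_body" "Less (Var ''i'') (Var ''n'')"]
    unfolding sum_cost_def s1_def by (simp add: algebra_simps)
  define b2 where "b2 = bsz (Less (Var ''t'') (Plus (Var ''T'') (Const 1))) + 1"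
  define s2 where "s2 = csz test_init + s1 + b2 + csz best_update + csz push"
  have "loop_cost T sum_cost (Less (Var ''t'') (Plus (Var ''T'') (Const 1))) \<le> (sum_cost + b2) * (T + 1)"
    using loop_cost_le[of T sum_cost "Less (Var ''t'') (Plus (Var ''T'') (Const 1))"] unfolding b2_def by simp
  also have "\<dots> \<le> (s1 * (n + 1) + b2 * (n + 1)) * (T + 1)"
    using \<open>sum_cost \<le> s1 * (n + 1)\<close> by (intro mult_right_mono add_mono) auto
  also have "\<dots> = (s1 + b2) * ((n + 1) * (T + 1))" by (simp only: add_mult_distrib mult.assoc)
  finally have l2: "loop_cost T sum_cost (Less (Var ''t'') (Plus (Var ''T'') (Const 1))) \<le> (s1 + b2) * ((n + 1) * (T + 1))" .
  have "x \<le> x * ((n + 1) * (T + 1))" for x by (rule le_mult_pos) auto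
  from this[of "csz test_init + csz best_update + csz push"] l2
  have tc: "test_cost \<le> s2 * ((n + 1) * (T + 1))"
    unfolding test_cost_def s2_def by (simp only: add_mult_distrib)
  define b3 where "b3 = bsz (Less (Var ''u'') (Var ''N'')) + 1"
  have "loop_cost R test_cost (Less (Var ''u'') (Var ''N'')) \<le> (test_cost + b3) * (R + 1)"
    using loop_cost_le[of R test_cost "Less (Var ''u'') (Var ''N'')"] unfolding b3_def by simp
  also have "\<dots> \<le> (s2 * ((n + 1) * (T + 1)) + b3 * ((n + 1) * (T + 1))) * (3 * R)"
    by (rule mult_le_mono[OF add_mono[OF tc le_mult_pos[OF order_refl]] N(6)]) simp
  also have "\<dots> = (s2 + b3) * D" unfolding D_def by (simp add: algebra_simps)
  finally have l3: "loop_cost (M * Y * opts) test_cost (Less (Var ''u'') (Var ''N'')) \<le> (s2 + b3) * D"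
    unfolding R_def .
  note ls = lc[OF N(1), of "csz scan_body" "Less (Var ''k'') (Var ''n'')"]
    lc[OF N(2), of "csz thr_body" "Not (Less (Times (Const 2) (Var ''sw'')) (Var ''h''))"]
    lc[OF N(3), of "csz pow_body" "Less (Var ''k'') (Plus (Var ''X'') (Var ''n''))"]
    lc[OF N(4), of "csz root_body" "Less (Var ''y'') (Var ''M'')"]
    lc[OF N(5), of "csz out_body" "Less (Var ''k'') (Times (Var ''n'') (Var ''T''))"]
  have "csz (select k) + total_cost \<le> (csz (select 0) + csz scan_init + csz thr_init + csz pow_init + csz root_init + csz main_init + csz out_init) * D
     + (csz scan_body + bsz (Less (Var ''k'') (Var ''n'')) + 1) * D
     + (csz thr_body + bsz (Not (Less (Times (Const 2) (Var ''sw'')) (Var ''h''))) + 1) * D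
     + (csz pow_body + bsz (Less (Var ''k'') (Plus (Var ''X'') (Var ''n''))) + 1) * D
     + (csz root_body + bsz (Less (Var ''y'') (Var ''M'')) + 1) * D
     + (csz out_body + bsz (Less (Var ''k'') (Times (Var ''n'') (Var ''T''))) + 1) * D
     + (s2 + b3) * D"
    using ls l3 D1[of "csz (select 0) + csz scan_init + csz thr_init + csz pow_init + csz root_init + csz main_init + csz out_init"]
    unfolding total_cost_def csz_select[of k] by linarith
  also have "\<dots> = (csz (select 0) + csz scan_init + csz thr_init + csz pow_init + csz root_init + csz main_init + csz out_init
     + (csz scan_body + bsz (Less (Var ''k'') (Var ''n'')) + 1)
     + (csz thr_body + bsz (Not (Less (Times (Const 2) (Var ''sw'')) (Var ''h''))) + 1)
     + (csz pow_body + bsz (Less (Var ''k'') (Plus (Var ''X'') (Var ''n''))) + 1)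
     + (csz root_body + bsz (Less (Var ''y'') (Var ''M'')) + 1)
     + (csz out_body + bsz (Less (Var ''k'') (Times (Var ''n'') (Var ''T''))) + 1)
     + (s2 + b3)) * D"
    by (simp only: add_mult_distrib)
  also have "\<dots> = cost_const * (R * ((n + 1) * (T + 1)))"
    unfolding cost_const_def D_def s2_def s1_def b2_def b3_def by (simp only: ac_simps)
  finally show ?thesis unfolding R_def .
qed

definition isize where "isize = input_size I"

lemma isize_bounds: "n \<le> isize" "T \<le> isize" "n * T \<le> isize" "bits (w_max I) \<le> isize" "bits (p_max I) \<le> isize" "bits (W_max I) \<le> isize" "1 \<le> isize"
proof -
  have "n * 1 \<le> n * bits (w_max I)" "1 * bits (w_max I) \<le> n * bits (w_max I)"
    using bits_pos n1 by (intro mult_mono; simp)+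
  moreover have "n * T * 1 \<le> n * T * bits (p_max I)" "(1 * 1) * bits (p_max I) \<le> n * T * bits (p_max I)"
    using bits_pos n1 T1 by (intro mult_mono; simp)+
  moreover have "T * 1 \<le> T * bits (W_max I)" "1 * bits (W_max I) \<le> T * bits (W_max I)"
    using bits_pos T1 by (intro mult_mono; simp)+
  ultimately show "n \<le> isize" "T \<le> isize" "n * T \<le> isize" "bits (w_max I) \<le> isize" "bits (p_max I) \<le> isize" "bits (W_max I) \<le> isize" "1 \<le> isize"
    using n1 unfolding isize_def input_size_def by linarith+
qed

lemma sw_le: "sw \<le> n * w_max I"
proof -
  have "sw \<le> (\<Sum>i<n. w_max I)" unfolding sw_def w_max_def by (intro sum_mono Max_ge) auto
  then show ?thesis by simp
qed

lemma J_le: "J \<le> 4 * isize"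
proof -
  obtain j where j: "J = Suc j" using J_pos by (cases J) auto
  have "2 ^ j \<le> wm * 2 ^ j" using wm_pos by simp
  also have "\<dots> \<le> 2 * sw" using J_least[of j] j by simp
  also have "\<dots> \<le> 2 * (n * w_max I)" using sw_le by simp
  also have "\<dots> < 2 ^ bits (2 * (n * w_max I))" by (rule less_pow_bits)
  finally have "j < bits (2 * (n * w_max I))" by simp
  also have "\<dots> \<le> bits 2 + (bits n + bits (w_max I))"
    using bits_mult[of 2 "n * w_max I"] bits_mult[of n "w_max I"] by linarith
  also have "\<dots> \<le> 2 + (isize + isize)"
    using bits_le_self[of 2] bits_le_self[OF n1] isize_bounds by (intro add_mono) auto
  finally show ?thesis using j isize_bounds(7) by linarith
qed

text \<open>Common yardstick for polynomial factors: \<open>n\<close>, \<open>T\<close>,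
  \<open>K\<close> and the input size are all at most \<open>Q\<close>.\<close>

definition Q where "Q = K * isize"

lemma Q_bounds: "16 \<le> Q" "4 * isize \<le> Q" "K \<le> Q" "K * n \<le> Q" "n + 1 \<le> Q" "T + 1 \<le> Q" "n * T \<le> Q" "isize \<le> Q"
proof -
  have "16 * isize \<le> Q" unfolding Q_def using K16 by (intro mult_right_mono) auto
  then show "16 \<le> Q" "4 * isize \<le> Q" "n + 1 \<le> Q" "T + 1 \<le> Q" "n * T \<le> Q" "isize \<le> Q" using isize_bounds by linarith+
  show "K \<le> Q" "K * n \<le> Q" unfolding Q_def using isize_bounds by auto
qed

lemma Q_pow: "i \<le> j \<Longrightarrow> Q ^ i \<le> Q ^ j" using Q_bounds(1) by (intro power_increasing) auto

lemma X_le: "X \<le> Q ^ 2"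
proof -
  have "X \<le> Q * Q" unfolding X_def using J_le Q_bounds by (intro mult_mono) auto
  then show ?thesis by (simp add: power2_eq_square)
qed

lemma B_le: "B \<le> Q ^ 3"
proof -
  have "2 * T + 2 \<le> Q" using Q_bounds(2) isize_bounds(2,7) by linarith
  then have "2 * (T + 1) \<le> Q" by simp
  then have "K * n * n * (2 * (T + 1)) \<le> Q * Q * Q" using Q_bounds by (intro mult_mono) auto
  then show ?thesis unfolding B_def by (simp add: power3_eq_cube algebra_simps)
qed

lemma opts_le: "opts \<le> Q ^ 3"
proof -
  have "opts \<le> Q ^ 2 * Q" unfolding opts_def using X_le Q_bounds by (intro mult_mono) auto
  then show ?thesis by (simp add: power3_eq_cube power2_eq_square)
qed

text \<open>Stored values can be as large as \<open>B ^ (X + n)\<close> or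
  \<open>M * Y * opts\<close>, but \<open>X + n\<close> and \<open>bits B\<close> are polynomial in
  \<open>Q\<close>, and so are their bit lengths.\<close>

lemma bits_Vb: "bits Vb \<le> Q ^ 9"
proof -
  have bB: "bits B \<le> Q ^ 3" using bits_le_self[of B] B_bounds(3) B_le by linarith
  have Q1: "Q = Q ^ 1" by simp
  have QQ: "2 * Q ^ i \<le> Q ^ Suc i" "3 * Q ^ i \<le> Q ^ Suc i" for i using Q_bounds(1) by simp_all
  have bMn: "bits (B ^ (X + n)) \<le> Q ^ 6"
  proof -
    have "bits (B ^ (X + n)) \<le> (X + n) * bits B" using X_pos by (intro bits_le_pow) auto
    also have "\<dots> \<le> (Q ^ 2 + Q ^ 2) * Q ^ 3" using X_le bB Q_bounds(5) Q_pow[of 1 2] by (intro mult_mono add_mono) auto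
    also have "\<dots> = 2 * Q ^ 5" by (simp add: algebra_simps flip: power_add)
    also have "\<dots> \<le> Q ^ 6" using QQ(1)[of 5] by simp
    finally show ?thesis .
  qed
  have bM: "bits M \<le> Q ^ 6"
  proof -
    have "M \<le> B ^ (X + n)" unfolding M_def using B_bounds(3) by (intro power_increasing) auto
    then show ?thesis using bits_mono bMn le_trans by blast
  qed
  have small: "bits k \<le> Q ^ 3" if "k \<le> Q ^ 3" for k
    using bits_le_self[of k] that bits_mono[of 0 1] bits_le_self[of 1] Q_bounds(1)
    by (cases "k = 0") (auto simp: bits_def intro: le_trans)
  have s3: "k \<le> Q ^ 3" if "k \<le> Q" for k using that Q_pow[of 1 3] by simp
  have bY: "bits Y \<le> 2 * Q ^ 6"
    using bits_mult[of "n + 1" M] small[OF s3[OF Q_bounds(5)]] bM Q_pow[of 3 6] unfolding Y_def by simp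
  have bR: "bits (M * Y * opts) \<le> 4 * Q ^ 6"
    using bits_mult[of "M * Y" opts] bits_mult[of M Y] bM bY small[OF opts_le] Q_pow[of 3 6] by linarith
  have "2 * (K * n) \<le> Q * Q" using Q_bounds(1,4) by (intro mult_mono) auto
  then have "2 * K * n \<le> Q ^ 2" by (simp add: power2_eq_square)
  then have "2 * K * n \<le> Q ^ 3" using Q_pow[of 2 3] by linarith
  then have bKM: "bits (2 * K * n * M) \<le> 2 * Q ^ 6"
    using bits_mult[of "2 * K * n" M] small[of "2 * K * n"] bM Q_pow[of 3 6] by simp
  have q36: "Q \<le> Q ^ 6" using Q_pow[of 1 6] by simp
  have "bits (4 * sw) \<le> bits (4 * (n * w_max I))" using sw_le by (intro bits_mono) simp
  also have "\<dots> \<le> bits 4 + (bits n + bits (w_max I))"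
    using bits_mult[of 4 "n * w_max I"] bits_mult[of n "w_max I"] by linarith
  also have "\<dots> \<le> 4 + (n + isize)" using bits_le_self[of 4] bits_le_self[OF n1] isize_bounds by (intro add_mono) auto
  also have "\<dots> \<le> 3 * Q" using Q_bounds by linarith
  finally have bsw: "bits (4 * sw) \<le> 3 * Q ^ 6" using q36 by linarith
  have bp: "bits (p_max I) \<le> Q ^ 6" using isize_bounds(5) Q_bounds(8) q36 by linarith
  have bnp: "bits (n * p_max I) \<le> 2 * Q ^ 6"
    using bits_mult[of n "p_max I"] bits_le_self[OF n1] bp Q_bounds(5) q36 by linarith
  have bW: "bits (W_max I) \<le> Q ^ 6" using isize_bounds(6) Q_bounds(8) q36 by linarith
  have sm: "bits k \<le> Q ^ 6" if "k \<le> Q ^ 3" for k using small[OF that] Q_pow[of 3 6] by linarith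
  have X3: "X \<le> Q ^ 3" using X_le Q_pow[of 2 3] by linarith
  note sms = sm[OF B_le] sm[OF X3] sm[OF opts_le] sm[OF s3[of n]] sm[OF s3[of T]] sm[OF s3[of K]] sm[OF s3[of "n * T"]] sm[OF s3[of 16]]
  have "bits Vb \<le> bits (4 * sw) + bits (B ^ (X + n)) + bits (M * Y * opts) + bits (2 * K * n * M) + bits (n * p_max I) +
     bits (W_max I) + bits B + bits X + bits (n * T) + bits n + bits T + bits K + bits M + bits Y + bits opts + bits (p_max I) + bits 16"
    unfolding Vb_def
    by (rule order_trans[OF bits_add] add_right_mono order_refl)+
  also have "\<dots> \<le> 30 * Q ^ 6"
    using bsw bMn bR bKM bnp bW sms bM bY bp Q_bounds by linarith
  also have "\<dots> \<le> Q ^ 2 * Q ^ 6"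
  proof (intro mult_right_mono)
    have "16 * 16 \<le> Q * Q" using Q_bounds(1) by (intro mult_mono) auto
    then show "30 \<le> Q ^ 2" by (simp add: power2_eq_square)
  qed simp
  also have "\<dots> \<le> Q ^ 9" using Q_pow[of 8 9] by (simp flip: power_add)
  finally show ?thesis .
qed

text \<open>One factor \<open>B ^ X\<close> counts the guesses, the other the load vectors. The
  power 15 consists of 6 for the remaining step count and 9 for the bit length.\<close>

lemma running_time_le:
  "(csz (select k) + total_cost) * bits Vb \<le> cost_const * B ^ (2 * X) * (K * isize) ^ 15"
proof -
  have "M * Y * opts * ((n + 1) * (T + 1)) = B ^ (2 * X) * ((n + 1) * opts * ((n + 1) * (T + 1)))"
    unfolding Y_def M_def mult_2 power_add by (simp only: ac_simps)
  also have "\<dots> \<le> B ^ (2 * X) * (Q * Q ^ 3 * (Q * Q))"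
    using Q_bounds opts_le by (intro mult_left_mono mult_mono) auto
  also have "\<dots> = B ^ (2 * X) * Q ^ 6" by (simp add: eval_nat_numeral)
  finally have 1: "M * Y * opts * ((n + 1) * (T + 1)) \<le> B ^ (2 * X) * Q ^ 6" .
  have "(csz (select k) + total_cost) * bits Vb \<le> cost_const * (B ^ (2 * X) * Q ^ 6) * Q ^ 9"
    by (intro mult_mono le_trans[OF total_cost_le mult_left_mono[OF 1]] bits_Vb) auto
  also have "\<dots> = cost_const * B ^ (2 * X) * Q ^ 15" by (simp flip: power_add add: mult.assoc)
  finally show ?thesis unfolding Q_def .
qed

lemma bnd_init: "bnd Vb (init_state I)"
proof -
  have Vb2: "2 \<le> Vb" "n \<le> Vb" "T \<le> Vb" using Vb by linarith+
  have w: "w k \<le> Vb" if "k \<in> {1..n}" for k using w_Vb[of "k - 1"] that by auto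
  have W: "W k \<le> Vb" if "k \<in> {1..T}" for k
  proof -
    have "W k \<le> W_max I" unfolding W_max_def using that by (intro Max_ge) auto
    then show ?thesis using Vb(6) by linarith
  qed
  have p: "p ((k - 1) div T + 1) ((k - 1) mod T + 1) \<le> Vb" if "k \<in> {1..n * T}" for k
  proof -
    have "(k - 1) div T < n" using that by (intro less_mult_imp_div_less) auto
    moreover have "(k - 1) mod T < T" using T1 by (intro mod_less_divisor) auto
    ultimately have "((k - 1) div T + 1, (k - 1) mod T + 1) \<in> {1..n} \<times> {1..T}" by auto
    then have "p ((k - 1) div T + 1) ((k - 1) mod T + 1) \<le> p_max I" unfolding p_max_def by (intro Max_ge) force+
    then show ?thesis using Vb(16) by linarith
  qed
  show ?thesis unfolding bnd_def init_state_def using Vb2 w W p by auto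
qed

lemma fresh_init: "fresh ((init_state I)\<lparr>var := (var (init_state I))(''K'' := K)\<rparr>)"
proof -
  have "arr (init_state I) ''p'' (i * T + t) = p (Suc i) t" if "i < n" "1 \<le> t" "t \<le> T" for i t
    using init_state_profit[of "Suc i" I t] that by (simp add: entry_def)
  then show ?thesis unfolding fresh_def base_def by (simp add: init_state_def)
qed

lemma output_chain_of:
  assumes "out_inv A (n * T) s" "t \<le> T"
  shows "output_chain I s t = chain_of A t"
proof (cases "t = 0")
  case False
  have "arr s ''S'' (entry I i t) \<noteq> 0 \<longleftrightarrow> 0 < dig A (i - 1) \<and> dig A (i - 1) \<le> t" if i: "i \<in> {1..n}" for i
  proof -
    obtain j where j: "i = Suc j" "j < n" using i by (cases i) auto
    obtain r where r: "t = Suc r" "r < T" using False assms(2) by (cases t) auto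
    have "Suc j * T \<le> n * T" using j by (intro mult_right_mono) auto
    then have "entry I i t \<le> n * T" using j r by (simp add: entry_def)
    moreover have "entry I i t - 1 = r + j * T" using j r by (simp add: entry_def)
    moreover have "shown A (r + j * T) \<longleftrightarrow> 0 < dig A (i - 1) \<and> dig A (i - 1) \<le> t"
      using j r by (auto simp: shown_def)
    moreover have "1 \<le> entry I i t" using r by (simp add: entry_def)
    ultimately show ?thesis using assms(1) unfolding out_inv_def by simp
  qed
  then show ?thesis using False by (auto simp: output_chain_def chain_of_def)
qed (simp add: output_chain_def chain_of_def)

end

lemma chain_cong:
  assumes "\<And>t. t \<le> periods I \<Longrightarrow> S t = S' t"
  shows "feasible_chain I S = feasible_chain I S'" "chain_profit I S = chain_profit I S'"
proof -
  have e: "t \<in> {1..periods I} \<Longrightarrow> S t = S' t \<and> S (t - 1) = S' (t - 1)" for t using assms by auto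
  then show "chain_profit I S = chain_profit I S'" unfolding chain_profit_def by (intro sum.cong) auto
  have "S 0 = S' 0" using assms by simp
  then show "feasible_chain I S = feasible_chain I S'" unfolding feasible_chain_def chain_def using e by auto
qed

text \<open>The ratio refers to \<open>l\<close> even when \<open>L = 2\<close>: for a single item
  the output is optimal. The time refers to \<open>L\<close>, and so is independent of
  \<open>l\<close> in that case.\<close>

lemma algorithm_correct:
  assumes I: "gik_instance I" and l: "2 \<le> l"
  defines "L \<equiv> if items I = 1 then 2 else l"
  shows "\<exists>k s. exec (select (8 * l) ;; solve) (init_state I) k s \<and> feasible_chain I (output_chain I s) \<and>
     (real l - 1) * max_profit I \<le> l * real (chain_profit I (output_chain I s)) \<and>
     k \<le> cost_const * gik_dp.B I (8 * L) ^ (2 * gik_dp.X I (8 * L)) * (8 * L * input_size I) ^ 15"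
proof -
  interpret gik_dp I "8 * L" L by unfold_locales (use I l in \<open>auto simp: L_def\<close>)
  define A where "A = snd (snd (snd (st (M * Y * opts))))"
  let ?s = "(init_state I)\<lparr>var := (var (init_state I))(''K'' := 8 * L)\<rparr>"
  have n: "var (init_state I) ''n'' = n" by (simp add: init_state_def)
  \<comment> \<open>For a single item the constant \<open>8 * l\<close> may exceed
    \<open>Vb\<close>; it sits in the branch not taken, which \<open>safe\<close> does not
    inspect.\<close>
  have safe: "safe Vb (select (8 * l)) (init_state I)"
    using Vb(12,17) unfolding select_def by (auto simp: n L_def)
  have run: "run (select (8 * l)) (init_state I) = ?s" unfolding select_def by (auto simp: n L_def)
  obtain k1 where k1: "exec (select (8 * l)) (init_state I) k1 ?s" "k1 \<le> csz (select (8 * l)) * bits Vb" "bnd Vb ?s"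
    using exec_run[OF bnd_init safe] unfolding run by auto
  obtain k2 s where k2: "exec solve ?s k2 s" "k2 \<le> total_cost * bits Vb" "out_inv A (n * T) s"
    using exec_solve[OF fresh_init k1(3)] unfolding A_def by auto
  have e: "exec (select (8 * l) ;; solve) (init_state I) (k1 + k2) s" using exec.Seq[OF k1(1) k2(1)] .
  have "k1 + k2 \<le> (csz (select (8 * l)) + total_cost) * bits Vb" using k1(2) k2(2) by (simp add: add_mult_distrib)
  also have "\<dots> \<le> cost_const * B ^ (2 * X) * (8 * L * isize) ^ 15" by (rule running_time_le)
  finally have cost: "k1 + k2 \<le> cost_const * B ^ (2 * X) * (8 * L * input_size I) ^ 15" unfolding isize_def .
  obtain v a b c where st: "st (M * Y * opts) = (v, a, b, c)" by (metis prod_cases4)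
  have G: "good (M * Y * opts) (v, a, b, c)" using good_st[of "M * Y * opts"] unfolding st .
  have A: "A = c" unfolding A_def st by simp
  have fA: "feas A" "\<And>i. i < n \<Longrightarrow> dig A i \<le> T" using G sound_dig unfolding good_def A by auto
  have oc: "t \<le> T \<Longrightarrow> output_chain I s t = chain_of A t" for t using output_chain_of[OF k2(3)] .
  have feas: "feasible_chain I (output_chain I s)"
    using chain_cong(1)[of I "output_chain I s" "chain_of A"] oc feasible_chain_of[OF fA(1)] by auto
  have prof: "chain_profit I (output_chain I s) = prof A"
    using chain_cong(2)[of I "output_chain I s" "chain_of A"] oc profit_chain_of[OF fA(2)] by auto
  obtain S where S: "feasible_chain I S" "chain_profit I S = max_profit I" using max_profit_attained by blast
  have app: "(L - 1) * max_profit I \<le> L * prof A" "n = 1 \<Longrightarrow> max_profit I \<le> prof A"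
    using approximation[OF S(1) G] S(2) A by auto
  have "(l - 1) * max_profit I \<le> l * prof A"
  proof (cases "n = 1")
    case True
    then show ?thesis using app(2) by (intro mult_mono) auto
  next
    case False
    then show ?thesis using app(1) by (simp add: L_def)
  qed
  then have "real ((l - 1) * max_profit I) \<le> real (l * prof A)" by (simp only: of_nat_le_iff)
  then have "(real l - 1) * max_profit I \<le> l * real (prof A)" using l by (simp add: of_nat_diff)
  then show ?thesis using e feas prof cost by (intro exI[of _ "k1 + k2"] exI[of _ s]) auto
qed

section \<open>The exponent of the running time\<close>

context gik_dp
begin

text \<open>Here \<open>sw = wm\<close>, hence \<open>J = 2\<close> and \<open>2 * X = 64\<close>,
  and everything becomes a fixed power of the input size: 79 = 64 + 15.\<close>

lemma time_single:
  assumes "n = 1" "K = 16"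
  shows "B ^ (2 * X) * (K * isize) ^ 15 \<le> 64 ^ 64 * 16 ^ 15 * isize ^ 79"
proof -
  have "sw = wm" using assms unfolding sw_def wm_def w_min_def by (simp add: lessThan_Suc)
  have "J = 2" unfolding J_def \<open>sw = wm\<close>
  proof (rule Least_equality)
    show "2 * wm < wm * 2 ^ 2" using wm_pos by simp
    fix y assume y: "2 * wm < wm * 2 ^ y"
    have "y \<noteq> 0" using y by (cases "y = 0") auto
    moreover have "y \<noteq> 1" using y by (cases "y = 1") auto
    ultimately show "2 \<le> y" by linarith
  qed
  then have "K * J = 16 * 2" by (rule arg_cong2[OF assms(2)])
  then have X: "2 * X = 64" unfolding X_def by simp
  have K: "(K * isize) ^ 15 = (16 * isize) ^ 15" by (simp only: assms(2))
  have "2 * K * n * n * (T + 1) = 32 * (T + 1)" using assms by simp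
  then have "B = 32 * (T + 1)" unfolding B_def .
  also have "\<dots> \<le> 64 * isize" using isize_bounds(2,7) by simp
  finally have "B ^ 64 \<le> (64 * isize) ^ 64" by (rule power_mono) simp
  then have "B ^ (2 * X) * (K * isize) ^ 15 \<le> (64 * isize) ^ 64 * (16 * isize) ^ 15" unfolding X K by (rule mult_right_mono) simp
  also have "\<dots> = 64 ^ 64 * 16 ^ 15 * (isize ^ 64 * isize ^ 15)" unfolding power_mult_distrib by (simp only: ac_simps)
  also have "\<dots> = 64 ^ 64 * 16 ^ 15 * isize ^ 79" by (simp only: power_add[symmetric]) simp
  finally show ?thesis .
qed

text \<open>\<open>X\<close> is of order \<open>q * lr\<close> and \<open>ln B\<close> at most of
  order \<open>q * lT\<close>, so the exponent is of order \<open>q ^ 2 * lr * lT\<close>, well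
  below the fifth power. With two items \<open>lr\<close> and \<open>lT\<close> are at least 1/2,
  which lets additive terms and the factor \<open>K ^ 15\<close> be absorbed: 24960 + 960 is below
  26000.\<close>

lemma time_many:
  fixes q :: real
  assumes n2: "2 \<le> n" and q: "1 \<le> q" and Kq: "real K \<le> 16 * q"
  shows "real (B ^ (2 * X) * K ^ 15) \<le> real (n * T) powr (26000 * q ^ 5 * ln (real n * (real (w_max I) / real (w_min I))))"
proof -
  define lr where "lr = ln (real n * (real (w_max I) / real (w_min I)))"
  define lT where "lT = ln (real (n * T))"
  have ln2: "1 / 2 \<le> ln (2::real)" using ln2_ge_two_thirds by simp
  have wmp: "0 < real wm" using wm_pos by simp
  have "wm \<le> w_max I"
  proof -
    have "w 1 \<le> w_max I" unfolding w_max_def using n1 by (intro Max_ge) auto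
    then show ?thesis using wm_le[of 1] n1 by auto
  qed
  then have "1 \<le> real (w_max I) / real wm" using wmp by simp
  then have nr: "2 \<le> real n * (real (w_max I) / real wm)" using n2 mult_mono[of 2 "real n" 1 "real (w_max I) / real wm"] by simp
  then have "ln 2 \<le> lr" unfolding lr_def wm_def by (subst ln_le_cancel_iff) auto
  then have l: "1 / 2 \<le> lr" using ln2 by linarith
  have nT2: "2 \<le> n * T" using n2 T1 by (metis le_trans mult.right_neutral mult_le_mono2)
  then have nT2r: "2 \<le> real (n * T)" by (metis of_nat_le_iff of_nat_numeral)
  then have "ln 2 \<le> lT" unfolding lT_def by (subst ln_le_cancel_iff) linarith+
  then have v: "1 / 2 \<le> lT" using ln2 by linarith
  have K1: "1 \<le> real K" using K16 by simp
  have "real B \<le> 4 * real K * real (n * T) ^ 2"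
  proof -
    have "B \<le> 2 * K * n * n * (T + T)" unfolding B_def using T1 by (intro mult_left_mono) auto
    also have "\<dots> = 4 * K * n * n * T * 1" by simp
    also have "\<dots> \<le> 4 * K * n * n * T * T" using T1 by (intro mult_left_mono) auto
    also have "\<dots> = 4 * K * (n * T) ^ 2" by (simp add: power2_eq_square)
    finally have "real B \<le> real (4 * K * (n * T) ^ 2)" by (simp only: of_nat_le_iff)
    then show ?thesis by simp
  qed
  then have "ln (real B) \<le> ln (4 * real K * real (n * T) ^ 2)"
    using B_bounds(3) K1 nT2 by (subst ln_le_cancel_iff) auto
  also have "\<dots> = ln (4 * real K) + 2 * lT"
    unfolding lT_def using K1 nT2 n2 T1 by (subst ln_mult_pos) (auto simp: ln_realpow)
  \<comment> \<open>A crude linear bound for the logarithm; it costs one factor \<open>q\<close> in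
    the exponent.\<close>
  also have "ln (4 * real K) \<le> 4 * real K" using ln_le_minus_one[of "4 * real K"] K1 by linarith
  also have "4 * real K + 2 * lT \<le> 64 * q + 2 * lT" using Kq by simp
  also have "\<dots> \<le> 128 * (q * lT) + 2 * (q * lT)"
  proof -
    have "q * (1 / 2) \<le> q * lT" using v q by (intro mult_left_mono) auto
    moreover have "1 * lT \<le> q * lT" using v q by (intro mult_right_mono) auto
    ultimately show ?thesis by linarith
  qed
  finally have lB: "ln (real B) \<le> 130 * (q * lT)" by linarith
  obtain j where j: "J = Suc j" using J_pos by (cases J) auto
  have "wm * 2 ^ j \<le> 2 * (n * w_max I)" using J_least[of j] j sw_le by simp
  then have "real wm * 2 ^ j \<le> 2 * (real n * real (w_max I))"
    by (metis (mono_tags, lifting) of_nat_le_iff of_nat_mult of_nat_numeral of_nat_power)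
  then have "2 ^ j \<le> 2 * (real n * (real (w_max I) / real wm))" using wmp by (simp add: field_simps)
  then have "ln (2 ^ j) \<le> ln (2 * (real n * (real (w_max I) / real wm)))" using nr by (subst ln_le_cancel_iff) auto
  also have "\<dots> = ln 2 + lr" unfolding lr_def wm_def[symmetric] using nr by (subst ln_mult_pos) auto
  finally have "real j * ln 2 \<le> ln 2 + lr" by (simp add: ln_realpow)
  then have "(real j - 1) * ln 2 \<le> lr" by (simp add: algebra_simps)
  then have "real j - 1 \<le> 2 * lr"
  proof (cases "1 \<le> real j")
    case True
    then have "(real j - 1) * (1 / 2) \<le> (real j - 1) * ln 2" using ln2 by (intro mult_left_mono) auto
    also have "\<dots> \<le> lr" by fact
    finally show ?thesis by simp
  next
    case False
    then show ?thesis using l by linarith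
  qed
  \<comment> \<open>\<open>J = j + 1\<close> is at most \<open>2 * lr + 2\<close>, and
    \<open>2 \<le> 4 * lr\<close>.\<close>
  then have J: "real J \<le> 6 * lr" using j l by simp
  have X: "real X \<le> 96 * (q * lr)"
  proof -
    have "real X \<le> (16 * q) * (6 * lr)" unfolding X_def of_nat_mult using Kq J q by (intro mult_mono) auto
    then show ?thesis by simp
  qed
  have lB0: "0 \<le> ln (real B)" using B_bounds(3) by simp
  have "real (2 * X) * ln (real B) \<le> (192 * (q * lr)) * (130 * (q * lT))"
  proof (rule mult_mono[OF _ lB _ lB0])
    show "real (2 * X) \<le> 192 * (q * lr)" unfolding of_nat_mult of_nat_numeral using X by linarith
    show "0 \<le> 192 * (q * lr)" using q l by simp
  qed
  then have 1: "real (2 * X) * ln (real B) \<le> 24960 * (q ^ 2 * (lr * lT))" by (simp add: power2_eq_square algebra_simps)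
  have lv: "1 / 4 \<le> lr * lT" using mult_mono[OF l v] l by simp
  then have "0 \<le> lr * lT" by linarith
  then have nn: "0 \<le> q ^ 2 * (lr * lT)" by (rule mult_nonneg_nonneg[OF zero_le_power2])
  have "15 * ln (real K) \<le> 15 * real K" using ln_le_minus_one[of "real K"] K1 by simp
  also have "\<dots> \<le> 240 * q" using Kq by simp
  also have "\<dots> \<le> 960 * (q * (lr * lT))"
  proof -
    have "q * (1 / 4) \<le> q * (lr * lT)" using q by (intro mult_left_mono[OF lv]) simp
    then show ?thesis by linarith
  qed
  also have "\<dots> \<le> 960 * (q ^ 2 * (lr * lT))"
    using power_increasing[of 1 2 q] q lv by (intro mult_left_mono mult_right_mono) auto
  finally have 2: "real (2 * X) * ln (real B) + 15 * ln (real K) \<le> 26000 * (q ^ 2 * (lr * lT))"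
    using 1 nn by linarith
  also have "\<dots> \<le> 26000 * (q ^ 5 * (lr * lT))"
    using power_increasing[of 2 5 q] q lv by (intro mult_left_mono mult_right_mono) auto
  finally have 3: "real (2 * X) * ln (real B) + 15 * ln (real K) \<le> 26000 * q ^ 5 * lr * lT" by (simp add: mult.assoc)
  have B0: "0 < real B" using B_bounds(3) by simp
  have "real (B ^ (2 * X) * K ^ 15) = exp (real (2 * X) * ln (real B) + 15 * ln (real K))"
  proof -
    have "exp (real (2 * X) * ln (real B)) = real B ^ (2 * X)" using exp_of_nat_mult[of "2 * X" "ln (real B)"] B0 by simp
    moreover have "exp (15 * ln (real K)) = real K ^ 15" using exp_of_nat_mult[of 15 "ln (real K)"] K1 by simp
    ultimately show ?thesis by (simp add: exp_add)
  qed
  also have "\<dots> \<le> exp (26000 * q ^ 5 * lr * lT)" using 3 by simp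
  also have "\<dots> = real (n * T) powr (26000 * q ^ 5 * lr)" using nT2 n1 T1 by (auto simp: powr_def lT_def)
  finally show ?thesis unfolding lr_def .
qed

end

theorem theorem4:
  shows "\<exists>(C::real) (c::real) (d::nat). C > 0 \<and> c > 0 \<and>
    (\<forall>\<epsilon>::real. 0 < \<epsilon> \<and> \<epsilon> < 1 \<longrightarrow>
      (\<exists>alg::com. \<forall>I::gik. gik_instance I \<longrightarrow>
        (\<exists>(k::nat) (s::state).
          exec alg (init_state I) k s \<and>
          feasible_chain I (output_chain I s) \<and>
          real (chain_profit I (output_chain I s)) \<ge> (1 - \<epsilon>) * real (max_profit I) \<and>
          real k \<le> C *
            (real (items I * periods I) powr
              (c * (1 / \<epsilon> ^ 5) * ln (real (items I) * (real (w_max I) / real (w_min I))))) *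
            real (input_size I) ^ d)))"
proof -
  define C :: nat where "C = cost_const * (64 ^ 64 * 16 ^ 15)"
  have "0 < cost_const" by (simp add: cost_const_def)
  then have C: "0 < real C" "cost_const \<le> C" by (simp_all add: C_def)
  have main: "\<exists>alg. \<forall>I. gik_instance I \<longrightarrow>
        (\<exists>k s. exec alg (init_state I) k s \<and> feasible_chain I (output_chain I s) \<and>
          real (chain_profit I (output_chain I s)) \<ge> (1 - \<epsilon>) * real (max_profit I) \<and>
          real k \<le> real C * (real (items I * periods I) powr
              (26000 * (1 / \<epsilon> ^ 5) * ln (real (items I) * (real (w_max I) / real (w_min I))))) *
            real (input_size I) ^ 79)"
    if eps: "0 < \<epsilon>" "\<epsilon> < 1" for \<epsilon> :: real
  proof -
    define q where "q = 1 / \<epsilon>"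
    \<comment> \<open>Rounding up makes \<open>1 / l\<close> at most \<epsilon>; and as
      \<open>q > 1\<close> gives \<open>l < 2 * q\<close>, the number \<open>8 * l\<close> of slots
      per round stays below \<open>16 * q\<close>.\<close>
    define l where "l = nat \<lceil>q\<rceil>"
    have q: "1 < q" unfolding q_def using eps by simp
    have lq: "q \<le> real l" "real l < q + 1" unfolding l_def using q by linarith+
    have l2: "2 \<le> l" using lq(1) q by linarith
    have gap: "(1 - \<epsilon>) * m \<le> y" if "(real l - 1) * m \<le> l * y" "0 \<le> m" for m y :: real
    proof -
      have l0: "0 < real l" using l2 by simp
      have "1 \<le> real l * \<epsilon>" using lq(1) eps unfolding q_def by (simp add: field_simps)
      then have "(1 - \<epsilon>) * real l \<le> real l - 1" by (simp add: algebra_simps)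
      then have "(1 - \<epsilon>) * real l * m \<le> (real l - 1) * m" using that(2) by (rule mult_right_mono)
      also have "\<dots> \<le> l * y" by fact
      finally have "real l * ((1 - \<epsilon>) * m) \<le> real l * y" by (simp add: algebra_simps)
      then show ?thesis using l0 by simp
    qed
    have "\<exists>k s. exec (select (8 * l) ;; solve) (init_state I) k s \<and> feasible_chain I (output_chain I s) \<and>
          real (chain_profit I (output_chain I s)) \<ge> (1 - \<epsilon>) * real (max_profit I) \<and>
          real k \<le> real C * (real (items I * periods I) powr
              (26000 * (1 / \<epsilon> ^ 5) * ln (real (items I) * (real (w_max I) / real (w_min I))))) *
            real (input_size I) ^ 79"
      if I: "gik_instance I" for I
    proof -
      define L where "L = (if items I = 1 then 2 else l)"
      interpret gik_dp I "8 * L" L by unfold_locales (use I l2 in \<open>auto simp: L_def\<close>)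
      obtain k s where ks: "exec (select (8 * l) ;; solve) (init_state I) k s" "feasible_chain I (output_chain I s)"
         "(real l - 1) * max_profit I \<le> l * real (chain_profit I (output_chain I s))"
         "k \<le> cost_const * B ^ (2 * X) * (8 * L * isize) ^ 15"
        using algorithm_correct[OF I l2] unfolding L_def isize_def by blast
      have "real k \<le> real C * (real (n * T) powr
              (26000 * (1 / \<epsilon> ^ 5) * ln (real n * (real (w_max I) / real (w_min I))))) * real isize ^ 79"
      proof (cases "n = 1")
        case True
        then have "w_max I = w_min I" "0 < w_min I" using wm_pos unfolding wm_def by (simp_all add: w_max_def w_min_def)
        then have "ln (real n * (real (w_max I) / real (w_min I))) = 0" using True by simp
        moreover have "k \<le> C * isize ^ 79"
        proof -
          have "8 * L = 16" using True by (simp add: L_def)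
          from time_single[OF True this]
          have "cost_const * (B ^ (2 * X) * (8 * L * isize) ^ 15) \<le> cost_const * (64 ^ 64 * 16 ^ 15 * isize ^ 79)"
            by (rule mult_left_mono) simp
          then show ?thesis using ks(4) unfolding C_def mult.assoc by (rule le_trans[rotated])
        qed
        then have "real k \<le> real (C * isize ^ 79)" by (simp only: of_nat_le_iff)
        ultimately show ?thesis using True T1 by simp
      next
        case False
        then have n2: "2 \<le> n" using n1 by simp
        have "real (8 * L) \<le> 16 * q" using lq(2) q False by (simp add: L_def)
        from time_many[OF n2 _ this] q
        have 1: "real (B ^ (2 * X) * (8 * L) ^ 15) \<le> real (n * T) powr (26000 * q ^ 5 * ln (real n * (real (w_max I) / real (w_min I))))"
          (is "_ \<le> ?P") by simp
        have "real k \<le> real (cost_const * (B ^ (2 * X) * (8 * L) ^ 15) * isize ^ 15)"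
          using ks(4) by (simp only: of_nat_le_iff power_mult_distrib mult.assoc)
        also have "\<dots> = real cost_const * real (B ^ (2 * X) * (8 * L) ^ 15) * real isize ^ 15" by simp
        also have "\<dots> \<le> real C * ?P * real isize ^ 79"
          using C(2) 1 isize_bounds(7) by (intro mult_mono power_increasing) auto
        finally show ?thesis by (simp add: q_def power_one_over)
      qed
      then show ?thesis using ks(1,2) gap[OF ks(3)] unfolding isize_def
        by (intro exI[of _ k] exI[of _ s] conjI) auto
    qed
    then show ?thesis by blast
  qed
  show ?thesis
    using C(1) main by (intro exI[of _ "real C"] exI[of _ "26000::real"] exI[of _ "79::nat"]) auto
qed

end
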